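(* Let $L\subset\mathbb{C}^3$ be a connected special Lagrangian $3$-fold such that, at each point $x\in L$, the $SO(T_xL)$-stabilizer of the fundamental cubic $C_x$ contains a subgroup isomorphic to $SO(2)$ (a full group of rotations of $T_xL$ about some axis). Then either $L$ is an open subset of a real affine $3$-plane, or else, up to rigid motion, $L$ is an open subset of one of the Harvey–Lawson examples $$L_c=\bigl\{\,(s+i\,t)\,\mathbf{u}\ \bigm|\ \mathbf{u}\in S^2\subset\mathbb{R}^3,\ s,t\in\mathbb{R},\ t^3-3s^2t=c^3\,\bigr\}\subset\mathbb{C}^3,$$ where $c$ is a real constant.
   Context: On $\mathbb{C}^3$ use the standard structure $\omega=\frac{i}{2}\sum_k dz_k\wedge d\bar z_k$, $\Upsilon=dz_1\wedge dz_2\wedge dz_3$, the flat metric $g=\sum_k|dz_k|^2$ and the complex structure $J$ (multiplication by $i$). A (smooth) $3$-dimensional submanifold $L\subset\mathbb{C}^3$ is special Lagrangian if $\omega$ and $\operatorname{Im}\Upsilon$ pull back to $0$ on $L$; it is oriented so that $\operatorname{Re}\Upsilon$ is a positive volume form. The fundamental cubic $C$ of $L$ is the symmetric cubic form on $L$ given by $C_x(a,b,c)=g(\mathrm{II}_x(a,b),Jc)$ for $a,b,c\in T_xL$, where $\mathrm{II}$ is the second fundamental form of $L$. It is totally symmetric and traceless with respect to the induced metric, hence is a harmonic homogeneous cubic polynomial on $T_xL$. The group $SO(T_xL)\cong SO(3)$ acts on such cubics by pullback, and the stabilizer of $C_x$ is the subgroup fixing $C_x$. Rigid motion means a map $z\mapsto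 Az+b$ with $A\in SU(3)$, $b\in\mathbb{C}^3$. *)

theory Defs
  imports "HOL-Analysis.Analysis"
begin

text \<open>
  Real structures on \<open>complex ^ 3\<close> are the library ones: the inner product \<open>\<bullet>\<close> is the flat metric \<open>g\<close>,
  and linearity, affine hulls and dimensions are over the reals.
\<close>


subsection \<open>Smooth submanifolds of dimension 3\<close>

primrec Ck_on :: "nat \<Rightarrow> 'a::real_normed_vector set \<Rightarrow> ('a \<Rightarrow> 'b::real_normed_vector) \<Rightarrow> bool" where
  "Ck_on 0 S f \<longleftrightarrow> continuous_on S f"
| "Ck_on (Suc k) S f \<longleftrightarrow> (\<forall>x\<in>S. f differentiable (at x)) \<and>
     (\<forall>v. Ck_on k S (\<lambda>x. frechet_derivative f (at x) v))"

text \<open>Meant for open \<open>S\<close> in a finite-dimensional space, where controlling every directional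
  derivative controls the full derivative.\<close>

definition smooth_on :: "'a::real_normed_vector set \<Rightarrow> ('a \<Rightarrow> 'b::real_normed_vector) \<Rightarrow> bool" where
  "smooth_on S f \<longleftrightarrow> (\<forall>k. Ck_on k S f)"

definition local_parametrization ::
    "'a::euclidean_space set \<Rightarrow> (real ^ 3) set \<Rightarrow> (real ^ 3 \<Rightarrow> 'a) \<Rightarrow> bool" where
  "local_parametrization L V f \<longleftrightarrow>
     open V \<and> smooth_on V f \<and> (\<forall>q\<in>V. inj (frechet_derivative f (at q))) \<and>
     openin (top_of_set L) (f ` V) \<and> (\<exists>g. homeomorphism V (f ` V) f g)"

definition smooth_submanifold3 :: "'a::euclidean_space set \<Rightarrow> bool" where
  "smooth_submanifold3 L \<longleftrightarrow> (\<forall>x\<in>L. \<exists>V f. local_parametrization L V f \<and> x \<in> f ` V)"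

definition tangent_space :: "'a::euclidean_space set \<Rightarrow> 'a \<Rightarrow> 'a set" where
  "tangent_space L x =
     {v. \<exists>\<epsilon>>0. \<exists>\<gamma>::real \<Rightarrow> 'a. smooth_on {-\<epsilon><..<\<epsilon>} \<gamma> \<and> \<gamma> ` {-\<epsilon><..<\<epsilon>} \<subseteq> L \<and>
          \<gamma> 0 = x \<and> (\<gamma> has_vector_derivative v) (at 0)}"


subsection \<open>Special Lagrangian 3-folds\<close>

text \<open>In each coordinate the wedge product of \<open>dz\<close> and its conjugate takes \<open>(u, v)\<close> to
  \<open>u * cnj v - v * cnj u\<close>. The value of the form is real.\<close>

definition kahler_form :: "complex ^ 3 \<Rightarrow> complex ^ 3 \<Rightarrow> complex" where
  "kahler_form u v = (\<i> / 2) * (\<Sum>k\<in>UNIV. u $ k * cnj (v $ k) - v $ k * cnj (u $ k))"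

text \<open>\<open>dz\<^sub>1 \<and> dz\<^sub>2 \<and> dz\<^sub>3\<close> evaluated on three vectors.\<close>

definition holomorphic_volume :: "complex ^ 3 \<Rightarrow> complex ^ 3 \<Rightarrow> complex ^ 3 \<Rightarrow> complex" where
  "holomorphic_volume u v w = det (vector [u, v, w] :: complex ^ 3 ^ 3)"

definition special_lagrangian :: "(complex ^ 3) set \<Rightarrow> bool" where
  "special_lagrangian L \<longleftrightarrow> smooth_submanifold3 L \<and>
     (\<forall>x\<in>L. \<forall>u\<in>tangent_space L x. \<forall>v\<in>tangent_space L x. kahler_form u v = 0) \<and>
     (\<forall>x\<in>L. \<forall>u\<in>tangent_space L x. \<forall>v\<in>tangent_space L x. \<forall>w\<in>tangent_space L x.
        Im (holomorphic_volume u v w) = 0)"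


subsection \<open>The fundamental cubic and its stabilizer\<close>

text \<open>
  The second fundamental form is the normal component of \<open>D\<^sub>a Y\<close>, where \<open>Y\<close> is any tangent vector
  field of \<open>L\<close> with \<open>Y x = b\<close>. Only differentiability of \<open>Y\<close> at \<open>x\<close> is needed for this to be
  independent of \<open>Y\<close>. The derivative \<open>D\<close> within \<open>L\<close> is determined on the tangent space only, so
  \<open>a\<close> and \<open>b\<close> are meant to be tangent vectors at \<open>x\<close>.
\<close>

definition second_fundamental_form ::
    "'a::euclidean_space set \<Rightarrow> 'a \<Rightarrow> 'a \<Rightarrow> 'a \<Rightarrow> 'a" where
  "second_fundamental_form L x a b =
     (THE n. \<exists>Y D. (\<forall>y\<in>L. Y y \<in> tangent_space L y) \<and> Y x = b \<and>
        (Y has_derivative D) (at x within L) \<and>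
        n \<in> orthogonal_comp (tangent_space L x) \<and> D a - n \<in> tangent_space L x)"

definition fundamental_cubic ::
    "(complex ^ 3) set \<Rightarrow> complex ^ 3 \<Rightarrow> complex ^ 3 \<Rightarrow> complex ^ 3 \<Rightarrow> complex ^ 3 \<Rightarrow> real" where
  "fundamental_cubic L x a b c = second_fundamental_form L x a b \<bullet> (\<i> *s c)"

text \<open>
  The group \<open>SO(W)\<close> of a three-dimensional subspace \<open>W\<close>: the self-maps of \<open>W\<close> (made \<open>undefined\<close>
  off \<open>W\<close>) whose matrix in an orthonormal basis of \<open>W\<close> is in \<open>SO(3)\<close>. The basis is given as a linear
  isometry \<open>f\<close> from \<open>real ^ 3\<close> onto \<open>W\<close>, and its choice does not matter.
\<close>

definition special_orthogonal3 :: "'a::euclidean_space set \<Rightarrow> ('a \<Rightarrow> 'a) set" where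
  "special_orthogonal3 W =
     {R \<in> extensional W. \<exists>f::real ^ 3 \<Rightarrow> 'a. \<exists>A::real ^ 3 ^ 3.
        linear f \<and> (\<forall>q. norm (f q) = norm q) \<and> range f = W \<and>
        rotation_matrix A \<and> (\<forall>q. R (f q) = f (A *v q))}"

definition rotations_about :: "'a::euclidean_space set \<Rightarrow> 'a \<Rightarrow> ('a \<Rightarrow> 'a) set" where
  "rotations_about W e = {R \<in> special_orthogonal3 W. R e = e}"

definition cubic_stabilizer ::
    "(complex ^ 3) set \<Rightarrow> complex ^ 3 \<Rightarrow> (complex ^ 3 \<Rightarrow> complex ^ 3) set" where
  "cubic_stabilizer L x =
     {R \<in> special_orthogonal3 (tangent_space L x).
        \<forall>a\<in>tangent_space L x. \<forall>b\<in>tangent_space L x. \<forall>c\<in>tangent_space L x.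
          fundamental_cubic L x (R a) (R b) (R c) = fundamental_cubic L x a b c}"


subsection \<open>Rigid motions and the Harvey--Lawson examples\<close>

definition special_unitary :: "complex ^ 3 ^ 3 \<Rightarrow> bool" where
  "special_unitary A \<longleftrightarrow> map_matrix cnj (transpose A) ** A = mat 1 \<and> det A = 1"

definition rigid_motion :: "(complex ^ 3 \<Rightarrow> complex ^ 3) \<Rightarrow> bool" where
  "rigid_motion M \<longleftrightarrow> (\<exists>A b. special_unitary A \<and> M = (\<lambda>z. A *v z + b))"

definition harvey_lawson :: "real \<Rightarrow> (complex ^ 3) set" where
  "harvey_lawson c =
     {Complex s t *s (\<chi> k. complex_of_real (u $ k)) | s t (u :: real ^ 3).
        norm u = 1 \<and> t ^ 3 - 3 * s ^ 2 * t = c ^ 3}"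

end

theory Submission
  imports Defs
begin

text \<open>
  In a chart \<open>f\<close> the cubic pairs the derivative of a tangent field with \<open>\<i>\<close> times the tangent
  space, so it is symmetric because \<open>\<omega>\<close> vanishes on \<open>L\<close> and traceless because \<open>Im \<Upsilon>\<close> does.
  Invariance under the rotation by a right angle about the axis already forces it to be \<open>r\<close> times
  the zonal cubic of a unit tangent vector \<open>E\<close>. We may take \<open>r \<ge> 0\<close>; where \<open>r > 0\<close>, a cubic
  contraction of the cubic with itself is \<open>8 r\<^sup>3 E\<close>, so \<open>E\<close> and \<open>r\<close> are smooth.

  Writing \<open>\<epsilon>\<close> for the inner product with \<open>E\<close>, the normal part of \<open>d (d E) = 0\<close> gives
  \<open>d E = l df + m \<epsilon> E\<close> and \<open>d r = - 4 h r \<epsilon>\<close> with \<open>l = h - \<i> r\<close> and \<open>m = 3 \<i> r - h\<close>,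
  and then \<open>d (d E) = 0\<close> gives \<open>d l = m l \<epsilon>\<close>. Hence the centre \<open>f - E / l\<close>, the number
  \<open>k = r / norm l ^ 4\<close> and a complex symmetric matrix (the real structure whose real points are the
  3-plane of the Harvey--Lawson example) are locally constant. Since \<open>r\<close> is \<open>k\<close> divided by the
  fourth power of the distance from the centre, the cubic vanishes identically or nowhere. In the
  second case the constants determine the rigid motion; if the cubic vanishes identically, the
  tangent plane is constant.
\<close>

subsection \<open>Calculus of smooth maps\<close>

text \<open>The constants are read off from the model. At a point \<open>w u\<close> of a
  Harvey--Lawson example, with \<open>u\<close> a real unit vector and signs chosen so that
  \<open>Im (w ^ 3) > 0\<close>, the level curve of \<open>Im (w ^ 3)\<close> is tangent to
  \<open>cnj w ^ 2\<close>. So \<open>E = (cnj w / norm w) ^ 2 u\<close>, and the tangent vectors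
  across the axis are \<open>w\<close> times real vectors orthogonal to \<open>u\<close>. Then
  \<open>E / l = w u\<close> gives \<open>norm l = 1 / norm w\<close> and argument of
  \<open>l\<close> equal to -3 times that of \<open>w\<close>. Hence \<open>k\<close> is
  \<open>Im (w ^ 3)\<close>, and the phase of \<open>l\<close> to the powers -2/3 and 1/3 makes
  \<open>E\<close> and the vectors across it real, up to a common cube root of unity. The squares of
  these phases are the coefficients -4/3 and 2/3 of the conserved matrix. Two obstacles shape the
  proof. The axis is given only pointwise, by choice, so its smoothness must come from a formula
  polynomial in the cubic. At a zero of the cubic there is no axis and no structure equation, so
  zeros are excluded by a quantity that stays continuous across them.\<close>

lemma Ck_on_cong:
  assumes "open S" "\<And>x. x \<in> S \<Longrightarrow> f x = g x" "Ck_on k S f"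
  shows "Ck_on k S g"
  using assms(2,3)
proof (induction k arbitrary: f g)
  case 0
  then show ?case using continuous_on_cong by (metis Ck_on.simps(1))
next
  case (Suc k)
  have d: "(g has_derivative frechet_derivative f (at x)) (at x)" if "x \<in> S" for x
  proof -
    have "(f has_derivative frechet_derivative f (at x)) (at x)"
      using Suc.prems(2) that frechet_derivative_works by auto
    then show ?thesis
      by (rule has_derivative_transform_within_open[OF _ assms(1) that]) (use Suc.prems(1) in auto)
  qed
  have e: "frechet_derivative f (at x) = frechet_derivative g (at x)" if "x \<in> S" for x
    using frechet_derivative_at[OF d[OF that]] .
  have "Ck_on k S (\<lambda>x. frechet_derivative g (at x) v)" for v
    by (rule Suc.IH[of "\<lambda>x. frechet_derivative f (at x) v"]) (use e Suc.prems(2) in auto)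
  then show ?case using d by (auto simp: differentiable_def)
qed

lemma Ck_on_SucD: "Ck_on (Suc k) S f \<Longrightarrow> Ck_on k S f"
proof (induction k arbitrary: f)
  case 0
  then show ?case
    by (auto intro!: continuous_at_imp_continuous_on differentiable_imp_continuous_within)
next
  case (Suc k)
  then show ?case by (metis Ck_on.simps(2))
qed

text \<open>Derivatives at a point are unique, so any explicit formula \<open>f'\<close> may stand
  in for \<open>frechet_derivative\<close>. This lets the closure lemmas below run by induction on
  the order, through the usual differentiation rules.\<close>

lemma Ck_on_SucI:
  assumes "open S" "\<And>x. x \<in> S \<Longrightarrow> (f has_derivative f' x) (at x)" "\<And>v. Ck_on k S
      (\<lambda>x. f' x v)"
  shows "Ck_on (Suc k) S f"
proof -
  have "f' x = frechet_derivative f (at x)" if "x \<in> S" for x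
    using frechet_derivative_at[OF assms(2)[OF that]] .
  then have "Ck_on k S (\<lambda>x. frechet_derivative f (at x) v)" for v
    by (intro Ck_on_cong[OF assms(1) _ assms(3)[of v]]) auto
  then show ?thesis using assms(2) by (auto simp: differentiable_def)
qed

lemma Ck_on_has_derivative:
  assumes "Ck_on (Suc k) S f" "x \<in> S"
  shows "(f has_derivative frechet_derivative f (at x)) (at x)"
  using assms frechet_derivative_works by auto

lemma Ck_on_const: "open S \<Longrightarrow> Ck_on k S (\<lambda>x. c)"
proof (induction k arbitrary: c)
  case (Suc k)
  show ?case by (rule Ck_on_SucI[OF Suc.prems, where f'="\<lambda>x v. 0"]) (use Suc in auto)
qed auto

lemma Ck_on_add:
  assumes "open S" "Ck_on k S f" "Ck_on k S g"
  shows "Ck_on k S (\<lambda>x. f x + g x)"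
  using assms(2,3)
proof (induction k arbitrary: f g)
  case 0
  then show ?case by (auto intro: continuous_intros)
next
  case (Suc k)
  show ?case
    by (rule Ck_on_SucI[OF assms(1), where
          f'="\<lambda>x v. frechet_derivative f (at x) v + frechet_derivative g (at x) v"])
      (use Suc Ck_on_has_derivative[OF Suc.prems(1)] Ck_on_has_derivative[OF Suc.prems(2)]
        in \<open>auto intro!: has_derivative_add\<close>)
qed

text \<open>The product rule gives two terms of the same bilinear shape, one order lower, so the
  induction closes. Scaling, inner products and products are all instances.\<close>

lemma Ck_on_bilinear:
  assumes "open S" "bounded_bilinear B" "Ck_on k S f" "Ck_on k S g"
  shows "Ck_on k S (\<lambda>x. B (f x) (g x))"
  using assms(3,4)
proof (induction k arbitrary: f g)
  case 0
  then show ?case by (simp add: bounded_bilinear.continuous_on[OF assms(2)])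
next
  case (Suc k)
  note D = bounded_bilinear.FDERIV[OF assms(2)
      Ck_on_has_derivative[OF Suc.prems(1)] Ck_on_has_derivative[OF Suc.prems(2)]]
  have "Ck_on k S (\<lambda>x. B (f x) (frechet_derivative g (at x) v) + B (frechet_derivative f (at x) v) (g
      x))" for v
    by (intro Ck_on_add[OF assms(1)] Suc.IH)
      (use Suc.prems Ck_on_SucD[OF Suc.prems(1)] Ck_on_SucD[OF Suc.prems(2)] in auto)
  then show ?case by (intro Ck_on_SucI[OF assms(1) D])
qed

lemma Ck_on_inverse:
  fixes f :: "'a::real_normed_vector \<Rightarrow> real"
  assumes "open S" "Ck_on k S f" "\<And>x. x \<in> S \<Longrightarrow> f x \<noteq> 0"
  shows "Ck_on k S (\<lambda>x. inverse (f x))"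
  using assms(2)
proof (induction k)
  case 0
  then show ?case using assms(3) by (auto intro!: continuous_intros)
next
  case (Suc k)
  have "((\<lambda>x. inverse (f x)) has_derivative
      (\<lambda>v. - (inverse (f x) * frechet_derivative f (at x) v * inverse (f x)))) (at x)" if "x \<in> S" for x
    using Ck_on_has_derivative[OF Suc.prems that] assms(3)[OF that]
    by (auto intro!: derivative_eq_intros simp: field_simps)
  moreover have "Ck_on k S (\<lambda>x. - (inverse (f x) * frechet_derivative f (at x) v * inverse (f x)))" for v
  proof -
    have i: "Ck_on k S (\<lambda>x. inverse (f x))" using Suc Ck_on_SucD by auto
    have "Ck_on k S (\<lambda>x. (- 1) * (inverse (f x) * frechet_derivative f (at x) v * inverse (f x)))"
      by (intro Ck_on_bilinear[OF assms(1) bounded_bilinear_mult] i Ck_on_const assms(1))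
        (use Suc.prems in auto)
    then show ?thesis by simp
  qed
  ultimately show ?case by (intro Ck_on_SucI[OF assms(1)])
qed

text \<open>The derivative contains the reciprocal of the root itself, whose regularity is the
  induction hypothesis combined with \<open>Ck_on_inverse\<close>.\<close>

lemma Ck_on_sqrt:
  fixes f :: "'a::real_normed_vector \<Rightarrow> real"
  assumes "open S" "Ck_on k S f" "\<And>x. x \<in> S \<Longrightarrow> f x > 0"
  shows "Ck_on k S (\<lambda>x. sqrt (f x))"
  using assms(2)
proof (induction k)
  case 0
  then show ?case by (auto intro!: continuous_intros)
next
  case (Suc k)
  have "((\<lambda>x. sqrt (f x)) has_derivative
      (\<lambda>v. (1/2) * (inverse (sqrt (f x)) * frechet_derivative f (at x) v))) (at x)" if "x \<in> S" for x
    using Ck_on_has_derivative[OF Suc.prems that] assms(3)[OF that]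
    by (auto intro!: derivative_eq_intros simp: field_simps)
  moreover have "Ck_on k S (\<lambda>x. (1/2) * (inverse (sqrt (f x)) * frechet_derivative f (at x) v))" for v
  proof -
    have i: "Ck_on k S (\<lambda>x. sqrt (f x))" using Suc Ck_on_SucD by auto
    show ?thesis
      by (intro Ck_on_bilinear[OF assms(1) bounded_bilinear_mult] Ck_on_inverse i Ck_on_const assms(1))
        (use Suc.prems assms(3) in force)+
  qed
  ultimately show ?case by (intro Ck_on_SucI[OF assms(1)])
qed

lemma smooth_on_const: "open S \<Longrightarrow> smooth_on S (\<lambda>x. c)"
  by (simp add: smooth_on_def Ck_on_const)

lemma smooth_on_add:
  "open S \<Longrightarrow> smooth_on S f \<Longrightarrow> smooth_on S g \<Longrightarrow> smooth_on S
      (\<lambda>x. f x + g x)"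
  by (simp add: smooth_on_def Ck_on_add)

lemma smooth_on_bilinear:
  "open S \<Longrightarrow> bounded_bilinear B \<Longrightarrow> smooth_on S f \<Longrightarrow> smooth_on S g
      \<Longrightarrow> smooth_on S (\<lambda>x. B (f x) (g x))"
  by (simp add: smooth_on_def Ck_on_bilinear)

lemmas smooth_on_scaleR = smooth_on_bilinear[OF _ bounded_bilinear_scaleR]
lemmas smooth_on_inner = smooth_on_bilinear[OF _ bounded_bilinear_inner]
lemmas smooth_on_mult = smooth_on_bilinear[OF _ bounded_bilinear_mult]

lemma smooth_on_linear:
  assumes "open S" "bounded_linear h" "smooth_on S f"
  shows "smooth_on S (\<lambda>x. h (f x))"
proof -
  have "bounded_bilinear (\<lambda>(c::real) x. c *\<^sub>R h x)"
    using bounded_bilinear.comp[OF bounded_bilinear_scaleR bounded_linear_ident assms(2)] by simp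
  from smooth_on_bilinear[OF assms(1) this smooth_on_const[OF assms(1), of 1] assms(3)]
  show ?thesis by simp
qed

lemma smooth_on_diff:
  assumes "open S" "smooth_on S f" "smooth_on S g"
  shows "smooth_on S (\<lambda>x. f x - g x)"
  using smooth_on_add[OF assms(1,2) smooth_on_linear[OF assms(1) bounded_linear_minus[OF bounded_linear_ident]
      assms(3)]]
  by simp

lemma smooth_on_inverse:
  fixes f :: "'a::real_normed_vector \<Rightarrow> real"
  shows "open S \<Longrightarrow> smooth_on S f \<Longrightarrow> (\<And>x. x \<in> S \<Longrightarrow> f x
      \<noteq> 0) \<Longrightarrow> smooth_on S (\<lambda>x. inverse (f x))"
  by (simp add: smooth_on_def Ck_on_inverse)

lemma smooth_on_norm:
  fixes f :: "'a::real_normed_vector \<Rightarrow> 'b::real_inner"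
  assumes "open S" "smooth_on S f" "\<And>x. x \<in> S \<Longrightarrow> f x \<noteq> 0"
  shows "smooth_on S (\<lambda>x. norm (f x))"
proof -
  have "smooth_on S (\<lambda>x. f x \<bullet> f x)" using smooth_on_inner assms by blast
  then have "smooth_on S (\<lambda>x. sqrt (f x \<bullet> f x))"
    using assms(1,3) by (simp add: smooth_on_def Ck_on_sqrt)
  then show ?thesis by (simp add: norm_eq_sqrt_inner)
qed

lemma smooth_on_sgn:
  fixes f :: "'a::real_normed_vector \<Rightarrow> 'b::real_inner"
  assumes "open S" "smooth_on S f" "\<And>x. x \<in> S \<Longrightarrow> f x \<noteq> 0"
  shows "smooth_on S (\<lambda>x. inverse (norm (f x)) *\<^sub>R f x)"
  by (intro smooth_on_scaleR smooth_on_inverse smooth_on_norm assms) (use assms in auto)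

lemma smooth_on_sum:
  assumes "open S" "finite I" "\<And>i. i \<in> I \<Longrightarrow> smooth_on S (f i)"
  shows "smooth_on S (\<lambda>x. \<Sum>i\<in>I. f i x)"
  using assms(2,3)
proof (induction I)
  case empty
  then show ?case by (simp add: smooth_on_const assms(1))
next
  case (insert i I)
  then show ?case by (simp add: smooth_on_add assms(1))
qed

lemma smooth_on_cong:
  "open S \<Longrightarrow> (\<And>x. x \<in> S \<Longrightarrow> f x = g x) \<Longrightarrow> smooth_on S f
      \<Longrightarrow> smooth_on S g"
  unfolding smooth_on_def using Ck_on_cong by blast

lemma smooth_on_deriv:
  "smooth_on S f \<Longrightarrow> smooth_on S (\<lambda>x. frechet_derivative f (at x) v)"
  unfolding smooth_on_def by (metis Ck_on.simps(2))

lemma smooth_on_has_derivative: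
  "smooth_on S f \<Longrightarrow> x \<in> S \<Longrightarrow> (f has_derivative frechet_derivative f (at x)) (at x)"
  unfolding smooth_on_def using Ck_on_has_derivative by blast

lemma smooth_on_continuous: "smooth_on S f \<Longrightarrow> continuous_on S f"
  unfolding smooth_on_def by (metis Ck_on.simps(1))

lemma Ck_on_subset: "Ck_on k S f \<Longrightarrow> T \<subseteq> S \<Longrightarrow> Ck_on k T f"
  by (induction k arbitrary: f) (auto intro: continuous_on_subset)

lemma smooth_on_subset: "smooth_on S f \<Longrightarrow> T \<subseteq> S \<Longrightarrow> smooth_on T f"
  unfolding smooth_on_def using Ck_on_subset by blast

text \<open>\<open>smooth_on\<close> controls derivatives in fixed directions only; expanding a
  moving direction in the standard basis reduces to those.\<close>

lemma smooth_on_deriv_dir: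
  fixes f :: "'a::euclidean_space \<Rightarrow> 'b::real_normed_vector"
  assumes S: "open S" and f: "smooth_on S f" and v: "smooth_on S v"
  shows "smooth_on S (\<lambda>x. frechet_derivative f (at x) (v x))"
proof (rule smooth_on_cong[OF S])
  show "smooth_on S (\<lambda>x. \<Sum>b\<in>Basis. (v x \<bullet> b) *\<^sub>R frechet_derivative f (at x) b)"
    by (intro smooth_on_sum smooth_on_scaleR smooth_on_inner smooth_on_deriv S f v smooth_on_const) auto
  fix x assume "x \<in> S"
  then have "linear (frechet_derivative f (at x))"
    using smooth_on_has_derivative[OF f] has_derivative_linear by blast
  then show "(\<Sum>b\<in>Basis. (v x \<bullet> b) *\<^sub>R frechet_derivative f (at x) b) =
      frechet_derivative f (at x) (v x)"
    using linear_sum[of "frechet_derivative f (at x)" "\<lambda>b. (v x \<bullet> b) *\<^sub>R b" Basis]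
    by (simp add: linear_cmul euclidean_representation)
qed

lemma smooth_on_line:
  fixes f :: "'a::real_normed_vector \<Rightarrow> 'b::real_normed_vector"
  assumes f: "smooth_on S f" and T: "open (T::real set)" and sub: "\<And>t. t \<in> T \<Longrightarrow> p + t
      *\<^sub>R v \<in> S"
  shows "smooth_on T (\<lambda>t. f (p + t *\<^sub>R v))"
proof -
  have "Ck_on k T (\<lambda>t. f (p + t *\<^sub>R v))" if "Ck_on k S f" for k f
    using that
  proof (induction k arbitrary: f)
    case 0
    then show ?case
      by (auto intro!: continuous_on_compose2[of S f] continuous_intros sub)
  next
    case (Suc k)
    have "((\<lambda>t. f (p + t *\<^sub>R v)) has_derivative
        (\<lambda>s. s *\<^sub>R frechet_derivative f (at (p + t *\<^sub>R v)) v)) (at t)" if "t \<in> T" for t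
    proof -
      have f': "(f has_derivative frechet_derivative f (at (p + t *\<^sub>R v))) (at (p + t *\<^sub>R v))"
        using Ck_on_has_derivative[OF Suc.prems sub[OF that]] .
      have l: "((\<lambda>t. p + t *\<^sub>R v) has_derivative (\<lambda>s. s *\<^sub>R v)) (at t)"
        by (auto intro!: derivative_eq_intros)
      show ?thesis
        using has_derivative_compose[OF l f'] has_derivative_linear[OF f']
        by (simp add: linear_cmul)
    qed
    moreover have "Ck_on k T (\<lambda>t. s *\<^sub>R frechet_derivative f (at (p + t *\<^sub>R v)) v)" for s
      using Suc by (intro Ck_on_bilinear[OF T bounded_bilinear_scaleR] Ck_on_const T) auto
    ultimately show ?case by (intro Ck_on_SucI[OF T])
  qed
  then show ?thesis using f unfolding smooth_on_def by blast
qed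

section \<open>Symmetry of second derivatives\<close>

lemma mean_value_mixed:
  fixes F :: "'a::real_normed_vector \<Rightarrow> real"
  assumes F: "smooth_on S F" and h: "h > 0"
    and sub: "\<And>s t. 0 \<le> s \<Longrightarrow> s \<le> h \<Longrightarrow> 0 \<le> t \<Longrightarrow> t
        \<le> h \<Longrightarrow> p + s *\<^sub>R w + t *\<^sub>R v \<in> S"
  obtains s t where "0 < s" "s < h" "0 < t" "t < h"
    "F (p + h *\<^sub>R w + h *\<^sub>R v) - F (p + h *\<^sub>R w) - F (p + h *\<^sub>R v) + F p
      = h ^ 2 * frechet_derivative (\<lambda>x. frechet_derivative F (at x) w) (at (p + s *\<^sub>R w + t
          *\<^sub>R v)) v"
proof -
  have line: "((\<lambda>t. G (q + t *\<^sub>R u)) has_real_derivative frechet_derivative G (at (q + t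
      *\<^sub>R u)) u) (at t)"
    if "smooth_on S G" "q + t *\<^sub>R u \<in> S" for G :: "'a \<Rightarrow> real" and q t u
  proof -
    have g': "(G has_derivative frechet_derivative G (at (q + t *\<^sub>R u))) (at (q + t *\<^sub>R u))"
      using smooth_on_has_derivative that by blast
    have l: "((\<lambda>t. q + t *\<^sub>R u) has_derivative (\<lambda>s. s *\<^sub>R u)) (at t)"
      by (auto intro!: derivative_eq_intros)
    show ?thesis
      using has_derivative_compose[OF l g'] has_derivative_linear[OF g']
      by (simp add: linear_cmul has_field_derivative_def mult_commute_abs)
  qed
  define G where "G = (\<lambda>x. frechet_derivative F (at x) w)"
  have G: "smooth_on S G" unfolding G_def by (rule smooth_on_deriv[OF F])
  \<comment> \<open>The second difference is an increment of the difference of \<open>F\<close>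
    along two parallel segments in direction \<open>w\<close>. One mean value step along
    \<open>w\<close> leaves a difference of \<open>G\<close> along \<open>v\<close>, to which a
    second one applies.\<close>
  define \<phi> where "\<phi> = (\<lambda>s. F ((p + h *\<^sub>R v) + s *\<^sub>R w) - F (p + s *\<^sub>R w))"
  have "\<exists>s. s > 0 \<and> s < h \<and> \<phi> h - \<phi> 0 = (h - 0) * (G ((p + h *\<^sub>R v) + s
      *\<^sub>R w) - G (p + s *\<^sub>R w))"
  proof (rule MVT2)
    fix s assume s: "0 \<le> s" "s \<le> h"
    have "p + h *\<^sub>R v + s *\<^sub>R w \<in> S" "p + s *\<^sub>R w \<in> S"
      using sub[OF s, of h] sub[OF s, of 0] h by (auto simp: ac_simps)
    then show "(\<phi> has_real_derivative G ((p + h *\<^sub>R v) + s *\<^sub>R w) - G (p + s *\<^sub>R w)) (at s)"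
      unfolding \<phi>_def G_def by (intro DERIV_diff line F)
  qed (rule h)
  then obtain s where s: "0 < s" "s < h"
    "\<phi> h - \<phi> 0 = h * (G (p + h *\<^sub>R v + s *\<^sub>R w) - G (p + s *\<^sub>R w))" by auto
  define \<psi> where "\<psi> = (\<lambda>t. G ((p + s *\<^sub>R w) + t *\<^sub>R v))"
  have "\<exists>t. t > 0 \<and> t < h \<and> \<psi> h - \<psi> 0 = (h - 0) * frechet_derivative G (at ((p + s
      *\<^sub>R w) + t *\<^sub>R v)) v"
  proof (rule MVT2)
    fix t assume t: "0 \<le> t" "t \<le> h"
    have "p + s *\<^sub>R w + t *\<^sub>R v \<in> S" using sub[of s t] s t by auto
    then show "(\<psi> has_real_derivative frechet_derivative G (at ((p + s *\<^sub>R w) + t *\<^sub>R v)) v) (at t)"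
      unfolding \<psi>_def by (intro line G)
  qed (rule h)
  then obtain t where t: "0 < t" "t < h"
    "\<psi> h - \<psi> 0 = h * frechet_derivative G (at ((p + s *\<^sub>R w) + t *\<^sub>R v)) v" by auto
  have "\<phi> h - \<phi> 0 = h * (\<psi> h - \<psi> 0)"
    using s(3) unfolding \<psi>_def by (simp add: ac_simps)
  then have "\<phi> h - \<phi> 0 = h\<^sup>2 * frechet_derivative G (at ((p + s *\<^sub>R w) + t *\<^sub>R v)) v"
    using t(3) by (simp add: power2_eq_square)
  moreover have "\<phi> h - \<phi> 0 = F (p + h *\<^sub>R w + h *\<^sub>R v) - F (p + h *\<^sub>R w) - F (p + h
      *\<^sub>R v) + F p"
    unfolding \<phi>_def by (simp add: ac_simps)
  ultimately show ?thesis using that[OF s(1,2) t(1,2)] unfolding G_def by simp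
qed

text \<open>The second difference over a square does not depend on the order of its sides. So the
  two mixed derivatives agree at points of arbitrarily small squares, and continuity carries the
  equality to \<open>p\<close>.\<close>

lemma second_derivative_symmetric_real:
  fixes F :: "'a::real_normed_vector \<Rightarrow> real"
  assumes F: "smooth_on S F" and S: "open S" and p: "p \<in> S"
  shows "frechet_derivative (\<lambda>x. frechet_derivative F (at x) w) (at p) v
       = frechet_derivative (\<lambda>x. frechet_derivative F (at x) v) (at p) w"
proof -
  define A where "A = (\<lambda>w v x. frechet_derivative (\<lambda>x. frechet_derivative F (at x) w) (at x) v)"
  have cont: "isCont (A w v) p" for w v
  proof -
    have "smooth_on S (A w v)" unfolding A_def by (intro smooth_on_deriv F)
    then show ?thesis
      using smooth_on_continuous S p continuous_on_eq_continuous_at by blast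
  qed
  have near: "\<exists>d>0. \<forall>x. dist x p < d \<longrightarrow> x \<in> S \<and> \<bar>A w v x - A w v
      p\<bar> < e" if "e > 0" for w v e
  proof -
    obtain d1 where d1: "d1 > 0" "\<And>x. dist x p < d1 \<Longrightarrow> dist (A w v x) (A w v p) < e"
      using cont \<open>e > 0\<close> unfolding continuous_at_eps_delta by blast
    obtain d2 where "d2 > 0" "ball p d2 \<subseteq> S" using S p openE by blast
    then show ?thesis
      using d1 by (intro exI[of _ "min d1 d2"]) (auto simp: dist_real_def dist_commute subset_eq)
  qed
  have "\<bar>A w v p - A v w p\<bar> < e" if e: "e > 0" for e
  proof -
    obtain d1 where d1: "d1 > 0" "\<And>x. dist x p < d1 \<Longrightarrow> x \<in> S \<and> \<bar>A w v x - A w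
        v p\<bar> < e/2"
      using near[of "e/2" w v] e by auto
    obtain d2 where d2: "d2 > 0" "\<And>x. dist x p < d2 \<Longrightarrow> x \<in> S \<and> \<bar>A v w x - A v
        w p\<bar> < e/2"
      using near[of "e/2" v w] e by auto
    define d where "d = min d1 d2"
    \<comment> \<open>With this side the whole square lies within distance \<open>d\<close> of
      \<open>p\<close>; the added 1 keeps the denominator positive.\<close>
    define h where "h = d / (2 * (norm w + norm v + 1))"
    have h: "h > 0" unfolding h_def d_def using d1 d2
      by (smt (verit) divide_pos_pos norm_ge_zero)
    have small: "dist (p + s *\<^sub>R w + t *\<^sub>R v) p < d" if "0 \<le> s" "s \<le> h" "0 \<le> t" "t
        \<le> h" for s t
    proof -
      have "dist (p + s *\<^sub>R w + t *\<^sub>R v) p \<le> norm (s *\<^sub>R w) + norm (t *\<^sub>R v)"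
        by (metis add.assoc add_diff_cancel_left' dist_norm norm_triangle_ineq)
      also have "\<dots> \<le> h * norm w + h * norm v"
        using that by (auto intro!: add_mono mult_right_mono)
      also have "\<dots> < h * (2 * (norm w + norm v + 1))"
        using h by (simp add: algebra_simps) (smt (verit) mult_nonneg_nonneg norm_ge_zero)
      also have "\<dots> = d" unfolding h_def
        by (smt (verit, ccfv_SIG) nonzero_eq_divide_eq norm_ge_zero)
      finally show ?thesis .
    qed
    have small': "dist (p + s *\<^sub>R v + t *\<^sub>R w) p < d" if "0 \<le> s" "s \<le> h" "0 \<le> t" "t
        \<le> h" for s t
      using small[OF that(3,4,1,2)] by (simp add: ac_simps)
    obtain s t where st: "0 < s" "s < h" "0 < t" "t < h"
      "F (p + h *\<^sub>R w + h *\<^sub>R v) - F (p + h *\<^sub>R w) - F (p + h *\<^sub>R v) + F p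
        = h ^ 2 * A w v (p + s *\<^sub>R w + t *\<^sub>R v)"
      using mean_value_mixed[OF F h, of p w v] small d1(2) unfolding A_def d_def
      by (metis min_less_iff_conj)
    obtain s' t' where st': "0 < s'" "s' < h" "0 < t'" "t' < h"
      "F (p + h *\<^sub>R v + h *\<^sub>R w) - F (p + h *\<^sub>R v) - F (p + h *\<^sub>R w) + F p
        = h ^ 2 * A v w (p + s' *\<^sub>R v + t' *\<^sub>R w)"
      using mean_value_mixed[OF F h, of p v w] small' d1(2) unfolding A_def d_def
      by (metis min_less_iff_conj)
    have "h ^ 2 * A w v (p + s *\<^sub>R w + t *\<^sub>R v) = h ^ 2 * A v w (p + s' *\<^sub>R v + t' *\<^sub>R w)"
      using st(5) st'(5) unfolding add.assoc add.commute[of "h *\<^sub>R v"] by linarith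
    then have eq: "A w v (p + s *\<^sub>R w + t *\<^sub>R v) = A v w (p + s' *\<^sub>R v + t' *\<^sub>R w)"
      using h by simp
    have "\<bar>A w v (p + s *\<^sub>R w + t *\<^sub>R v) - A w v p\<bar> < e/2"
      using d1(2)[of "p + s *\<^sub>R w + t *\<^sub>R v"] small[of s t] st unfolding d_def by auto
    moreover have "\<bar>A v w (p + s' *\<^sub>R v + t' *\<^sub>R w) - A v w p\<bar> < e/2"
      using d2(2)[of "p + s' *\<^sub>R v + t' *\<^sub>R w"] small'[of s' t'] st' unfolding d_def by auto
    ultimately show ?thesis using eq by linarith
  qed
  then have "A w v p = A v w p"
    by (metis eq_iff_diff_eq_0 less_irrefl zero_less_abs_iff)
  then show ?thesis unfolding A_def .
qed

lemma second_derivative_symmetric: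
  fixes f :: "'a::real_normed_vector \<Rightarrow> 'b::euclidean_space"
  assumes f: "smooth_on S f" and S: "open S" and p: "p \<in> S"
  shows "frechet_derivative (\<lambda>x. frechet_derivative f (at x) w) (at p) v
       = frechet_derivative (\<lambda>x. frechet_derivative f (at x) v) (at p) w"
proof (rule euclidean_eqI)
  fix b :: 'b assume "b \<in> Basis"
  have inner_deriv: "frechet_derivative (\<lambda>x. g x \<bullet> b) (at x) u = frechet_derivative g (at x) u
      \<bullet> b"
    if "smooth_on S g" "x \<in> S" for g :: "'a \<Rightarrow> 'b" and x u
  proof -
    have "((\<lambda>x. g x \<bullet> b) has_derivative (\<lambda>u. frechet_derivative g (at x) u \<bullet>
        b)) (at x)"
      by (intro has_derivative_inner_left smooth_on_has_derivative[OF that])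
    then show ?thesis using frechet_derivative_at by metis
  qed
  have F: "smooth_on S (\<lambda>x. f x \<bullet> b)" by (intro smooth_on_inner S f smooth_on_const)
  have "frechet_derivative (\<lambda>x. frechet_derivative (\<lambda>x. f x \<bullet> b) (at x) w) (at p) v
      = frechet_derivative (\<lambda>x. frechet_derivative f (at x) w) (at p) v \<bullet> b" for w v
  proof -
    have g: "smooth_on S (\<lambda>x. frechet_derivative f (at x) w)" by (rule smooth_on_deriv[OF f])
    have "((\<lambda>x. frechet_derivative f (at x) w \<bullet> b) has_derivative
        (\<lambda>v. frechet_derivative (\<lambda>x. frechet_derivative f (at x) w) (at p) v \<bullet> b)) (at p)"
      by (intro has_derivative_inner_left smooth_on_has_derivative[OF g p])
    then have "((\<lambda>x. frechet_derivative (\<lambda>x. f x \<bullet> b) (at x) w) has_derivative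
        (\<lambda>v. frechet_derivative (\<lambda>x. frechet_derivative f (at x) w) (at p) v \<bullet> b)) (at p)"
      by (rule has_derivative_transform_within_open[OF _ S p]) (simp add: inner_deriv[OF f])
    then show ?thesis using frechet_derivative_at by metis
  qed
  then show "frechet_derivative (\<lambda>x. frechet_derivative f (at x) w) (at p) v \<bullet> b
      = frechet_derivative (\<lambda>x. frechet_derivative f (at x) v) (at p) w \<bullet> b"
    using second_derivative_symmetric_real[OF F S p, of w v] by simp
qed

subsection \<open>The tangent space in a chart\<close>

locale chart =
  fixes L :: "'a::euclidean_space set" and V :: "(real ^ 3) set" and f :: "real ^ 3 \<Rightarrow> 'a"
  assumes local_par: "local_parametrization L V f"
begin

abbreviation df :: "real ^ 3 \<Rightarrow> real ^ 3 \<Rightarrow> 'a" where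
  "df p \<equiv> frechet_derivative f (at p)"

lemma open_V: "open V"
  and smooth_f: "smooth_on V f"
  and inj_df: "p \<in> V \<Longrightarrow> inj (df p)"
  and openin_image: "openin (top_of_set L) (f ` V)"
  and ex_inverse: "\<exists>g. homeomorphism V (f ` V) f g"
  using local_par unfolding local_parametrization_def by auto

lemma f_in_L: "p \<in> V \<Longrightarrow> f p \<in> L"
  using openin_image openin_imp_subset by blast

lemma has_derivative_f: "p \<in> V \<Longrightarrow> (f has_derivative df p) (at p)"
  using smooth_on_has_derivative[OF smooth_f] .

lemma linear_df: "p \<in> V \<Longrightarrow> linear (df p)"
  using has_derivative_f has_derivative_linear by blast

lemma inj_on_f: "inj_on f V"
  using ex_inverse by (auto simp: homeomorphism_def inj_on_def) metis

lemma near_in_image: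
  assumes "p \<in> V"
  obtains d where "d > 0" "\<And>y. y \<in> L \<Longrightarrow> dist y (f p) < d \<Longrightarrow> y \<in> f ` V"
proof -
  obtain T where T: "open T" "f ` V = L \<inter> T" using openin_image openin_open by metis
  then obtain d where "d > 0" "ball (f p) d \<subseteq> T" using assms openE by (metis IntE imageI)
  then show ?thesis using that[of d] T by (auto simp: dist_commute subset_eq)
qed

text \<open>The inverse chart is defined only on a piece of \<open>L\<close>, so its derivative is
  taken within \<open>L\<close>. Injectivity of \<open>df p\<close> bounds
  \<open>norm (df p v)\<close> below by a multiple of \<open>norm v\<close>, which makes parameter
  distances comparable to distances in \<open>L\<close>; continuity of \<open>g\<close> first brings
  the parameter close to \<open>p\<close>.\<close>

lemma inverse_has_derivative:
  assumes p: "p \<in> V" and l: "linear l" "\<And>v. l (df p v) = v" and g: "homeomorphism V (f ` V) f g"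
  shows "(g has_derivative l) (at (f p) within L)"
  unfolding has_derivative_within_alt
proof (intro conjI allI impI)
  show bl: "bounded_linear l" using l(1) linear_conv_bounded_linear by blast
  fix e :: real assume e: "e > 0"
  obtain B where B: "B > 0" "\<And>v. B * norm v \<le> norm (df p v)"
    using linear_inj_bounded_below_pos[OF linear_df[OF p] inj_df[OF p]] by (metis mult.commute)
  obtain K where K: "K > 0" "\<And>x. norm (l x) \<le> norm x * K"
    using bounded_linear.pos_bounded[OF bl] by blast
  \<comment> \<open>The bound \<open>B/2\<close> lets the remainder be absorbed in the lower
    estimate for \<open>df p\<close>; the other bound yields \<open>e\<close> after multiplication
    by the norm bound of \<open>l\<close> and by \<open>2 / B\<close>.\<close>
  define e' where "e' = min (B/2) (e * B / (2 * K))"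
  have e': "e' > 0" "e' \<le> B/2" "e' * K * (2 / B) \<le> e"
    using e B K unfolding e'_def by (auto simp: field_simps min_def)
  obtain d1 where d1: "d1 > 0"
    "\<And>q. norm (q - p) < d1 \<Longrightarrow> norm (f q - f p - df p (q - p)) \<le> e' * norm (q - p)"
    using has_derivative_f[OF p] e'(1) unfolding has_derivative_at_alt by metis
  have "continuous_on (f ` V) g" using g by (simp add: homeomorphism_def)
  then obtain d2 where d2: "d2 > 0" "\<And>y. y \<in> f ` V \<Longrightarrow> dist y (f p) < d2
      \<Longrightarrow> dist (g y) (g (f p)) < d1"
    using p d1(1) unfolding continuous_on_iff by (metis imageI)
  obtain d3 where d3: "d3 > 0" "\<And>y. y \<in> L \<Longrightarrow> dist y (f p) < d3 \<Longrightarrow> y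
      \<in> f ` V"
    using near_in_image[OF p] by blast
  have gp: "g (f p) = p" using g p by (simp add: homeomorphism_def)
  show "\<exists>d>0. \<forall>y\<in>L. norm (y - f p) < d \<longrightarrow>
      norm (g y - g (f p) - l (y - f p)) \<le> e * norm (y - f p)"
  proof (intro exI[of _ "min d2 d3"] conjI ballI impI)
    show "min d2 d3 > 0" using d2 d3 by simp
    fix y assume "y \<in> L" "norm (y - f p) < min d2 d3"
    then have y: "y \<in> f ` V" "dist y (f p) < d2" using d3 by (auto simp: dist_norm)
    define q where "q = g y"
    have q: "f q = y" using g y unfolding q_def by (auto simp: homeomorphism_def)
    have "norm (q - p) < d1" using d2(2)[OF y] gp unfolding q_def by (simp add: dist_norm)
    from d1(2)[OF this] have R: "norm (f q - f p - df p (q - p)) \<le> e' * norm (q - p)" .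
    have "B * norm (q - p) \<le> norm (df p (q - p))" by (rule B(2))
    also have "\<dots> \<le> norm (f q - f p) + norm (f q - f p - df p (q - p))"
      by (metis norm_triangle_sub norm_minus_commute)
    also have "\<dots> \<le> norm (f q - f p) + B/2 * norm (q - p)"
      using R e'(2) by (smt (verit, best) mult_right_mono norm_ge_zero)
    finally have Q: "norm (q - p) \<le> (2 / B) * norm (y - f p)"
      using B(1) q by (simp add: field_simps)
    have "g y - g (f p) - l (y - f p) = - l (f q - f p - df p (q - p))"
      using l q gp unfolding q_def[symmetric] by (simp add: linear_diff)
    then have "norm (g y - g (f p) - l (y - f p)) \<le> norm (f q - f p - df p (q - p)) * K"
      using K(2) by simp
    also have "\<dots> \<le> (e' * ((2 / B) * norm (y - f p))) * K"
      using R Q K e' by (intro mult_right_mono) (smt (verit) mult_left_mono, simp)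
    also have "\<dots> = (e' * K * (2 / B)) * norm (y - f p)" by (simp add: field_simps)
    also have "\<dots> \<le> e * norm (y - f p)" using e'(3) by (intro mult_right_mono) auto
    finally show "norm (g y - g (f p) - l (y - f p)) \<le> e * norm (y - f p)" .
  qed
qed

lemma obtains_left_inverse:
  assumes "p \<in> V"
  obtains l where "linear l" "\<And>v. l (df p v) = v"
  using linear_injective_left_inverse[OF linear_df[OF assms] inj_df[OF assms]]
  by (metis comp_apply id_apply)

text \<open>Two left inverses of \<open>df p\<close> agree on tangent vectors, so the choice of
  \<open>l\<close> affects this derivative only off the tangent space.\<close>

lemma has_derivative_within_chart:
  assumes p: "p \<in> V" and F: "((\<lambda>q. F (f q)) has_derivative D) (at p)"
    and l: "linear l" "\<And>v. l (df p v) = v"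
  shows "(F has_derivative (\<lambda>x. D (l x))) (at (f p) within L)"
proof -
  obtain g where g: "homeomorphism V (f ` V) f g" using ex_inverse by blast
  have gp: "g (f p) = p" using g p by (simp add: homeomorphism_def)
  obtain d where d: "d > 0" "\<And>y. y \<in> L \<Longrightarrow> dist y (f p) < d \<Longrightarrow> y \<in> f ` V"
    using near_in_image[OF p] by blast
  have "((\<lambda>y. F (f (g y))) has_derivative (\<lambda>x. D (l x))) (at (f p) within L)"
    using has_derivative_compose[OF inverse_has_derivative[OF p l g], of "\<lambda>q. F (f q)" D] F gp by simp
  moreover have "F (f (g y)) = F y" if "y \<in> L" "dist y (f p) < d" for y
    using d(2)[OF that] g by (auto simp: homeomorphism_def)
  ultimately show ?thesis
    using has_derivative_transform_within[OF _ d(1) f_in_L[OF p]] by blast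
qed

lemma has_derivative_chart_compose:
  assumes p: "p \<in> V" and F: "(F has_derivative D) (at (f p) within L)"
  shows "((\<lambda>q. F (f q)) has_derivative (\<lambda>v. D (df p v))) (at p)"
proof -
  have "(f has_derivative df p) (at p within V)"
    using has_derivative_f[OF p] has_derivative_at_withinI by blast
  moreover have "(F has_derivative D) (at (f p) within f ` V)"
    using F f_in_L has_derivative_subset by (metis image_subsetI)
  ultimately have "((\<lambda>q. F (f q)) has_derivative (\<lambda>v. D (df p v))) (at p within V)"
    by (rule has_derivative_in_compose)
  then show ?thesis using at_within_open[OF p open_V] by simp
qed

text \<open>Images of straight segments realize every vector of the range. Conversely a curve in
  \<open>L\<close> is differentiated through the chart, which shows that its velocity is fixed by
  \<open>df p\<close> composed with a left inverse.\<close>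

lemma tangent_space_eq:
  assumes p: "p \<in> V"
  shows "tangent_space L (f p) = range (df p)"
proof (intro subset_antisym subsetI)
  fix v assume "v \<in> range (df p)"
  then obtain w where w: "v = df p w" by blast
  obtain d where d: "d > 0" "ball p d \<subseteq> V" using open_V p openE by blast
  define e where "e = d / (norm w + 1)"
  have nw: "norm w + 1 > 0" by (smt (verit) norm_ge_zero)
  have e: "e > 0" unfolding e_def using d nw by simp
  have inV: "p + t *\<^sub>R w \<in> V" if "t \<in> {-e<..<e}" for t
  proof -
    have "\<bar>t\<bar> * norm w \<le> \<bar>t\<bar> * (norm w + 1)" by (intro mult_left_mono) auto
    also have "\<dots> < e * (norm w + 1)" using that nw by (intro mult_strict_right_mono) auto
    also have "\<dots> = d" unfolding e_def using nw by simp
    finally show ?thesis using d(2) by (auto simp: dist_norm)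
  qed
  have l: "((\<lambda>t. p + t *\<^sub>R w) has_derivative (\<lambda>s. s *\<^sub>R w)) (at 0)"
    by (auto intro!: derivative_eq_intros)
  have "((\<lambda>t. f (p + t *\<^sub>R w)) has_vector_derivative v) (at 0)"
    using has_derivative_compose[OF l, of f "df p"] has_derivative_f[OF p] linear_df[OF p] w
    by (simp add: has_vector_derivative_def linear_cmul)
  moreover have "smooth_on {-e<..<e} (\<lambda>t. f (p + t *\<^sub>R w))"
    by (rule smooth_on_line[OF smooth_f]) (use inV in auto)
  ultimately show "v \<in> tangent_space L (f p)"
    unfolding tangent_space_def using e inV f_in_L
    by (auto intro!: exI[of _ e] exI[of _ "\<lambda>t. f (p + t *\<^sub>R w)"])
next
  fix v assume "v \<in> tangent_space L (f p)"
  then obtain e \<gamma> where \<gamma>: "e > 0" "\<gamma> ` {-e<..<e} \<subseteq> L" "\<gamma> 0 = f p"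
      "(\<gamma> has_vector_derivative v) (at 0)"
    unfolding tangent_space_def by blast
  obtain l where l: "linear l" "\<And>v. l (df p v) = v" using obtains_left_inverse[OF p] by blast
  obtain g where g: "homeomorphism V (f ` V) f g" using ex_inverse by blast
  have gp: "g (f p) = p" using g p by (simp add: homeomorphism_def)
  have f: "((\<lambda>q. f q) has_derivative df p) (at p)" using has_derivative_f[OF p] .
  \<comment> \<open>The identity map, seen within \<open>L\<close>, also has the derivative
    \<open>df p\<close> after \<open>l\<close>. Along the curve both derivatives must give the
    velocity \<open>v\<close>, so \<open>v = df p (l v)\<close>.\<close>
  have id: "((\<lambda>y. y) has_derivative (\<lambda>x. df p (l x))) (at (f p) within L)"
    using has_derivative_within_chart[OF p _ l, of "\<lambda>y. y"] f by simp
  have \<gamma>': "(\<gamma> has_derivative (\<lambda>s. s *\<^sub>R v)) (at 0 within {-e<..<e})"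
    using \<gamma>(4) has_derivative_at_withinI unfolding has_vector_derivative_def by blast
  have "((\<lambda>y. y) has_derivative (\<lambda>x. df p (l x))) (at (\<gamma> 0) within \<gamma> ` {-e<..<e})"
    using id \<gamma>(2,3) has_derivative_subset by metis
  from has_derivative_in_compose[OF \<gamma>' this]
  have "(\<gamma> has_derivative (\<lambda>s. df p (l (s *\<^sub>R v)))) (at 0)"
    using \<gamma>(1) at_within_open[of "0::real" "{-e<..<e}"] by simp
  then have "(\<lambda>s. df p (l (s *\<^sub>R v))) = (\<lambda>s. s *\<^sub>R v)"
    using \<gamma>(4) has_derivative_unique unfolding has_vector_derivative_def by blast
  then have "df p (l (1 *\<^sub>R v)) = 1 *\<^sub>R v" by meson
  then show "v \<in> range (df p)" by (metis rangeI scaleR_one)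
qed

lemma subspace_tangent: "p \<in> V \<Longrightarrow> subspace (tangent_space L (f p))"
  by (simp add: tangent_space_eq linear_df linear_subspace_image)

lemma df_tangent: "p \<in> V \<Longrightarrow> df p v \<in> tangent_space L (f p)"
  by (simp add: tangent_space_eq)

lemma dim_tangent: "p \<in> V \<Longrightarrow> dim (tangent_space L (f p)) = 3"
  using dim_image_eq[OF linear_df, of p UNIV] inj_df[of p]
  by (simp add: tangent_space_eq)

lemma smooth_df: "smooth_on V (\<lambda>p. df p v)"
  by (rule smooth_on_deriv[OF smooth_f])

definition d2f :: "real ^ 3 \<Rightarrow> real ^ 3 \<Rightarrow> real ^ 3 \<Rightarrow> 'a" where
  "d2f p w v = frechet_derivative (\<lambda>q. df q v) (at p) w"

lemma d2f_has_derivative: "p \<in> V \<Longrightarrow> ((\<lambda>q. df q v) has_derivative (\<lambda>w. d2f p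
    w v)) (at p)"
  unfolding d2f_def by (rule smooth_on_has_derivative[OF smooth_df])

lemma d2f_commute: "p \<in> V \<Longrightarrow> d2f p w v = d2f p v w"
  unfolding d2f_def by (rule second_derivative_symmetric[OF smooth_f open_V])

end

text \<open>Composing with a curve in \<open>L\<close> of velocity \<open>v\<close> turns the claim
  into uniqueness of an ordinary derivative in one variable.\<close>

lemma tangent_derivative_unique:
  assumes "(F has_derivative D) (at x within L)" "(F has_derivative D') (at x within L)"
    and v: "v \<in> tangent_space L x"
  shows "D v = D' v"
proof -
  obtain e \<gamma> where \<gamma>: "e > 0" "\<gamma> ` {-e<..<e} \<subseteq> L" "\<gamma> 0 = x" "(\<gamma>
      has_vector_derivative v) (at 0)"
    using v unfolding tangent_space_def by blast
  have \<gamma>': "(\<gamma> has_derivative (\<lambda>s. s *\<^sub>R v)) (at 0 within {-e<..<e})"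
    using \<gamma>(4) has_derivative_at_withinI unfolding has_vector_derivative_def by blast
  have *: "((\<lambda>t. F (\<gamma> t)) has_derivative (\<lambda>s. A (s *\<^sub>R v))) (at 0)"
    if "(F has_derivative A) (at x within L)" for A
  proof -
    have "(F has_derivative A) (at (\<gamma> 0) within \<gamma> ` {-e<..<e})"
      using that \<gamma>(2,3) has_derivative_subset by metis
    from has_derivative_in_compose[OF \<gamma>' this] show ?thesis
      using \<gamma>(1) at_within_open[of "0::real" "{-e<..<e}"] by simp
  qed
  have "(\<lambda>s. D (s *\<^sub>R v)) = (\<lambda>s. D' (s *\<^sub>R v))"
    using has_derivative_unique[OF *[OF assms(1)] *[OF assms(2)]] .
  then have "D (1 *\<^sub>R v) = D' (1 *\<^sub>R v)" by meson
  then show ?thesis by simp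
qed

subsection \<open>Lagrangian subspaces of \<open>complex ^ 3\<close>\<close>

lemma inner_complex3: "(u :: complex ^ 3) \<bullet> v = Re (\<Sum>k\<in>UNIV. u $ k * cnj (v $ k))"
  by (simp add: inner_vec_def inner_complex_def)

lemma inner_i_right: "u \<bullet> (\<i> *s v) = Im (\<Sum>k\<in>UNIV. u $ k * cnj (v $ k))" for u v :: "complex ^ 3"
  by (simp add: inner_complex3 algebra_simps)

lemma inner_i_left: "(\<i> *s u) \<bullet> v = - (u \<bullet> (\<i> *s v))" for u v :: "complex ^ 3"
  by (simp add: inner_complex3 algebra_simps sum_negf)

lemma inner_i_i [simp]: "(\<i> *s u) \<bullet> (\<i> *s v) = u \<bullet> v" for u v :: "complex ^ 3"
  by (simp add: inner_complex3 algebra_simps)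

lemma i_scaleR: "\<i> *s (c *\<^sub>R v) = c *\<^sub>R (\<i> *s v)" for v :: "complex ^ 3"
  by (simp add: vec_eq_iff)

lemma linear_i: "linear (\<lambda>v :: complex ^ 3. \<i> *s v)"
  by (intro linearI) (auto simp: vec_eq_iff algebra_simps)

lemma bounded_linear_i: "bounded_linear (\<lambda>v :: complex ^ 3. \<i> *s v)"
  using linear_i linear_conv_bounded_linear by blast

lemma complex_smult: "c *s v = Re c *\<^sub>R v + Im c *\<^sub>R (\<i> *s v)" for v :: "complex ^ 3"
  by (simp add: vec_eq_iff complex_eq_iff)

lemma kahler_form_inner: "kahler_form u v = - complex_of_real (u \<bullet> (\<i> *s v))"
proof -
  have "(\<Sum>k\<in>UNIV. u $ k * cnj (v $ k) - v $ k * cnj (u $ k))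
      = (\<Sum>k\<in>UNIV. u $ k * cnj (v $ k)) - cnj (\<Sum>k\<in>UNIV. u $ k * cnj (v $ k))"
    by (simp add: sum_subtractf mult.commute)
  also have "\<dots> = 2 * \<i> * complex_of_real (u \<bullet> (\<i> *s v))"
  proof -
    have "S - cnj S = 2 * \<i> * complex_of_real (Im S)" for S by (simp add: complex_eq_iff)
    then show ?thesis unfolding inner_i_right .
  qed
  finally show ?thesis unfolding kahler_form_def by simp
qed

text \<open>Real and imaginary parts of Hermitian orthonormality, written with the real inner
  product only.\<close>

definition unitary_frame :: "(3 \<Rightarrow> complex ^ 3) \<Rightarrow> bool" where
  "unitary_frame v \<longleftrightarrow> (\<forall>a b. v a \<bullet> v b = (if a = b then 1 else 0)) \<and>
      (\<forall>a b. v a \<bullet> (\<i> *s v b) = 0)"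

text \<open>A one-sided inverse of a square matrix is two-sided, so orthonormality of the vectors
  passes to their coordinates.\<close>

lemma unitary_frame_columns:
  assumes "unitary_frame v"
  shows "(\<Sum>a\<in>UNIV. v a $ j * cnj (v a $ k)) = (if j = k then 1 else 0)"
    and "(\<Sum>j\<in>UNIV. v a $ j * cnj (v b $ j)) = (if a = b then 1 else 0)"
proof -
  have h: "(\<Sum>j\<in>UNIV. v a $ j * cnj (v b $ j)) = (if a = b then 1 else 0)" for a b
    using assms inner_complex3[of "v a" "v b"] inner_i_right[of "v a" "v b"]
    unfolding unitary_frame_def complex_eq_iff by auto
  then show "(\<Sum>j\<in>UNIV. v a $ j * cnj (v b $ j)) = (if a = b then 1 else 0)" .
  define F :: "complex ^ 3 ^ 3" where "F = (\<chi> j a. v a $ j)"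
  define G :: "complex ^ 3 ^ 3" where "G = (\<chi> a j. cnj (v a $ j))"
  have "G ** F = mat 1"
    using h unfolding F_def G_def by (simp add: matrix_matrix_mult_def mat_def vec_eq_iff mult.commute)
  then have "F ** G = mat 1" by (simp add: matrix_left_right_inverse)
  then show "(\<Sum>a\<in>UNIV. v a $ j * cnj (v a $ k)) = (if j = k then 1 else 0)"
    unfolding F_def G_def by (simp add: matrix_matrix_mult_def mat_def vec_eq_iff)
qed

lemma unitary_frame_expand:
  assumes "unitary_frame v"
  shows "z = (\<Sum>a\<in>UNIV. (z \<bullet> v a) *\<^sub>R v a + (z \<bullet> (\<i> *s v a)) *\<^sub>R (\<i>
      *s v a))"
proof -
  have "(z \<bullet> v a) *\<^sub>R v a + (z \<bullet> (\<i> *s v a)) *\<^sub>R (\<i> *s v a)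
      = (\<Sum>k\<in>UNIV. z $ k * cnj (v a $ k)) *s v a" for a
    using complex_smult[of "\<Sum>k\<in>UNIV. z $ k * cnj (v a $ k)" "v a"]
      inner_complex3[of z "v a"] inner_i_right[of z "v a"] by metis
  then have "(\<Sum>a\<in>UNIV. (z \<bullet> v a) *\<^sub>R v a + (z \<bullet> (\<i> *s v a)) *\<^sub>R (\<i> *s v a))
      = (\<Sum>a\<in>UNIV. (\<Sum>k\<in>UNIV. z $ k * cnj (v a $ k)) *s v a)" by simp
  also have "\<dots> = z"
  proof (subst vec_eq_iff, intro allI)
    fix j
    have "(\<Sum>a\<in>UNIV. (\<Sum>k\<in>UNIV. z $ k * cnj (v a $ k)) *s v a) $ j
        = (\<Sum>a\<in>UNIV. \<Sum>k\<in>UNIV. z $ k * (v a $ j * cnj (v a $ k)))"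
      by (simp add: sum_distrib_left mult_ac)
    also have "\<dots> = (\<Sum>k\<in>UNIV. z $ k * (\<Sum>a\<in>UNIV. v a $ j * cnj (v a $ k)))"
      by (subst sum.swap) (simp add: sum_distrib_left)
    also have "\<dots> = z $ j"
      by (simp add: unitary_frame_columns(1)[OF assms] if_distrib[of "\<lambda>x. _ * x"] cong: if_cong)
    finally show "(\<Sum>a\<in>UNIV. (\<Sum>k\<in>UNIV. z $ k * cnj (v a $ k)) *s v a) $ j = z $ j" .
  qed
  finally show ?thesis ..
qed

definition lagrangian :: "(complex ^ 3) set \<Rightarrow> bool" where
  "lagrangian T \<longleftrightarrow> subspace T \<and> dim T = 3 \<and> (\<forall>u\<in>T. \<forall>v\<in>T. u
      \<bullet> (\<i> *s v) = 0)"

text \<open>In a Lagrangian subspace the Hermitian product is real, so every real orthonormal basis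
  is a unitary frame. It remains to place \<open>E\<close> first.\<close>

lemma lagrangian_frame_ex:
  assumes T: "lagrangian T" and E: "E \<in> T" "norm E = 1"
  obtains v where "unitary_frame v" "\<And>a. v a \<in> T" "v 1 = E"
proof -
  obtain B where B: "B \<subseteq> T" "pairwise orthogonal B" "\<And>x. x \<in> B \<Longrightarrow> norm x = 1"
      "independent B" "card B = dim T" "span B = T"
    using orthonormal_basis_subspace T unfolding lagrangian_def by metis
  have "finite B" using B(4) independent_imp_finite by blast
  moreover have "card (UNIV :: 3 set) = card B" using B(5) T by (simp add: lagrangian_def)
  ultimately obtain b where b: "bij_betw b (UNIV :: 3 set) B"
    using bij_betw_iff_card[of "UNIV :: 3 set" B] by auto
  have bb: "b i \<bullet> b j = (if i = j then 1 else 0)" for i j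
  proof (cases "i = j")
    case True
    then show ?thesis using B(3)[of "b i"] b by (auto simp: bij_betw_def dot_square_norm)
  next
    case False
    then have "b i \<noteq> b j" "b i \<in> B" "b j \<in> B" using b by (auto simp: bij_betw_def inj_def)
    then show ?thesis using B(2) False by (auto simp: pairwise_def orthogonal_def)
  qed
  define \<phi> :: "real ^ 3 \<Rightarrow> complex ^ 3" where "\<phi> = (\<lambda>q. \<Sum>i\<in>UNIV. (q $ i)
      *\<^sub>R b i)"
  have \<phi>\<phi>: "\<phi> q \<bullet> \<phi> r = q \<bullet> r" for q r
  proof -
    have "\<phi> q \<bullet> \<phi> r = (\<Sum>i\<in>UNIV. \<Sum>j\<in>UNIV. r $ i * (q $ j * (b j \<bullet> b i)))"
      unfolding \<phi>_def inner_sum_left inner_sum_right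
      by (simp add: inner_sum_left inner_sum_right sum_distrib_left)
    also have "\<dots> = (\<Sum>i\<in>UNIV. r $ i * q $ i)"
      by (simp add: bb if_distrib[of "\<lambda>x. _ * x"] cong: if_cong)
    also have "\<dots> = q \<bullet> r" by (simp add: inner_vec_def mult.commute)
    finally show ?thesis .
  qed
  have "b i \<in> T" for i using b B(1) by (auto simp: bij_betw_def)
  then have \<phi>T: "\<phi> q \<in> T" for q
    unfolding \<phi>_def using T by (auto simp: lagrangian_def intro!: subspace_sum subspace_scale)
  define e where "e = (\<chi> i. E \<bullet> b i)"
  have "E \<in> span B" using E B by simp
  then have "E \<in> range \<phi>"
  proof (induction rule: span_induct_alt)
    case base
    then show ?case unfolding \<phi>_def by (intro image_eqI[of _ _ 0]) auto
  next
    case (step c x y)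
    then obtain i q where "x = b i" "y = \<phi> q" using b by (auto simp: bij_betw_def)
    then have "c *\<^sub>R x + y = \<phi> (c *\<^sub>R axis i 1 + q)"
      unfolding \<phi>_def by (simp add: scaleR_left_distrib sum.distrib axis_def if_distrib[of "\<lambda>x. _ * x"]
          if_distrib[of "\<lambda>c. c *\<^sub>R _"] cong: if_cong)
    then show ?case by blast
  qed
  then obtain e where e: "E = \<phi> e" by blast
  then have ne: "norm e = 1" using E(2) \<phi>\<phi>[of e e] by (simp add: norm_eq_sqrt_inner)
  have na: "norm (axis 1 1 :: real ^ 3) = 1" by simp
  \<comment> \<open>The orthogonal group of \<open>real ^ 3\<close> is transitive on unit vectors;
    rotating the coordinates moves the first basis vector to \<open>E\<close>.\<close>
  obtain R :: "real ^ 3 \<Rightarrow> real ^ 3" where R: "orthogonal_transformation R" "R (axis 1 1) = e"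
    using orthogonal_transformation_exists_1[OF na ne] by metis
  define v where "v = (\<lambda>a. \<phi> (R (axis a 1)))"
  have "v a \<bullet> v c = (if a = c then 1 else 0)" for a c
    using R(1) unfolding v_def \<phi>\<phi> orthogonal_transformation_def by (simp add: inner_axis_axis)
  then have "unitary_frame v" using T \<phi>T unfolding unitary_frame_def lagrangian_def v_def by auto
  then show ?thesis using that[of v] \<phi>T R(2) e unfolding v_def by simp
qed

lemma lagrangian_frame:
  assumes "lagrangian T"
  obtains v where "unitary_frame v" "\<And>a. v a \<in> T"
proof -
  have "dim T \<noteq> 0" using assms by (simp add: lagrangian_def)
  then obtain x where "x \<in> T" "x \<noteq> 0" by (metis dim_eq_0 singletonI subsetI)
  then have "(1 / norm x) *\<^sub>R x \<in> T" "norm ((1 / norm x) *\<^sub>R x) = 1"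
    using assms by (auto simp: lagrangian_def subspace_scale)
  then show ?thesis using lagrangian_frame_ex[OF assms] that by metis
qed

lemma lagrangian_expand:
  assumes T: "lagrangian T" and v: "unitary_frame v" "\<And>a. v a \<in> T" and z: "z \<in> T"
  shows "z = (\<Sum>a\<in>UNIV. (z \<bullet> v a) *\<^sub>R v a)"
  using unitary_frame_expand[OF v(1), of z] v(2) z T by (simp add: lagrangian_def)

text \<open>A Lagrangian subspace is maximal isotropic: in the frame expansion the coefficients of
  \<open>\<i> *s v a\<close> vanish. This is the test for tangency used throughout.\<close>

lemma lagrangian_memI:
  assumes T: "lagrangian T" and z: "\<And>u. u \<in> T \<Longrightarrow> z \<bullet> (\<i> *s u) = 0"
  shows "z \<in> T"
proof -
  obtain v where v: "unitary_frame v" "\<And>a. v a \<in> T" using lagrangian_frame[OF T] by blast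
  have "z = (\<Sum>a\<in>UNIV. (z \<bullet> v a) *\<^sub>R v a)"
    using unitary_frame_expand[OF v(1), of z] v(2) z by simp
  then show ?thesis using v(2) T
    by (metis (no_types, lifting) lagrangian_def subspace_scale subspace_sum)
qed

lemma lagrangian_zeroI:
  assumes T: "lagrangian T"
    and z: "\<And>u. u \<in> T \<Longrightarrow> z \<bullet> u = 0" "\<And>u. u \<in> T \<Longrightarrow> z
        \<bullet> (\<i> *s u) = 0"
  shows "z = 0"
  using lagrangian_memI[OF T z(2)] z(1)[of z] by simp

subsection \<open>The fundamental cubic in a chart\<close>

lemma zero_tangent: "x \<in> L \<Longrightarrow> 0 \<in> tangent_space L x"
  unfolding tangent_space_def
  by (auto intro!: exI[of _ 1] exI[of _ "\<lambda>t. x"] smooth_on_const)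

locale slag_chart = chart L V f
  for L :: "(complex ^ 3) set" and V :: "(real ^ 3) set" and f :: "real ^ 3 \<Rightarrow> complex ^ 3" +
  assumes special_lag: "special_lagrangian L"
begin

abbreviation T where "T p \<equiv> tangent_space L (f p)"

lemma lagrangian_T: assumes p: "p \<in> V" shows "lagrangian (T p)"
proof -
  have "u \<bullet> (\<i> *s v) = 0" if "u \<in> T p" "v \<in> T p" for u v
    using special_lag that f_in_L[OF p] kahler_form_inner[of u v] unfolding special_lagrangian_def by auto
  then show ?thesis unfolding lagrangian_def using subspace_tangent dim_tangent p by blast
qed

lemma T_df: "p \<in> V \<Longrightarrow> z \<in> T p \<Longrightarrow> \<exists>w. z = df p w"
  using tangent_space_eq by auto

lemma T_inner: "p \<in> V \<Longrightarrow> u \<in> T p \<Longrightarrow> v \<in> T p \<Longrightarrow> u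
    \<bullet> (\<i> *s v) = 0"
  using lagrangian_T by (simp add: lagrangian_def)

text \<open>This is the derivative of the identity \<open>Y \<bullet> (\<i> *s df z) = 0\<close>,
  which expresses that \<omega> vanishes on \<open>L\<close>. The right-hand side sees only the
  value of \<open>Y\<close> at \<open>p\<close>, which makes the cubic independent of how a tangent
  vector is extended.\<close>

lemma tangent_field_derivative:
  assumes p: "p \<in> V" and Y: "\<And>q. q \<in> V \<Longrightarrow> Y q \<in> T q" and Y': "(Y has_derivative
      Y') (at p)"
  shows "Y' w \<bullet> (\<i> *s df p z) = - (Y p \<bullet> (\<i> *s d2f p w z))"
proof -
  have "((\<lambda>q. Y q \<bullet> (\<i> *s df q z)) has_derivative
      (\<lambda>w. Y p \<bullet> (\<i> *s d2f p w z) + Y' w \<bullet> (\<i> *s df p z))) (at p)"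
    by (intro has_derivative_inner Y' bounded_linear.has_derivative[OF bounded_linear_i] d2f_has_derivative p)
  moreover have "((\<lambda>q. Y q \<bullet> (\<i> *s df q z)) has_derivative (\<lambda>w. 0)) (at p)"
    by (rule has_derivative_transform_within_open[OF _ open_V p, of "\<lambda>q. 0"])
      (use T_inner Y df_tangent in auto)
  ultimately have "(\<lambda>w. Y p \<bullet> (\<i> *s d2f p w z) + Y' w \<bullet> (\<i> *s df p z)) =
      (\<lambda>w. 0)"
    using has_derivative_unique by blast
  then show ?thesis by (metis (no_types, lifting) add_eq_0_iff)
qed

text \<open>The description by \<open>THE\<close> has to be shown meaningful. A normal vector is
  determined by its pairings with \<open>\<i>\<close> times tangent vectors, and
  \<open>tangent_field_derivative\<close> computes these for any admissible field; a
  constant-coefficient field of the chart gives existence.\<close>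

lemma second_fundamental_form_char:
  assumes p: "p \<in> V" and b: "b \<in> T p"
  shows "second_fundamental_form L (f p) (df p w) b \<bullet> (\<i> *s df p z) = - (b \<bullet> (\<i> *s d2f p w z))"
proof -
  define P where "P = (\<lambda>n. \<exists>Y D. (\<forall>y\<in>L. Y y \<in> tangent_space L y) \<and> Y (f p)
      = b \<and>
        (Y has_derivative D) (at (f p) within L) \<and>
        n \<in> orthogonal_comp (T p) \<and> D (df p w) - n \<in> T p)"
  have char: "n \<bullet> (\<i> *s df p z) = - (b \<bullet> (\<i> *s d2f p w z)) \<and> n \<in> orthogonal_comp (T p)"
    if n: "P n" for n z
  proof -
    obtain Y D where Y: "\<forall>y\<in>L. Y y \<in> tangent_space L y" "Y (f p) = b"
      "(Y has_derivative D) (at (f p) within L)" "n \<in> orthogonal_comp (T p)" "D (df p w) - n \<in> T p"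
      using n unfolding P_def by blast
    have "D (df p w) \<bullet> (\<i> *s df p z) = - (b \<bullet> (\<i> *s d2f p w z))"
      using tangent_field_derivative[OF p _ has_derivative_chart_compose[OF p Y(3)]] Y(1,2) f_in_L
      by auto
    moreover have "(D (df p w) - n) \<bullet> (\<i> *s df p z) = 0"
      using T_inner[OF p Y(5)] df_tangent[OF p] by blast
    ultimately show ?thesis using Y(4) by (simp add: inner_diff_left)
  qed
  have uniq: "n = m" if "P n" "P m" for n m
  proof -
    have "n - m = 0"
    proof (rule lagrangian_zeroI[OF lagrangian_T[OF p]])
      fix u assume u: "u \<in> T p"
      have "u \<bullet> n = 0" "u \<bullet> m = 0" using char that u
        by (auto simp: orthogonal_comp_def orthogonal_def inner_commute)
      then show "(n - m) \<bullet> u = 0" by (simp add: inner_commute[of _ u] inner_diff_right)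
      show "(n - m) \<bullet> (\<i> *s u) = 0" using char that T_df[OF p u]
        by (auto simp: inner_diff_left)
    qed
    then show ?thesis by simp
  qed
  have "\<exists>n. P n"
  proof -
    obtain \<beta> where \<beta>: "b = df p \<beta>" using T_df[OF p b] by blast
    obtain g where g: "homeomorphism V (f ` V) f g" using ex_inverse by blast
    have gf: "g (f q) = q" if "q \<in> V" for q using g that by (simp add: homeomorphism_def)
    \<comment> \<open>The value 0 off the chart keeps the field tangent on all of \<open>L\<close>.
      The chart image is open in \<open>L\<close>, so the derivative at \<open>f p\<close> does not
      see this extension.\<close>
    define Y where "Y = (\<lambda>y. if y \<in> f ` V then df (g y) \<beta> else 0)"
    have Yf: "Y (f q) = df q \<beta>" if "q \<in> V" for q using gf that unfolding Y_def by simp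
    obtain l where l: "linear l" "\<And>v. l (df p v) = v" using obtains_left_inverse[OF p] by blast
    have "((\<lambda>q. Y (f q)) has_derivative (\<lambda>w. d2f p w \<beta>)) (at p)"
      by (rule has_derivative_transform_within_open[OF d2f_has_derivative[OF p] open_V p])
        (simp add: Yf)
    from has_derivative_within_chart[OF p this l]
    have D: "(Y has_derivative (\<lambda>x. d2f p (l x) \<beta>)) (at (f p) within L)" .
    obtain y n where yn: "y \<in> span (T p)" "\<And>u. u \<in> span (T p) \<Longrightarrow> orthogonal n u"
        "d2f p w \<beta> = y + n"
      using orthogonal_subspace_decomp_exists by metis
    have "n \<in> orthogonal_comp (T p)"
      using yn(2) span_base by (auto simp: orthogonal_comp_def orthogonal_commute)
    moreover have "d2f p w \<beta> - n \<in> T p"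
      using yn(1,3) span_eq_iff[THEN iffD2, OF subspace_tangent[OF p]] by simp
    moreover have "Y y \<in> tangent_space L y" if "y \<in> L" for y
      using that zero_tangent Yf df_tangent unfolding Y_def[THEN fun_cong, of y]
      by (auto simp: gf)
    ultimately have "P n" unfolding P_def using D Yf[OF p] \<beta> l(2)
      by (intro exI[of _ Y] exI[of _ "\<lambda>x. d2f p (l x) \<beta>"]) auto
    then show ?thesis by blast
  qed
  then have "P (THE n. P n)" using uniq by (metis the_equality)
  then show ?thesis using char unfolding second_fundamental_form_def P_def by blast
qed

abbreviation C where "C p \<equiv> fundamental_cubic L (f p)"

text \<open>The working form of the cubic: the normal part of the derivative of any tangent field.
  Applied to the axis and to the tangential part of its derivative, it produces all structure
  equations.\<close>

lemma cubic_field: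
  assumes p: "p \<in> V" and Y: "\<And>q. q \<in> V \<Longrightarrow> Y q \<in> T q" and Y': "(Y has_derivative
      Y') (at p)"
    and z: "z \<in> T p"
  shows "C p (df p w) (Y p) z = Y' w \<bullet> (\<i> *s z)"
proof -
  obtain u where u: "z = df p u" using T_df[OF p z] by blast
  show ?thesis unfolding fundamental_cubic_def u
    using second_fundamental_form_char[OF p Y[OF p]] tangent_field_derivative[OF p Y Y'] by simp
qed

lemma cubic_df:
  assumes p: "p \<in> V" and z: "z \<in> T p"
  shows "C p (df p u) (df p v) z = d2f p u v \<bullet> (\<i> *s z)"
  using cubic_field[OF p df_tangent d2f_has_derivative[OF p] z] .

lemma cubic_commute12:
  assumes p: "p \<in> V" and t: "a \<in> T p" "b \<in> T p" "c \<in> T p"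
  shows "C p a b c = C p b a c"
  using T_df[OF p t(1)] T_df[OF p t(2)] cubic_df[OF p t(3)] d2f_commute[OF p] by metis

text \<open>Symmetry in the first two slots is that of second derivatives. Here the two sides are
  the two evaluations of the same normal component, related by skewness of multiplication by
  \<open>\<i>\<close>.\<close>

lemma cubic_commute23:
  assumes p: "p \<in> V" and t: "a \<in> T p" "b \<in> T p" "c \<in> T p"
  shows "C p a b c = C p a c b"
proof -
  obtain u where u: "a = df p u" using T_df[OF p t(1)] by blast
  obtain v where v: "b = df p v" using T_df[OF p t(2)] by blast
  obtain w where w: "c = df p w" using T_df[OF p t(3)] by blast
  note uvw = u v w
  have "C p a c b = d2f p u w \<bullet> (\<i> *s df p v)" using cubic_df[OF p t(2)] uvw by simp
  moreover have "C p a b c = - (df p v \<bullet> (\<i> *s d2f p u w))"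
    using second_fundamental_form_char[OF p t(2), of u w] uvw by (simp add: fundamental_cubic_def)
  ultimately show ?thesis using inner_i_left[of "df p v" "d2f p u w"] by (simp add: inner_commute)
qed

lemma cubic_linear3: "linear (\<lambda>c. C p a b c)"
  unfolding fundamental_cubic_def
  by (intro linearI) (auto simp: inner_right_distrib i_scaleR linear_add[OF linear_i])

end

subsection \<open>Axially symmetric cubics\<close>

text \<open>The traceless part of \<open>5 r (E a) (E b) (E c)\<close> in dimension 3. For unit
  \<open>E\<close>, with \<open>x\<close> the component along \<open>E\<close> of a vector
  \<open>v\<close>, the diagonal is \<open>r (5 x ^ 3 - 3 x norm v ^ 2)\<close>, twice
  \<open>r\<close> times the homogenized third Legendre polynomial.\<close>

definition zonal :: "'a::real_inner \<Rightarrow> real \<Rightarrow> 'a \<Rightarrow> 'a \<Rightarrow> 'a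
    \<Rightarrow> real" where
  "zonal E r a b c = r * (5 * (E \<bullet> a) * (E \<bullet> b) * (E \<bullet> c)
     - (E \<bullet> a) * (b \<bullet> c) - (E \<bullet> b) * (a \<bullet> c) - (E \<bullet> c) * (a \<bullet> b))"

lemma zonal_uminus: "zonal (- E) (- r) = zonal E r"
  by (intro ext) (simp add: zonal_def algebra_simps)

lemma zonal_zero [simp]: "zonal E 0 a b c = 0"
  by (simp add: zonal_def)

section \<open>Tracelessness from the holomorphic volume form\<close>

lemma holomorphic_volume_expand:
  "holomorphic_volume u v w =
     u $ 1 * v $ 2 * w $ 3 + u $ 2 * v $ 3 * w $ 1 + u $ 3 * v $ 1 * w $ 2
   - u $ 1 * v $ 3 * w $ 2 - u $ 2 * v $ 1 * w $ 3 - u $ 3 * v $ 2 * w $ 1"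
  unfolding holomorphic_volume_def det_3 by (simp add: vector_3)

lemma holomorphic_volume_unitary_frame:
  assumes "unitary_frame v"
  shows "norm (holomorphic_volume (v 1) (v 2) (v 3)) = 1"
proof -
  define A :: "complex ^ 3 ^ 3" where "A = vector [v 1, v 2, v 3]"
  define B :: "complex ^ 3 ^ 3" where "B = (\<chi> j a. cnj (v a $ j))"
  have Av: "A $ a = v a" for a
    using exhaust_3[of a] by (auto simp: A_def vector_3)
  have "A ** B = mat 1"
    using unitary_frame_columns(2)[OF assms]
    by (simp add: matrix_matrix_mult_def Av B_def mat_def vec_eq_iff)
  then have "det A * det B = 1" by (metis det_I det_mul)
  moreover have "det B = cnj (det A)"
    unfolding det_3 by (simp add: B_def Av algebra_simps)
  ultimately have "complex_of_real ((norm (det A))\<^sup>2) = 1" using complex_norm_square[of "det A"] by metis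
  then have "(norm (det A))\<^sup>2 = 1" using of_real_eq_1_iff by blast
  then have "norm (det A) = 1" by (simp add: abs_square_eq_1)
  then show ?thesis by (simp add: holomorphic_volume_def A_def)
qed

lemma holomorphic_volume_has_derivative:
  assumes "(Y1 has_derivative D1) (at p)" "(Y2 has_derivative D2) (at p)" "(Y3 has_derivative D3) (at p)"
  shows "((\<lambda>q. holomorphic_volume (Y1 q) (Y2 q) (Y3 q)) has_derivative
    (\<lambda>w. holomorphic_volume (D1 w) (Y2 p) (Y3 p) + holomorphic_volume (Y1 p) (D2 w) (Y3 p)
      + holomorphic_volume (Y1 p) (Y2 p) (D3 w))) (at p)"
proof -
  note c = bounded_linear.has_derivative[OF bounded_linear_vec_nth]
  note D = c[OF assms(1)] c[OF assms(2)] c[OF assms(3)]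
  show ?thesis unfolding holomorphic_volume_expand
    by (rule has_derivative_eq_rhs, (rule has_derivative_add has_derivative_diff has_derivative_mult D)+)
      (auto simp: fun_eq_iff algebra_simps)
qed

context slag_chart
begin

text \<open>Differentiating an alternating trilinear form on a frame multiplies it by the complex
  trace of the coefficient matrix of the derivatives. The value on the frame is real and nonzero, so
  the imaginary part of that trace, which is the trace of the cubic, must vanish.\<close>

lemma cubic_tracefree:
  assumes p: "p \<in> V" and v: "unitary_frame v" "\<And>a. v a \<in> T p" and w: "w \<in> T p"
  shows "(\<Sum>a\<in>UNIV. C p w (v a) (v a)) = 0"
proof -
  obtain u where u: "w = df p u" using T_df[OF p w] by blast
  have "\<exists>\<alpha>. v a = df p \<alpha>" for a using T_df[OF p v(2)] by blast
  then obtain \<alpha> where \<alpha>: "\<And>a. v a = df p (\<alpha> a)" by metis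
  let ?Y = "\<lambda>a q. df q (\<alpha> a)" and ?D = "\<lambda>a. d2f p u (\<alpha> a)"
  have hv: "((\<lambda>q. holomorphic_volume (?Y 1 q) (?Y 2 q) (?Y 3 q)) has_derivative
    (\<lambda>w. holomorphic_volume (d2f p w (\<alpha> 1)) (?Y 2 p) (?Y 3 p) + holomorphic_volume (?Y 1 p) (d2f
        p w (\<alpha> 2)) (?Y 3 p)
      + holomorphic_volume (?Y 1 p) (?Y 2 p) (d2f p w (\<alpha> 3)))) (at p)"
    by (intro holomorphic_volume_has_derivative d2f_has_derivative p)
  have im: "Im (holomorphic_volume a b c) = 0" if "q \<in> V" "a \<in> T q" "b \<in> T q" "c \<in> T q" for q a b c
    using special_lag that f_in_L unfolding special_lagrangian_def by blast
  have "((\<lambda>q. Im (holomorphic_volume (?Y 1 q) (?Y 2 q) (?Y 3 q))) has_derivative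
    (\<lambda>w. Im (holomorphic_volume (d2f p w (\<alpha> 1)) (?Y 2 p) (?Y 3 p) + holomorphic_volume (?Y 1 p)
        (d2f p w (\<alpha> 2)) (?Y 3 p)
      + holomorphic_volume (?Y 1 p) (?Y 2 p) (d2f p w (\<alpha> 3))))) (at p)"
    using has_derivative_Im[OF hv] .
  moreover have "((\<lambda>q. Im (holomorphic_volume (?Y 1 q) (?Y 2 q) (?Y 3 q))) has_derivative (\<lambda>w.
      0)) (at p)"
    by (rule has_derivative_transform_within_open[OF _ open_V p, of "\<lambda>q. 0"])
      (use im df_tangent in auto)
  ultimately have "(\<lambda>w. Im (holomorphic_volume (d2f p w (\<alpha> 1)) (?Y 2 p) (?Y 3 p) +
      holomorphic_volume (?Y 1 p) (d2f p w (\<alpha> 2)) (?Y 3 p)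
      + holomorphic_volume (?Y 1 p) (?Y 2 p) (d2f p w (\<alpha> 3)))) = (\<lambda>w. 0)"
    using has_derivative_unique by blast
  from fun_cong[OF this, of u] have zero: "Im (holomorphic_volume (?D 1) (v 2) (v 3)
      + holomorphic_volume (v 1) (?D 2) (v 3) + holomorphic_volume (v 1) (v 2) (?D 3)) = 0"
    by (simp add: \<alpha>)
  \<comment> \<open>Complex coefficients of the derivatives in the frame: the real part is
    tangential, the imaginary part is the normal component, that is, the cubic.\<close>
  define c where "c = (\<lambda>a b. Complex (?D a \<bullet> v b) (C p w (v a) (v b)))"
  have D: "?D a = c a 1 *s v 1 + c a 2 *s v 2 + c a 3 *s v 3" for a
  proof -
    have "?D a \<bullet> (\<i> *s v b) = C p w (v a) (v b)" for b
      using cubic_df[OF p v(2)] u \<alpha> by metis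
    then have "c a b *s v b = (?D a \<bullet> v b) *\<^sub>R v b + (?D a \<bullet> (\<i> *s v b)) *\<^sub>R
        (\<i> *s v b)" for b
      unfolding complex_smult[of "c a b"] by (simp add: c_def)
    then have "?D a = (\<Sum>b\<in>UNIV. c a b *s v b)"
      using unitary_frame_expand[OF v(1), of "?D a"] by simp
    then show ?thesis by (simp add: sum_3)
  qed
  define h where "h = holomorphic_volume (v 1) (v 2) (v 3)"
  have "holomorphic_volume (?D 1) (v 2) (v 3)
      + holomorphic_volume (v 1) (?D 2) (v 3) + holomorphic_volume (v 1) (v 2) (?D 3)
      = (c 1 1 + c 2 2 + c 3 3) * h"
    unfolding D[of 1] D[of 2] D[of 3] h_def holomorphic_volume_expand by (simp add: algebra_simps)
  then have "Im ((c 1 1 + c 2 2 + c 3 3) * h) = 0" using zero by simp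
  moreover have "Im h = 0" unfolding h_def using im[OF p] v(2) by blast
  moreover have "h \<noteq> 0" using holomorphic_volume_unitary_frame[OF v(1)] unfolding h_def by force
  ultimately have "Im (c 1 1 + c 2 2 + c 3 3) = 0" by (auto simp: complex_eq_iff)
  then show ?thesis unfolding c_def by (simp add: sum_3)
qed

lemma cubic_scale:
  assumes p: "p \<in> V" and t: "a \<in> T p" "b \<in> T p" "c \<in> T p"
  shows "C p (i *\<^sub>R a) (j *\<^sub>R b) (k *\<^sub>R c) = i * j * k * C p a b c"
proof -
  have s: "C p x y (m *\<^sub>R z) = m * C p x y z" for x y z m
    using linear_cmul[OF cubic_linear3[of p x y]] by simp
  have sc: "m *\<^sub>R x \<in> T p" if "x \<in> T p" for m x
    using that subspace_tangent[OF p] by (simp add: subspace_scale)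
  have "C p (i *\<^sub>R a) (j *\<^sub>R b) (k *\<^sub>R c) = k * C p (i *\<^sub>R a) (j *\<^sub>R b) c" by (rule s)
  also have "C p (i *\<^sub>R a) (j *\<^sub>R b) c = j * C p (i *\<^sub>R a) c b"
    using cubic_commute23[OF p] sc t s by metis
  also have "C p (i *\<^sub>R a) c b = i * C p c b a"
    using cubic_commute12[OF p] cubic_commute23[OF p] sc t s by metis
  also have "C p c b a = C p a b c"
    using cubic_commute12[OF p] cubic_commute23[OF p] t by metis
  finally show ?thesis by simp
qed

text \<open>Linearity is at hand in the third slot only, so each argument is moved there by symmetry
  before it is expanded in the frame.\<close>

lemma cubic_eqI:
  assumes p: "p \<in> V" and v: "unitary_frame v" "\<And>a. v a \<in> T p"
    and lin: "\<And>a b. linear (F a b)"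
    and sym: "\<And>a b c. F a b c = F b a c" "\<And>a b c. F a b c = F a c b"
    and eq: "\<And>i j k. C p (v i) (v j) (v k) = F (v i) (v j) (v k)"
    and t: "a \<in> T p" "b \<in> T p" "c \<in> T p"
  shows "C p a b c = F a b c"
proof -
  have ext: "C p x y z = F x y z" if "z \<in> T p" "\<And>k. C p x y (v k) = F x y (v k)" for x y z
  proof -
    have z: "z = (\<Sum>a\<in>UNIV. (z \<bullet> v a) *\<^sub>R v a)"
      using lagrangian_expand[OF lagrangian_T[OF p] v that(1)] .
    have "C p x y (\<Sum>a\<in>UNIV. (z \<bullet> v a) *\<^sub>R v a) = F x y (\<Sum>a\<in>UNIV. (z \<bullet> v
        a) *\<^sub>R v a)"
      using that(2) by (simp add: linear_sum[OF cubic_linear3] linear_sum[OF lin]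
          linear_cmul[OF cubic_linear3] linear_cmul[OF lin])
    then show ?thesis using z by simp
  qed
  have 1: "C p (v i) (v j) c = F (v i) (v j) c" for i j using ext[OF t(3)] eq by blast
  have 2: "C p (v i) b c = F (v i) b c" for i
    using ext[OF t(2), of "v i" c] 1 cubic_commute23[OF p] t v(2) sym(2) by metis
  have "C p b c (v i) = F b c (v i)" for i
    using 2[of i] cubic_commute12[OF p] cubic_commute23[OF p] t v(2) sym by metis
  then have "C p b c a = F b c a" using ext[OF t(1)] by blast
  then show ?thesis using cubic_commute12[OF p] cubic_commute23[OF p] t sym by metis
qed

text \<open>Under rotations about the axis a cubic splits into weights of absolute value at most 3.
  A quarter turn acts on weight \<open>m\<close> by the \<open>m\<close>-th power of
  \<open>\<i>\<close>, so invariance leaves weight 0 only, and tracelessness leaves one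
  parameter.\<close>

lemma cubic_zonal:
  assumes p: "p \<in> V" and e: "e \<in> T p" "e \<noteq> 0"
    and rot: "rotations_about (T p) e \<subseteq> cubic_stabilizer L (f p)"
  obtains E r where "E \<in> T p" "norm E = 1" "r \<ge> 0"
    "\<And>a b c. a \<in> T p \<Longrightarrow> b \<in> T p \<Longrightarrow> c \<in> T p \<Longrightarrow> C p
        a b c = zonal E r a b c"
proof -
  note sub = subspace_tangent[OF p]
  define E where "E = (1 / norm e) *\<^sub>R e"
  have E: "E \<in> T p" "norm E = 1" using e sub unfolding E_def by (auto simp: subspace_scale)
  have eE: "e = norm e *\<^sub>R E" using e by (simp add: E_def)
  obtain v where v: "unitary_frame v" "\<And>a. v a \<in> T p" "v 1 = E"
    using lagrangian_frame_ex[OF lagrangian_T[OF p] E] by blast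
  have vv: "v a \<bullet> v b = (if a = b then 1 else 0)" for a b
    using v(1) unfolding unitary_frame_def by blast
  define \<phi> :: "real ^ 3 \<Rightarrow> complex ^ 3" where "\<phi> = (\<lambda>q. q $ 1 *\<^sub>R v 1 + q $
      2 *\<^sub>R v 2 + q $ 3 *\<^sub>R v 3)"
  \<comment> \<open>The quarter turn about the first axis, taking the second axis to the
    third.\<close>
  define A :: "real ^ 3 ^ 3" where "A = vector [vector [1, 0, 0], vector [0, 0, - 1], vector [0, 1, 0]]"
  define R where "R = restrict (\<lambda>z. \<phi> (A *v (\<chi> i. z \<bullet> v i))) (T p)"
  have lin: "linear \<phi>" unfolding \<phi>_def by (intro linearI) (auto simp: algebra_simps)
  have inT: "\<phi> q \<in> T p" for q
    unfolding \<phi>_def using v(2) sub by (auto intro!: subspace_add subspace_scale)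
  have coords: "(\<chi> i. \<phi> q \<bullet> v i) = q" for q
    unfolding vec_eq_iff forall_3 \<phi>_def by (simp add: inner_add_left vv)
  have R\<phi>: "R (\<phi> q) = \<phi> (A *v q)" for q unfolding R_def using inT coords by simp
  have surj: "z = \<phi> (\<chi> i. z \<bullet> v i)" if "z \<in> T p" for z
    using lagrangian_expand[OF lagrangian_T[OF p] v(1,2) that] unfolding \<phi>_def by (simp add: sum_3)
  have rng: "range \<phi> = T p" using inT surj by (metis image_subset_iff rangeI subset_antisym subsetI)
  have nrm: "norm (\<phi> q) = norm q" for q
  proof -
    have "\<phi> q \<bullet> \<phi> q = q \<bullet> q"
      unfolding inner_vec_def[of q] \<phi>_def by (simp add: inner_add_left inner_add_right vv sum_3)
    then show ?thesis by (simp add: norm_eq_sqrt_inner)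
  qed
  have ext: "R \<in> extensional (T p)" by (simp add: R_def)
  have "rotation_matrix A"
    unfolding rotation_matrix_def orthogonal_matrix A_def det_3
    by (simp add: vector_3 vec_eq_iff forall_3 matrix_matrix_mult_def transpose_def mat_def sum_3)
  then have "R \<in> special_orthogonal3 (T p)"
    unfolding special_orthogonal3_def using lin nrm R\<phi> rng ext
    by (auto intro!: exI[of _ \<phi>] exI[of _ A])
  moreover have Aq: "\<phi> (A *v q) = q $ 1 *\<^sub>R v 1 - q $ 3 *\<^sub>R v 2 + q $ 2 *\<^sub>R v 3" for q
    unfolding \<phi>_def A_def by (simp add: matrix_vector_mult_def vector_3 sum_3)
  have RT: "R z = (z \<bullet> v 1) *\<^sub>R v 1 - (z \<bullet> v 3) *\<^sub>R v 2 + (z \<bullet> v 2)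
      *\<^sub>R v 3" if "z \<in> T p" for z
    using R\<phi>[of "\<chi> i. z \<bullet> v i"] surj[OF that] Aq by simp
  have ev: "e \<bullet> v a = norm e * (if 1 = a then 1 else 0)" for a
    by (subst (1) eE) (simp add: v(3)[symmetric] vv)
  have "R e = norm e *\<^sub>R v 1" using RT[OF e(1)] by (simp add: ev)
  then have "R e = e" using eE v(3) by simp
  ultimately have "R \<in> cubic_stabilizer L (f p)" using rot unfolding rotations_about_def by blast
  then have inv: "C p (R (v i)) (R (v j)) (R (v k)) = C p (v i) (v j) (v k)" for i j k
    using v(2) unfolding cubic_stabilizer_def by blast
  define c where "c = (\<lambda>i j k. C p (v i) (v j) (v k))"
  have Rv: "R (v 1) = 1 *\<^sub>R v 1" "R (v 2) = 1 *\<^sub>R v 3" "R (v 3) = (- 1) *\<^sub>R v 2"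
    using RT[OF v(2)] by (simp_all add: vv)
  have sym: "c i j k = c j i k" "c i j k = c i k j" for i j k
    unfolding c_def using cubic_commute12[OF p] cubic_commute23[OF p] v(2) by blast+
  note sc = cubic_scale[OF p v(2) v(2) v(2)]
  have i: "c 1 1 2 = c 1 1 3" "c 1 1 3 = - c 1 1 2" "c 1 2 3 = - c 1 3 2" "c 1 2 2 = c 1 3 3"
    "c 2 2 2 = c 3 3 3" "c 3 3 3 = - c 2 2 2" "c 2 2 3 = - c 3 3 2" "c 2 3 3 = c 3 2 2"
    using inv[of 1 1 2] inv[of 1 1 3] inv[of 1 2 3] inv[of 1 2 2] inv[of 2 2 2] inv[of 3 3 3]
      inv[of 2 2 3] inv[of 2 3 3]
    unfolding Rv sc c_def by simp_all
  have tr: "c 1 1 1 + c 1 2 2 + c 1 3 3 = 0"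
    using cubic_tracefree[OF p v(1,2) v(2), of 1] unfolding c_def by (simp add: sum_3)
  \<comment> \<open>A zonal cubic takes the value \<open>(5 - 3) * r\<close> on its unit
    axis.\<close>
  define r where "r = c 1 1 1 / 2"
  have vals: "c 1 1 2 = 0" "c 1 1 3 = 0" "c 1 2 3 = 0" "c 2 2 2 = 0" "c 3 3 3 = 0" "c 2 2 3 = 0" "c 2 3 3 = 0"
    "c 1 2 2 = - r" "c 1 3 3 = - r" "c 1 1 1 = 2 * r"
    using i tr sym(2)[of 1 3 2] sym(2)[of 3 3 2] sym(1)[of 3 2 3] sym(2)[of 3 2 2] sym(1)[of 3 2 2] sym(2)[of 2 3 2]
    unfolding r_def by auto
  have "C p (v i) (v j) (v k) = zonal E r (v i) (v j) (v k)" for i j k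
  proof -
    have "\<forall>i j k. c i j k = zonal (v 1) r (v i) (v j) (v k)"
      unfolding forall_3 zonal_def vv
      using vals sym(1)[of 2 1] sym(1)[of 3 1] sym(1)[of 3 2] sym(2)[of _ 2 1] sym(2)[of _ 3 1] sym(2)[of _ 3 2]
      by simp
    then show ?thesis unfolding c_def v(3) by blast
  qed
  then have z: "C p a b c = zonal E r a b c" if "a \<in> T p" "b \<in> T p" "c \<in> T p" for a b c
    by (intro cubic_eqI[OF p v(1,2) _ _ _ _ that])
      (auto simp: zonal_def inner_commute algebra_simps intro!: linearI)
  show ?thesis
  proof (cases "r \<ge> 0")
    case True
    then show ?thesis using that[OF E] z by blast
  next
    case False
    \<comment> \<open>Reversing both the axis and the sign of \<open>r\<close> leaves the cubic
      unchanged.\<close>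
    then show ?thesis using that[of "- E" "- r"] z E sub
      by (auto simp: zonal_uminus subspace_neg)
  qed
qed

end

subsection \<open>Smoothness of the axis\<close>

text \<open>Strict positivity of \<open>r\<close> makes the pair \<open>E\<close>, \<open>r\<close>
  unique at a point.\<close>

definition axial :: "(complex ^ 3) set \<Rightarrow> complex ^ 3 \<Rightarrow> complex ^ 3 \<Rightarrow> real
    \<Rightarrow> bool" where
  "axial L x E r \<longleftrightarrow> E \<in> tangent_space L x \<and> norm E = 1 \<and> r > 0 \<and>
     (\<forall>a\<in>tangent_space L x. \<forall>b\<in>tangent_space L x. \<forall>c\<in>tangent_space L x.
        fundamental_cubic L x a b c = zonal E r a b c)"

definition flat_at :: "(complex ^ 3) set \<Rightarrow> complex ^ 3 \<Rightarrow> bool" where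
  "flat_at L x \<longleftrightarrow> (\<forall>a\<in>tangent_space L x. \<forall>b\<in>tangent_space L x.
      \<forall>c\<in>tangent_space L x.
        fundamental_cubic L x a b c = 0)"

lemma zonal_square:
  fixes e :: "3 \<Rightarrow> real" and \<delta> :: "3 \<Rightarrow> 3 \<Rightarrow> real"
  assumes \<delta>: "\<And>a b. \<delta> a b = (if a = b then 1 else 0)" and e: "(\<Sum>a\<in>UNIV. e a ^ 2) = 1"
    and z: "\<And>a b c. z a b c = r * (5 * e a * e b * e c - e a * \<delta> b c - e b * \<delta> a c - e c *
        \<delta> a b)"
  shows "(\<Sum>d\<in>UNIV. \<Sum>f\<in>UNIV. z b d f * z c d f) = r ^ 2 * (2 * \<delta> b c + 4 * e b * e c)"
proof -
  have e': "e 1 ^ 2 + e 2 ^ 2 + e 3 ^ 2 = 1" using e by (simp add: sum_3)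
  have *: "z b d f * z c d f = r ^ 2 * ((5 * e b * e d * e f - e b * \<delta> d f - e d * \<delta> b f - e f *
      \<delta> b d)
      * (5 * e c * e d * e f - e c * \<delta> d f - e d * \<delta> c f - e f * \<delta> c d))" for b c d f
    by (simp add: z power2_eq_square)
  have "\<forall>b c. (\<Sum>d\<in>UNIV. \<Sum>f\<in>UNIV. (5 * e b * e d * e f - e b * \<delta> d f - e d *
      \<delta> b f - e f * \<delta> b d)
      * (5 * e c * e d * e f - e c * \<delta> d f - e d * \<delta> c f - e f * \<delta> c d)) = 2 * \<delta> b
          c + 4 * e b * e c"
    unfolding forall_3 sum_3 \<delta> using e' by simp algebra
  then show ?thesis unfolding * by (simp add: sum_distrib_left[symmetric])
qed

text \<open>The trace of the cubic vanishes and a quadratic contraction would see \<open>E\<close>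
  only up to sign. A contraction of degree three is the simplest one that is odd in the cubic and
  returns the oriented axis.\<close>

lemma zonal_cube:
  fixes e :: "3 \<Rightarrow> real" and \<delta> :: "3 \<Rightarrow> 3 \<Rightarrow> real"
  assumes \<delta>: "\<And>a b. \<delta> a b = (if a = b then 1 else 0)" and e: "(\<Sum>a\<in>UNIV. e a ^ 2) = 1"
    and z: "\<And>a b c. z a b c = r * (5 * e a * e b * e c - e a * \<delta> b c - e b * \<delta> a c - e c *
        \<delta> a b)"
  shows "(\<Sum>b\<in>UNIV. \<Sum>c\<in>UNIV. z a b c * (\<Sum>d\<in>UNIV. \<Sum>f\<in>UNIV. z b d f * z c d
      f)) = 8 * r ^ 3 * e a"
proof -
  have e': "e 1 ^ 2 + e 2 ^ 2 + e 3 ^ 2 = 1" using e by (simp add: sum_3)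
  have *: "z a b c * (r ^ 2 * (2 * \<delta> b c + 4 * e b * e c))
      = r ^ 3 * ((5 * e a * e b * e c - e a * \<delta> b c - e b * \<delta> a c - e c * \<delta> a b) * (2 *
          \<delta> b c + 4 * e b * e c))" for a b c
    by (simp add: z power2_eq_square power3_eq_cube)
  have "\<forall>a. (\<Sum>b\<in>UNIV. \<Sum>c\<in>UNIV. (5 * e a * e b * e c - e a * \<delta> b c - e b *
      \<delta> a c - e c * \<delta> a b)
      * (2 * \<delta> b c + 4 * e b * e c)) = 8 * e a"
    unfolding forall_3 sum_3 \<delta> using e' by simp algebra
  then show ?thesis unfolding zonal_square[OF assms] * by (simp add: sum_distrib_left[symmetric])
qed

section \<open>Smooth tangent frames and the axis vector\<close>

context slag_chart
begin

text \<open>Gram--Schmidt for the metric pulled back by \<open>df\<close>, carried out on parameter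
  vectors so that the resulting fields are visibly tangent and can serve as directions of
  differentiation.\<close>

lemma smooth_frame_ex:
  "\<exists>\<alpha> :: 3 \<Rightarrow> real ^ 3 \<Rightarrow> real ^ 3. (\<forall>a. smooth_on V (\<alpha> a)) \<and>
     (\<forall>q\<in>V. \<forall>a b. df q (\<alpha> a q) \<bullet> df q (\<alpha> b q) = (if a = b then 1 else 0))"
proof -
  define N where "N = (\<lambda>\<beta> q. inverse (norm (df q (\<beta> q))) *\<^sub>R (\<beta> q :: real ^ 3))"
  define pr where "pr = (\<lambda>\<beta> x q. (df q x \<bullet> df q (\<beta> q)) *\<^sub>R (\<beta> q :: real ^ 3))"
  have nz: "df q x \<noteq> 0" if "q \<in> V" "x \<noteq> 0" for q x
    using that linear_df inj_df linear_injective_0 by blast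
  have sN: "smooth_on V (N \<beta>)" if \<beta>: "smooth_on V \<beta>" "\<And>q. q \<in> V \<Longrightarrow>
      \<beta> q \<noteq> 0" for \<beta>
    unfolding N_def
    by (intro smooth_on_scaleR smooth_on_inverse smooth_on_norm open_V smooth_on_deriv_dir smooth_f \<beta>)
      (use nz \<beta>(2) in auto)
  have sp: "smooth_on V (pr \<beta> x)" if "smooth_on V \<beta>" for \<beta> x
    unfolding pr_def
    by (intro smooth_on_scaleR smooth_on_inner open_V smooth_on_deriv_dir smooth_f smooth_on_const that)
  have dN: "df q (N \<beta> q) = inverse (norm (df q (\<beta> q))) *\<^sub>R df q (\<beta> q)" if "q \<in> V"
      for \<beta> q
    unfolding N_def using linear_df[OF that] by (simp add: linear_cmul)
  have NN: "df q (N \<beta> q) \<bullet> df q (N \<beta> q) = 1" if "q \<in> V" "\<beta> q \<noteq> 0" for \<beta> q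
    using nz[OF that] by (simp add: dN[OF that(1)] dot_square_norm power2_eq_square)
  have dp: "df q (pr \<beta> x q) = (df q x \<bullet> df q (\<beta> q)) *\<^sub>R df q (\<beta> q)" if "q \<in>
      V" for \<beta> x q
    unfolding pr_def using linear_df[OF that] by (simp add: linear_cmul)
  define \<alpha>1 where "\<alpha>1 = N (\<lambda>q. axis 1 1)"
  define \<beta>2 where "\<beta>2 = (\<lambda>q. axis 2 1 - pr \<alpha>1 (axis 2 1) q)"
  define \<alpha>2 where "\<alpha>2 = N \<beta>2"
  define \<beta>3 where "\<beta>3 = (\<lambda>q. axis 3 1 - pr \<alpha>1 (axis 3 1) q - pr \<alpha>2 (axis 3 1) q)"
  define \<alpha>3 where "\<alpha>3 = N \<beta>3"
  \<comment> \<open>The triangular shape of the coordinates ensures that no vector to be normalized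
    vanishes: \<open>\<beta>2\<close> and \<open>\<beta>3\<close> keep the entry 1 in their last
    nonzero place.\<close>
  have c1: "\<alpha>1 q $ 2 = 0" "\<alpha>1 q $ 3 = 0" for q unfolding \<alpha>1_def N_def by (simp_all add: axis_def)
  have c2: "\<beta>2 q $ 2 = 1" "\<beta>2 q $ 3 = 0" for q
    unfolding \<beta>2_def pr_def by (simp_all add: c1) (simp_all add: axis_def)
  then have c2': "\<alpha>2 q $ 3 = 0" for q unfolding \<alpha>2_def N_def by simp
  have c3: "\<beta>3 q $ 3 = 1" for q
    unfolding \<beta>3_def pr_def by (simp add: c1 c2' axis_def)
  have n1: "axis 1 1 \<noteq> (0 :: real ^ 3)" by (simp add: axis_eq_0_iff)
  have n2: "\<beta>2 q \<noteq> 0" "\<beta>3 q \<noteq> 0" for q using c2 c3 by (metis zero_index zero_neq_one)+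
  have s1: "smooth_on V \<alpha>1" unfolding \<alpha>1_def using n1 by (intro sN smooth_on_const open_V) auto
  have s2: "smooth_on V \<alpha>2" unfolding \<alpha>2_def
    by (rule sN, unfold \<beta>2_def, intro smooth_on_diff smooth_on_const sp s1 open_V)
      (use n2 in \<open>simp add: \<beta>2_def\<close>)
  have s3: "smooth_on V \<alpha>3" unfolding \<alpha>3_def
    by (rule sN, unfold \<beta>3_def, intro smooth_on_diff smooth_on_const sp s1 s2 open_V)
      (use n2 in \<open>simp add: \<beta>3_def\<close>)
  define \<alpha> where "\<alpha> = (\<lambda>a :: 3. if a = 1 then \<alpha>1 else if a = 2 then \<alpha>2 else
      \<alpha>3)"
  have "\<forall>a b. df q (\<alpha> a q) \<bullet> df q (\<alpha> b q) = (if a = b then 1 else 0)" if q: "q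
      \<in> V" for q
  proof -
    have o11: "df q (\<alpha>1 q) \<bullet> df q (\<alpha>1 q) = 1" unfolding \<alpha>1_def by (rule NN[OF q n1])
    have o22: "df q (\<alpha>2 q) \<bullet> df q (\<alpha>2 q) = 1" unfolding \<alpha>2_def by (rule NN[OF q n2(1)])
    have o33: "df q (\<alpha>3 q) \<bullet> df q (\<alpha>3 q) = 1" unfolding \<alpha>3_def by (rule NN[OF q n2(2)])
    have "df q (\<beta>2 q) \<bullet> df q (\<alpha>1 q) = 0"
      unfolding \<beta>2_def by (simp add: linear_diff[OF linear_df[OF q]] dp[OF q] inner_diff_left o11)
    then have o21: "df q (\<alpha>2 q) \<bullet> df q (\<alpha>1 q) = 0"
      unfolding \<alpha>2_def by (simp add: dN[OF q])
    then have o12: "df q (\<alpha>1 q) \<bullet> df q (\<alpha>2 q) = 0" by (simp add: inner_commute)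
    have "df q (\<beta>3 q) \<bullet> df q (\<alpha>1 q) = 0" "df q (\<beta>3 q) \<bullet> df q (\<alpha>2 q) = 0"
      unfolding \<beta>3_def
      by (simp_all add: linear_diff[OF linear_df[OF q]] dp[OF q] inner_diff_left o11 o22 o12 o21)
    then have o3: "df q (\<alpha>3 q) \<bullet> df q (\<alpha>1 q) = 0" "df q (\<alpha>3 q) \<bullet> df q
        (\<alpha>2 q) = 0"
      unfolding \<alpha>3_def by (simp_all add: dN[OF q])
    then have "df q (\<alpha>1 q) \<bullet> df q (\<alpha>3 q) = 0" "df q (\<alpha>2 q) \<bullet> df q
        (\<alpha>3 q) = 0"
      by (simp_all add: inner_commute)
    then show ?thesis unfolding \<alpha>_def forall_3 using o11 o22 o33 o21 o12 o3 by simp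
  qed
  moreover have "smooth_on V (\<alpha> a)" for a using s1 s2 s3 unfolding \<alpha>_def by simp
  ultimately show ?thesis by blast
qed

definition fcoef :: "3 \<Rightarrow> real ^ 3 \<Rightarrow> real ^ 3" where
  "fcoef = (SOME \<alpha>. (\<forall>a. smooth_on V (\<alpha> a)) \<and>
     (\<forall>q\<in>V. \<forall>a b. df q (\<alpha> a q) \<bullet> df q (\<alpha> b q) = (if a = b then 1 else 0)))"

definition fr :: "3 \<Rightarrow> real ^ 3 \<Rightarrow> complex ^ 3" where
  "fr a q = df q (fcoef a q)"

lemma smooth_fcoef: "smooth_on V (fcoef a)"
  and fr_inner: "q \<in> V \<Longrightarrow> fr a q \<bullet> fr b q = (if a = b then 1 else 0)"
  using someI_ex[OF smooth_frame_ex] unfolding fcoef_def[symmetric] fr_def by blast+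

lemma fr_T: "q \<in> V \<Longrightarrow> fr a q \<in> T q"
  unfolding fr_def by (rule df_tangent)

lemma fr_unitary: "q \<in> V \<Longrightarrow> unitary_frame (\<lambda>a. fr a q)"
  unfolding unitary_frame_def using fr_inner T_inner fr_T by auto

lemma smooth_fr: "smooth_on V (fr a)"
  unfolding fr_def by (intro smooth_on_deriv_dir open_V smooth_f smooth_fcoef)

definition Cfr :: "3 \<Rightarrow> 3 \<Rightarrow> 3 \<Rightarrow> real ^ 3 \<Rightarrow> real" where
  "Cfr a b c q = C q (fr a q) (fr b q) (fr c q)"

text \<open>The cubic is defined by a pointwise description; \<open>cubic_field\<close> rewrites its
  frame components as derivatives of the smooth frame.\<close>

lemma smooth_Cfr: "smooth_on V (Cfr a b c)"
proof (rule smooth_on_cong[OF open_V])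
  show "smooth_on V (\<lambda>q. frechet_derivative (fr b) (at q) (fcoef a q) \<bullet> (\<i> *s fr c q))"
    by (intro smooth_on_inner smooth_on_deriv_dir smooth_on_linear[OF _ bounded_linear_i]
        open_V smooth_fr smooth_fcoef)
  show "frechet_derivative (fr b) (at q) (fcoef a q) \<bullet> (\<i> *s fr c q) = Cfr a b c q" if "q \<in> V" for q
    unfolding Cfr_def
    using cubic_field[OF that fr_T smooth_on_has_derivative[OF smooth_fr that] fr_T[OF that]]
    unfolding fr_def[of a] by simp
qed

definition axis_vec :: "real ^ 3 \<Rightarrow> complex ^ 3" where
  "axis_vec q = (\<Sum>a\<in>UNIV. (\<Sum>b\<in>UNIV. \<Sum>c\<in>UNIV. Cfr a b c q *
     (\<Sum>d\<in>UNIV. \<Sum>f\<in>UNIV. Cfr b d f q * Cfr c d f q)) *\<^sub>R fr a q)"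

lemma smooth_axis_vec: "smooth_on V axis_vec"
  unfolding axis_vec_def
  by (intro smooth_on_sum smooth_on_scaleR smooth_on_mult open_V smooth_Cfr smooth_fr finite)

lemma axis_vec_axial:
  assumes q: "q \<in> V" and ax: "axial L (f q) E r"
  shows "axis_vec q = (8 * r ^ 3) *\<^sub>R E"
proof -
  define e where "e = (\<lambda>a. E \<bullet> fr a q)"
  have E: "E \<in> T q" "norm E = 1" using ax unfolding axial_def by auto
  have ex: "E = (\<Sum>a\<in>UNIV. e a *\<^sub>R fr a q)"
    unfolding e_def by (rule lagrangian_expand[OF lagrangian_T[OF q] fr_unitary[OF q] fr_T[OF q] E(1)])
  have "1 = E \<bullet> E" using E(2) by (simp add: dot_square_norm)
  also have "\<dots> = E \<bullet> (\<Sum>a\<in>UNIV. e a *\<^sub>R fr a q)" using ex by simp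
  also have "\<dots> = (\<Sum>a\<in>UNIV. e a ^ 2)"
    by (simp add: inner_sum_right e_def power2_eq_square)
  finally have n: "(\<Sum>a\<in>UNIV. e a ^ 2) = 1" by simp
  have z: "Cfr a b c q = r * (5 * e a * e b * e c - e a * (if b = c then 1 else 0)
      - e b * (if a = c then 1 else 0) - e c * (if a = b then 1 else 0))" for a b c
    using ax fr_T[OF q] unfolding axial_def Cfr_def zonal_def e_def by (simp add: fr_inner[OF q])
  have "axis_vec q = (\<Sum>a\<in>UNIV. (8 * r ^ 3 * e a) *\<^sub>R fr a q)"
    unfolding axis_vec_def
    by (simp only: zonal_cube[of "\<lambda>a b. if a = b then 1 else 0", OF refl n z])
  also have "\<dots> = (8 * r ^ 3) *\<^sub>R E" by (subst ex) (simp add: scaleR_sum_right)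
  finally show ?thesis .
qed

lemma axis_vec_flat: "q \<in> V \<Longrightarrow> flat_at L (f q) \<Longrightarrow> axis_vec q = 0"
  unfolding axis_vec_def Cfr_def flat_at_def using fr_T by simp

lemma restrict_chart:
  assumes W: "open W" "W \<subseteq> V"
  shows "slag_chart L W f"
proof -
  obtain g where g: "homeomorphism V (f ` V) f g" using ex_inverse by blast
  have "homeomorphism W (f ` W) f g"
    by (rule homeomorphism_of_subsets[OF g W(2)]) (use W g in \<open>auto simp: homeomorphism_def\<close>)
  moreover have "openin (top_of_set L) (f ` W)"
  proof -
    have "openin (top_of_set V) W" using W open_V by (simp add: openin_open_eq)
    then have "openin (top_of_set (f ` V)) (f ` W)"
      using homeomorphism_imp_open_map[OF g] by blast
    then show ?thesis using openin_image openin_trans by blast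
  qed
  ultimately have "local_parametrization L W f"
    unfolding local_parametrization_def
    using W smooth_on_subset[OF smooth_f W(2)] inj_df by blast
  then show ?thesis by unfold_locales (use special_lag in auto)
qed

end

text \<open>\<open>E\<close> and \<open>r\<close> are functions of the point in space rather than of
  the parameter, so that all charts share them. Their smoothness is derived, not assumed.\<close>

locale axial_chart = slag_chart L V f
  for L :: "(complex ^ 3) set" and V :: "(real ^ 3) set" and f :: "real ^ 3 \<Rightarrow> complex ^ 3" +
  fixes E :: "complex ^ 3 \<Rightarrow> complex ^ 3" and r :: "complex ^ 3 \<Rightarrow> real"
  assumes axial: "\<And>p. p \<in> V \<Longrightarrow> axial L (f p) (E (f p)) (r (f p))"
begin

abbreviation e :: "real ^ 3 \<Rightarrow> complex ^ 3" where "e q \<equiv> E (f q)"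
abbreviation \<rho> :: "real ^ 3 \<Rightarrow> real" where "\<rho> q \<equiv> r (f q)"

lemma e_T: "p \<in> V \<Longrightarrow> e p \<in> T p" and e_norm: "p \<in> V \<Longrightarrow> norm (e p) = 1"
  and rho_pos: "p \<in> V \<Longrightarrow> \<rho> p > 0"
  and C_zonal: "p \<in> V \<Longrightarrow> a \<in> T p \<Longrightarrow> b \<in> T p \<Longrightarrow> c \<in>
      T p \<Longrightarrow> C p a b c = zonal (e p) (\<rho> p) a b c"
  using axial unfolding axial_def by auto

lemma e_e: "p \<in> V \<Longrightarrow> e p \<bullet> e p = 1"
  using e_norm by (simp add: dot_square_norm)

lemma smooth_e: "smooth_on V e"
proof (rule smooth_on_cong[OF open_V])
  show "smooth_on V (\<lambda>q. inverse (norm (axis_vec q)) *\<^sub>R axis_vec q)"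
  proof (intro smooth_on_sgn open_V smooth_axis_vec)
    fix q assume "q \<in> V"
    then show "axis_vec q \<noteq> 0"
      using axis_vec_axial[OF _ axial[of q]] e_norm[of q] rho_pos[of q] by force
  qed
  show "inverse (norm (axis_vec q)) *\<^sub>R axis_vec q = e q" if "q \<in> V" for q
    using axis_vec_axial[OF that axial[OF that]] e_norm[OF that] rho_pos[OF that] by simp
qed

text \<open>The axis pulled back to the parameter domain, so that functions can be differentiated
  along it.\<close>

definition \<eta> :: "real ^ 3 \<Rightarrow> real ^ 3" where
  "\<eta> q = (\<Sum>a\<in>UNIV. (e q \<bullet> fr a q) *\<^sub>R fcoef a q)"

lemma smooth_eta: "smooth_on V \<eta>"
  unfolding \<eta>_def
  by (intro smooth_on_sum smooth_on_scaleR smooth_on_inner open_V smooth_fcoef smooth_fr smooth_e finite)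

lemma df_eta: assumes q: "q \<in> V" shows "df q (\<eta> q) = e q"
  using lagrangian_expand[OF lagrangian_T[OF q] fr_unitary[OF q] fr_T[OF q] e_T[OF q]]
  unfolding \<eta>_def fr_def by (simp add: linear_sum[OF linear_df[OF q]] linear_cmul[OF linear_df[OF q]])

abbreviation De where "De p \<equiv> frechet_derivative e (at p)"

lemma e_has_derivative: "p \<in> V \<Longrightarrow> (e has_derivative De p) (at p)"
  by (rule smooth_on_has_derivative[OF smooth_e])

text \<open>The cubic takes the value \<open>2 r\<close> on the axis, and \<open>cubic_field\<close>
  expresses it by a derivative of the smooth field \<open>e\<close>.\<close>

lemma smooth_rho: "smooth_on V \<rho>"
proof (rule smooth_on_cong[OF open_V])
  show "smooth_on V (\<lambda>q. (1/2) * (De q (\<eta> q) \<bullet> (\<i> *s e q)))"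
    by (intro smooth_on_mult smooth_on_inner smooth_on_deriv_dir smooth_on_linear[OF _ bounded_linear_i]
        open_V smooth_e smooth_eta smooth_on_const)
  show "(1/2) * (De q (\<eta> q) \<bullet> (\<i> *s e q)) = \<rho> q" if q: "q \<in> V" for q
  proof -
    have "De q (\<eta> q) \<bullet> (\<i> *s e q) = zonal (e q) (\<rho> q) (e q) (e q) (e q)"
      using cubic_field[OF q e_T e_has_derivative[OF q] e_T[OF q], of "\<eta> q"]
        C_zonal[OF q e_T[OF q] e_T[OF q] e_T[OF q]] df_eta[OF q] by simp
    then show ?thesis by (simp add: zonal_def e_e[OF q])
  qed
qed

end

subsection \<open>The structure equations\<close>

lemma unitary_frame_independent:
  assumes v: "unitary_frame v" and z: "x *s v 1 + y *s v 2 + z *s v 3 = 0"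
  shows "x = 0" "y = 0" "z = 0"
proof -
  have vv: "v a \<bullet> v b = (if a = b then 1 else 0)" "v a \<bullet> (\<i> *s v b) = 0" "(\<i> *s v a)
      \<bullet> v b = 0" for a b
    using v inner_i_left[of "v a" "v b"] unfolding unitary_frame_def by auto
  have s: "x *s v 1 + y *s v 2 + z *s v 3 = Re x *\<^sub>R v 1 + Im x *\<^sub>R (\<i> *s v 1)
     + (Re y *\<^sub>R v 2 + Im y *\<^sub>R (\<i> *s v 2)) + (Re z *\<^sub>R v 3 + Im z *\<^sub>R (\<i> *s v 3))"
    unfolding complex_smult[of x "v 1"] complex_smult[of y "v 2"] complex_smult[of z "v 3"] by simp
  have "(x *s v 1 + y *s v 2 + z *s v 3) \<bullet> u = 0" for u using z by simp
  note zero = this[unfolded s]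
  show "x = 0" using zero[of "v 1"] zero[of "\<i> *s v 1"]
    by (simp add: inner_add_left vv complex_eq_iff)
  show "y = 0" using zero[of "v 2"] zero[of "\<i> *s v 2"]
    by (simp add: inner_add_left vv complex_eq_iff)
  show "z = 0" using zero[of "v 3"] zero[of "\<i> *s v 3"]
    by (simp add: inner_add_left vv complex_eq_iff)
qed

context axial_chart
begin

abbreviation \<epsilon> where "\<epsilon> q u \<equiv> e q \<bullet> df q u"
abbreviation D\<rho> where "D\<rho> p \<equiv> frechet_derivative \<rho> (at p)"

lemma rho_has_derivative: "p \<in> V \<Longrightarrow> (\<rho> has_derivative D\<rho> p) (at p)"
  by (rule smooth_on_has_derivative[OF smooth_rho])

lemma linear_De: "p \<in> V \<Longrightarrow> linear (De p)"
  using e_has_derivative has_derivative_linear by blast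

lemma linear_Drho: "p \<in> V \<Longrightarrow> linear (D\<rho> p)"
  using rho_has_derivative has_derivative_linear by blast

lemma De_normal:
  assumes p: "p \<in> V" and z: "z \<in> T p"
  shows "De p u \<bullet> (\<i> *s z) = \<rho> p * (3 * \<epsilon> p u * (e p \<bullet> z) - df p u \<bullet> z)"
  using cubic_field[OF p e_T e_has_derivative[OF p] z, of u]
    C_zonal[OF p df_tangent[OF p] e_T[OF p] z] e_e[OF p]
  by (simp add: zonal_def inner_commute algebra_simps)

lemma De_e: assumes p: "p \<in> V" shows "De p u \<bullet> e p = 0"
proof -
  have "((\<lambda>q. e q \<bullet> e q) has_derivative (\<lambda>u. e p \<bullet> De p u + De p u \<bullet> e
      p)) (at p)"
    by (intro has_derivative_inner e_has_derivative p)
  moreover have "((\<lambda>q. e q \<bullet> e q) has_derivative (\<lambda>u. 0)) (at p)"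
    by (rule has_derivative_transform_within_open[OF _ open_V p, of "\<lambda>q. 1"]) (auto simp: e_e)
  ultimately have "(\<lambda>u. e p \<bullet> De p u + De p u \<bullet> e p) = (\<lambda>u. 0)"
    using has_derivative_unique by blast
  from fun_cong[OF this, of u] show ?thesis by (simp add: inner_commute)
qed

text \<open>The tangential part of \<open>De\<close>: the subtracted vector is the normal part found
  in \<open>De_normal\<close>. For fixed \<open>u\<close> it is again a tangent field, so
  \<open>cubic_field\<close> applies a second time.\<close>

definition A :: "real ^ 3 \<Rightarrow> real ^ 3 \<Rightarrow> complex ^ 3" where
  "A u q = De q u - \<rho> q *\<^sub>R (\<i> *s ((3 * \<epsilon> q u) *\<^sub>R e q - df q u))"

lemma A_T: assumes q: "q \<in> V" shows "A u q \<in> T q"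
proof (rule lagrangian_memI[OF lagrangian_T[OF q]])
  fix z assume "z \<in> T q"
  then show "A u q \<bullet> (\<i> *s z) = 0"
    unfolding A_def by (simp add: De_normal[OF q] inner_diff_left)
qed

lemma A_inner:
  assumes q: "q \<in> V" and z: "z \<in> T q"
  shows "A u q \<bullet> z = De q u \<bullet> z"
proof -
  show ?thesis unfolding A_def using T_inner[OF q e_T[OF q] z] T_inner[OF q df_tangent[OF q] z]
    by (simp add: inner_diff_left inner_i_left)
qed

lemma A_e: "p \<in> V \<Longrightarrow> A u p \<bullet> e p = 0"
  using A_inner e_T De_e by simp

definition d2e where "d2e p w u = frechet_derivative (\<lambda>q. De q u) (at p) w"

lemma d2e_has_derivative: "p \<in> V \<Longrightarrow> ((\<lambda>q. De q u) has_derivative (\<lambda>w. d2e p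
    w u)) (at p)"
  unfolding d2e_def by (rule smooth_on_has_derivative[OF smooth_on_deriv[OF smooth_e]])

lemma d2e_commute: "p \<in> V \<Longrightarrow> d2e p w u = d2e p u w"
  unfolding d2e_def by (rule second_derivative_symmetric[OF smooth_e open_V])

lemma eps_has_derivative:
  assumes p: "p \<in> V"
  shows "((\<lambda>q. \<epsilon> q u) has_derivative (\<lambda>w. e p \<bullet> d2f p w u + De p w \<bullet>
      df p u)) (at p)"
  by (intro has_derivative_inner e_has_derivative d2f_has_derivative p)

text \<open>Write \<open>De\<close> as \<open>A\<close> plus \<open>\<i>\<close> times an explicit
  tangent field. The derivative of \<open>A\<close> contributes the cubic, that of the explicit
  field the remaining terms, so that, besides \<open>d2f\<close>, only first derivatives of
  \<open>e\<close> and \<open>r\<close> occur.\<close>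

lemma d2e_normal:
  assumes p: "p \<in> V" and z: "z \<in> T p"
  shows "d2e p w u \<bullet> (\<i> *s z) =
    \<rho> p * (- \<epsilon> p w * (A u p \<bullet> z) - (e p \<bullet> z) * (df p w \<bullet> A u p))
    + D\<rho> p w * (3 * \<epsilon> p u * (e p \<bullet> z) - df p u \<bullet> z)
    + \<rho> p * (3 * (A w p \<bullet> df p u + e p \<bullet> d2f p w u) * (e p \<bullet> z) + 3 * \<epsilon> p
        u * (A w p \<bullet> z) - d2f p w u \<bullet> z)"
proof -
  define B where "B = (\<lambda>w. \<rho> p *\<^sub>R ((3 * \<epsilon> p u) *\<^sub>R De p w
      + (3 * (e p \<bullet> d2f p w u + De p w \<bullet> df p u)) *\<^sub>R e p - d2f p w u)
      + D\<rho> p w *\<^sub>R ((3 * \<epsilon> p u) *\<^sub>R e p - df p u))"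
  have "((\<lambda>q. \<rho> q *\<^sub>R ((3 * \<epsilon> q u) *\<^sub>R e q - df q u)) has_derivative B) (at p)"
    unfolding B_def
    by (intro has_derivative_scaleR has_derivative_diff rho_has_derivative e_has_derivative
        d2f_has_derivative has_derivative_mult_right eps_has_derivative p)
  then have "(A u has_derivative (\<lambda>w. d2e p w u - \<i> *s B w)) (at p)"
    unfolding A_def i_scaleR[symmetric]
    by (intro has_derivative_diff d2e_has_derivative p bounded_linear.has_derivative[OF bounded_linear_i])
  from cubic_field[OF p A_T this z, of w]
  have "d2e p w u \<bullet> (\<i> *s z) = C p (df p w) (A u p) z + B w \<bullet> z"
    by (simp add: inner_diff_left)
  also have "C p (df p w) (A u p) z = \<rho> p * (- \<epsilon> p w * (A u p \<bullet> z) - (e p \<bullet> z) *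
      (df p w \<bullet> A u p))"
  proof -
    have eA: "e p \<bullet> A u p = 0" using A_e[OF p, of u] by (simp add: inner_commute)
    show ?thesis unfolding C_zonal[OF p df_tangent[OF p] A_T[OF p] z] zonal_def eA
      by (simp add: inner_commute algebra_simps)
  qed
  also have "B w \<bullet> z = D\<rho> p w * (3 * \<epsilon> p u * (e p \<bullet> z) - df p u \<bullet> z)
    + \<rho> p * (3 * (A w p \<bullet> df p u + e p \<bullet> d2f p w u) * (e p \<bullet> z) + 3 * \<epsilon> p
        u * (A w p \<bullet> z) - d2f p w u \<bullet> z)"
    unfolding B_def using A_inner[OF p z, of w] A_inner[OF p df_tangent[OF p], of w]
    by (simp add: inner_add_left inner_diff_left algebra_simps)
  finally show ?thesis by simp
qed

text \<open>Antisymmetrization of \<open>d2e_normal\<close> in \<open>u\<close> and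
  \<open>w\<close>: the second derivatives of \<open>e\<close> and \<open>f\<close> are symmetric
  and cancel.\<close>

lemma codazzi:
  assumes p: "p \<in> V" and z: "z \<in> T p"
  shows "4 * \<rho> p * (\<epsilon> p u * (A w p \<bullet> z) - \<epsilon> p w * (A u p \<bullet> z))
    + 4 * \<rho> p * (e p \<bullet> z) * (A w p \<bullet> df p u - A u p \<bullet> df p w)
    + D\<rho> p w * (3 * \<epsilon> p u * (e p \<bullet> z) - df p u \<bullet> z)
    - D\<rho> p u * (3 * \<epsilon> p w * (e p \<bullet> z) - df p w \<bullet> z) = 0"
  using d2e_normal[OF p z, of w u] d2e_normal[OF p z, of u w] d2e_commute[OF p, of w u] d2f_commute[OF p, of w u]
  by (simp add: inner_commute[of "df p w"] inner_commute[of "df p u"] algebra_simps)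

text \<open>Minus a quarter of the logarithmic derivative of \<open>r\<close> along the axis. The
  Codazzi equation shows that the same number is the rate at which the plane across the axis expands
  under \<open>A\<close>.\<close>

definition h :: "real ^ 3 \<Rightarrow> real" where
  "h q = - (1/4) * (inverse (\<rho> q) * D\<rho> q (\<eta> q))"

lemma smooth_h: "smooth_on V h"
  unfolding h_def using rho_pos
  by (intro smooth_on_mult smooth_on_inverse smooth_on_deriv_dir smooth_on_const open_V smooth_rho smooth_eta)
    force

text \<open>Evaluate \<open>codazzi\<close> on a frame starting with the axis. Two directions across
  the axis give that \<open>r\<close> is stationary across it; one along and one across, tested
  across, make \<open>A\<close> equal to \<open>h\<close> times the identity there; tested along the
  axis, they kill \<open>A\<close> in the direction of the axis.\<close>

lemma structure_aux:
  assumes p: "p \<in> V"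
  shows "A u p = h p *\<^sub>R (df p u - \<epsilon> p u *\<^sub>R e p)" "D\<rho> p u = - 4 * h p * \<rho> p *
      \<epsilon> p u"
proof -
  note lag = lagrangian_T[OF p]
  obtain v where v: "unitary_frame v" "\<And>a. v a \<in> T p" "v 1 = e p"
    using lagrangian_frame_ex[OF lag e_T[OF p] e_norm[OF p]] by blast
  have vv: "v a \<bullet> v b = (if a = b then 1 else 0)" for a b
    using v(1) unfolding unitary_frame_def by blast
  have "\<exists>\<alpha>. v a = df p \<alpha>" for a using T_df[OF p v(2)] by blast
  then obtain \<alpha> where \<alpha>: "\<And>a. df p (\<alpha> a) = v a" by metis
  have r: "\<rho> p > 0" by (rule rho_pos[OF p])
  have "inj (df p)" by (rule inj_df[OF p])
  then have a1: "\<alpha> 1 = \<eta> p" using \<alpha>[of 1] v(3) df_eta[OF p] by (metis injD)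
  have eps: "e p \<bullet> v a = (if a = 1 then 1 else 0)" for a using vv[of 1 a] v(3) by auto
  note cz = codazzi[OF p v(2), of "\<alpha> _" "\<alpha> _", unfolded \<alpha> eps vv]
  have D2: "D\<rho> p (\<alpha> 2) = 0" using cz[of 3 2 3] by simp
  have D3: "D\<rho> p (\<alpha> 3) = 0" using cz[of 3 2 2] by simp
  have D1: "D\<rho> p (\<alpha> 1) = - 4 * h p * \<rho> p" unfolding h_def a1 using r by simp
  have Ae: "A u p \<bullet> v 1 = 0" for u using A_e[OF p] v(3) by simp
  have Ab: "4 * \<rho> p * (A (\<alpha> b) p \<bullet> v c) + D\<rho> p (\<alpha> 1) * (if b = c then 1 else 0)
      = 0" if "b \<noteq> 1" "c \<noteq> 1" for b c
    using cz[of 1 b c] that by simp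
  have A2: "A (\<alpha> b) p \<bullet> v c = h p * (if b = c then 1 else 0)" if "b \<noteq> 1" "c \<noteq> 1" for b c
    using Ab[OF that] r unfolding D1 by (simp split: if_splits)
  have "4 * \<rho> p * (A (\<alpha> b) p \<bullet> v 1 - A (\<alpha> 1) p \<bullet> v b) + 4 * \<rho> p * (A
      (\<alpha> b) p \<bullet> v 1) + 2 * D\<rho> p (\<alpha> b) = 0" if "b \<noteq> 1" for b
    using cz[of 1 b 1] that by (simp add: algebra_simps)
  then have A1: "A (\<alpha> 1) p \<bullet> v b = 0" if "b \<noteq> 1" for b
    using that D2 D3 Ae r exhaust_3[of b] by force
  have Aall: "A (\<alpha> a) p = h p *\<^sub>R (v a - (if a = 1 then 1 else 0) *\<^sub>R v 1)" for a
  proof -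
    have "A (\<alpha> a) p = (\<Sum>c\<in>UNIV. (A (\<alpha> a) p \<bullet> v c) *\<^sub>R v c)"
      by (rule lagrangian_expand[OF lag v(1,2) A_T[OF p]])
    then have "A (\<alpha> a) p = (A (\<alpha> a) p \<bullet> v 2) *\<^sub>R v 2 + (A (\<alpha> a) p \<bullet>
        v 3) *\<^sub>R v 3"
      by (simp add: sum_3 Ae)
    then show ?thesis using exhaust_3[of a] A1[of 2] A1[of 3] A2[of 2 2] A2[of 2 3] A2[of 3 2] A2[of 3 3]
      by auto
  qed
  define c where "c = (\<lambda>a. df p u \<bullet> v a)"
  have dfu: "df p u = (\<Sum>a\<in>UNIV. c a *\<^sub>R v a)"
    unfolding c_def by (rule lagrangian_expand[OF lag v(1,2) df_tangent[OF p]])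
  have "df p (\<Sum>a\<in>UNIV. c a *\<^sub>R \<alpha> a) = df p u"
    using dfu by (simp add: linear_sum[OF linear_df[OF p]] linear_cmul[OF linear_df[OF p]] \<alpha>)
  then have u: "u = (\<Sum>a\<in>UNIV. c a *\<^sub>R \<alpha> a)" using \<open>inj (df p)\<close> by (metis injD)
  have epu: "\<epsilon> p u = c 1" unfolding c_def v(3) by (simp add: inner_commute)
  have lA: "linear (\<lambda>u. A u p)"
    unfolding A_def using linear_De[OF p] linear_df[OF p]
    by (intro linearI) (auto simp: linear_add linear_cmul inner_add_right algebra_simps linear_diff[OF linear_i]
        linear_add[OF linear_i] i_scaleR)
  have "A u p = (\<Sum>a\<in>UNIV. c a *\<^sub>R A (\<alpha> a) p)"
    by (subst u) (simp add: linear_sum[OF lA] linear_cmul[OF lA])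
  also have "\<dots> = h p *\<^sub>R (df p u - \<epsilon> p u *\<^sub>R e p)"
    unfolding Aall dfu epu v(3)[symmetric] by (simp add: sum_3 vv algebra_simps)
  finally show "A u p = h p *\<^sub>R (df p u - \<epsilon> p u *\<^sub>R e p)" .
  have "D\<rho> p u = (\<Sum>a\<in>UNIV. c a * D\<rho> p (\<alpha> a))"
    by (subst u) (simp add: linear_sum[OF linear_Drho[OF p]] linear_cmul[OF linear_Drho[OF p]])
  then show "D\<rho> p u = - 4 * h p * \<rho> p * \<epsilon> p u" using D1 D2 D3 epu by (simp add: sum_3)
qed

abbreviation lam :: "real ^ 3 \<Rightarrow> complex" where "lam q \<equiv> Complex (h q) (- \<rho> q)"
abbreviation mu :: "real ^ 3 \<Rightarrow> complex" where "mu q \<equiv> Complex (- h q) (3 * \<rho> q)"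

lemma De_eq:
  assumes p: "p \<in> V"
  shows "De p u = lam p *s df p u + (\<epsilon> p u * mu p) *s e p"
proof -
  have "De p u = A u p + \<rho> p *\<^sub>R (\<i> *s ((3 * \<epsilon> p u) *\<^sub>R e p - df p u))"
    by (simp add: A_def)
  then show ?thesis unfolding structure_aux(1)[OF p]
    by (simp add: vec_eq_iff complex_eq_iff algebra_simps)
qed

text \<open>The full equation \<open>d (d e) = 0\<close> is now used, tangential part included. A
  unitary frame is independent over the complex numbers, so coefficients can be compared: two
  directions across the axis give \<open>dl = 0\<close> there, one along and one across give the
  derivative along the axis.\<close>

lemma lambda_has_derivative:
  assumes p: "p \<in> V"
  shows "(lam has_derivative (\<lambda>w. \<epsilon> p w * (mu p * lam p))) (at p)"
proof -
  note lag = lagrangian_T[OF p]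
  obtain v where v: "unitary_frame v" "\<And>a. v a \<in> T p" "v 1 = e p"
    using lagrangian_frame_ex[OF lag e_T[OF p] e_norm[OF p]] by blast
  have vv: "v a \<bullet> v b = (if a = b then 1 else 0)" for a b
    using v(1) unfolding unitary_frame_def by blast
  have "\<exists>\<alpha>. v a = df p \<alpha>" for a using T_df[OF p v(2)] by blast
  then obtain \<alpha> where \<alpha>: "\<And>a. df p (\<alpha> a) = v a" by metis
  have eps: "e p \<bullet> v a = (if a = 1 then 1 else 0)" for a using vv[of 1 a] v(3) by auto
  define Dh where "Dh = frechet_derivative h (at p)"
  have dh: "(h has_derivative Dh) (at p)"
    unfolding Dh_def by (rule smooth_on_has_derivative[OF smooth_h p])
  define Dl where "Dl = (\<lambda>w. Complex (Dh w) (- D\<rho> p w))"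
  define Dm where "Dm = (\<lambda>w. Complex (- Dh w) (3 * D\<rho> p w))"
  have C: "(\<lambda>q. Complex (a q) (b q)) = (\<lambda>q. of_real (a q) + \<i> * of_real (b q))" for a b ::
      "'x \<Rightarrow> real"
    by (auto simp: fun_eq_iff complex_eq_iff)
  have dl: "(lam has_derivative Dl) (at p)" unfolding Dl_def C
    by (intro has_derivative_add has_derivative_of_real has_derivative_mult_right has_derivative_minus
        dh rho_has_derivative p)
  have dm: "(mu has_derivative Dm) (at p)" unfolding Dm_def C
    by (intro has_derivative_add has_derivative_of_real has_derivative_mult_right has_derivative_minus
        dh rho_has_derivative p)
  have bs: "bounded_bilinear (\<lambda>(c::complex) (z::complex ^ 3). c *s z)"
    unfolding bilinear_conv_bounded_bilinear[symmetric] bilinear_def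
    by (auto intro!: linearI simp: vec_eq_iff algebra_simps)
  have D: "d2e p w u = lam p *s d2f p w u + Dl w *s df p u
      + ((\<epsilon> p u * mu p) *s De p w + (\<epsilon> p u * Dm w + (e p \<bullet> d2f p w u + De p w
          \<bullet> df p u) * mu p) *s e p)" for w u
  proof -
    have "((\<lambda>q. lam q *s df q u + (\<epsilon> q u * mu q) *s e q) has_derivative (\<lambda>w. lam p *s
        d2f p w u + Dl w *s df p u
      + ((\<epsilon> p u * mu p) *s De p w + (\<epsilon> p u * Dm w + (e p \<bullet> d2f p w u + De p w
          \<bullet> df p u) * mu p) *s e p))) (at p)"
      by (intro has_derivative_add bounded_bilinear.FDERIV[OF bs] has_derivative_mult has_derivative_of_real
          dl dm d2f_has_derivative e_has_derivative eps_has_derivative p)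
    then have "((\<lambda>q. De q u) has_derivative (\<lambda>w. lam p *s d2f p w u + Dl w *s df p u
      + ((\<epsilon> p u * mu p) *s De p w + (\<epsilon> p u * Dm w + (e p \<bullet> d2f p w u + De p w
          \<bullet> df p u) * mu p) *s e p))) (at p)"
      by (rule has_derivative_transform_within_open[OF _ open_V p]) (simp add: De_eq)
    from fun_cong[OF has_derivative_unique[OF d2e_has_derivative[OF p] this], of w]
    show ?thesis .
  qed
  have sym: "De p w \<bullet> df p u = h p * (df p w \<bullet> df p u - \<epsilon> p w * \<epsilon> p u)" for w u
    using A_inner[OF p df_tangent[OF p], of w u] unfolding structure_aux(1)[OF p]
    by (simp add: inner_diff_left)
  \<comment> \<open>Antisymmetrization removes \<open>d2f\<close>, the pairing \<open>sym\<close>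
    and the term quadratic in \<open>mu\<close>, all symmetric in \<open>u\<close> and
    \<open>w\<close>.\<close>
  have eq: "Dl w *s df p u - Dl u *s df p w + (\<epsilon> p u * Dm w - \<epsilon> p w * Dm u) *s e p
     + (mu p * lam p) *s (\<epsilon> p u *s df p w - \<epsilon> p w *s df p u) = 0" for w u
  proof -
    have "d2e p w u - d2e p u w = 0" using d2e_commute[OF p] by simp
    then show ?thesis unfolding D De_eq[OF p] sym d2f_commute[OF p, of u w]
      sym[of u w, unfolded De_eq[OF p]] sym[of w u, unfolded De_eq[OF p]]
      by (simp add: inner_commute[of "df p u" "df p w"] vec_eq_iff algebra_simps)
  qed
  note eqs = eq[of "\<alpha> _" "\<alpha> _", unfolded \<alpha> eps]
  have "Dl (\<alpha> 2) *s v 3 - Dl (\<alpha> 3) *s v 2 = 0" using eqs[of 3 2] by simp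
  then have l23: "Dl (\<alpha> 2) = 0" "Dl (\<alpha> 3) = 0"
    using unitary_frame_independent[OF v(1), of 0 "- Dl (\<alpha> 3)" "Dl (\<alpha> 2)"] by simp_all
  have "(- Dm (\<alpha> 2)) *s v 1 + (Dl (\<alpha> 1) - mu p * lam p) *s v 2 + 0 *s v 3 = 0"
    using eqs[of 2 1] l23 v(3) by (simp add: vec_eq_iff algebra_simps)
  then have l1: "Dl (\<alpha> 1) = mu p * lam p"
    using unitary_frame_independent(2)[OF v(1)] by fastforce
  have "Dl u = \<epsilon> p u * (mu p * lam p)" for u
  proof -
    define c where "c = (\<lambda>a. df p u \<bullet> v a)"
    have dfu: "df p u = (\<Sum>a\<in>UNIV. c a *\<^sub>R v a)"
      unfolding c_def by (rule lagrangian_expand[OF lag v(1,2) df_tangent[OF p]])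
    have "df p (\<Sum>a\<in>UNIV. c a *\<^sub>R \<alpha> a) = df p u"
      using dfu by (simp add: linear_sum[OF linear_df[OF p]] linear_cmul[OF linear_df[OF p]] \<alpha>)
    then have u: "u = (\<Sum>a\<in>UNIV. c a *\<^sub>R \<alpha> a)" using inj_df[OF p] by (metis injD)
    have lD: "linear Dl" using dl has_derivative_linear by blast
    have "Dl u = (\<Sum>a\<in>UNIV. c a *\<^sub>R Dl (\<alpha> a))"
      by (subst u) (simp add: linear_sum[OF lD] linear_cmul[OF lD])
    also have "\<dots> = c 1 * (mu p * lam p)" by (simp add: sum_3 l23 l1 scaleR_conv_of_real)
    finally show ?thesis unfolding c_def v(3) by (simp add: inner_commute)
  qed
  then show ?thesis using dl by presburger
qed

end

subsection \<open>The conserved quantities\<close>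

text \<open>In an orthonormal basis \<open>v\<close> of a Lagrangian \<open>T\<close> this is the sum of the products
  \<open>v\<^sub>j v\<^sub>k\<close>: the complex symmetric matrix of the reflection in \<open>T\<close>, which is conjugate linear.\<close>

definition reflection_matrix :: "(complex ^ 3) set \<Rightarrow> complex ^ 3 ^ 3" where
  "reflection_matrix T = (SOME M. \<forall>z\<in>T. M *v (\<chi> k. cnj (z $ k)) = z)"

text \<open>The conjugates of a unitary frame span, so the values on the frame determine the matrix;
  hence \<open>SOME\<close> names a single object.\<close>

lemma reflection_matrix_unique:
  assumes v: "unitary_frame v" "\<And>a. v a \<in> T" and M: "\<forall>z\<in>T. M *v (\<chi> k. cnj (z $ k)) = z"
  shows "M $ j $ k = (\<Sum>a\<in>UNIV. v a $ j * v a $ k)"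
proof -
  have "(\<Sum>a\<in>UNIV. v a $ j * v a $ k) = (\<Sum>a\<in>UNIV. (M *v (\<chi> l. cnj (v a $ l))) $ j * v a $ k)"
    using M v(2) by simp
  also have "\<dots> = (\<Sum>a\<in>UNIV. \<Sum>l\<in>UNIV. M $ j $ l * (v a $ k * cnj (v a $ l)))"
    by (simp add: matrix_vector_mult_def sum_distrib_left mult_ac)
  also have "\<dots> = (\<Sum>l\<in>UNIV. M $ j $ l * (\<Sum>a\<in>UNIV. v a $ k * cnj (v a $ l)))"
    by (subst sum.swap) (simp add: sum_distrib_left)
  also have "\<dots> = M $ j $ k"
    by (simp add: unitary_frame_columns(1)[OF v(1)] if_distrib[of "\<lambda>x. _ * x"] cong: if_cong)
  finally show ?thesis ..
qed

lemma reflection_matrix_frame: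
  assumes T: "lagrangian T" and v: "unitary_frame v" "\<And>a. v a \<in> T"
  shows "reflection_matrix T $ j $ k = (\<Sum>a\<in>UNIV. v a $ j * v a $ k)"
    and "z \<in> T \<Longrightarrow> reflection_matrix T *v (\<chi> k. cnj (z $ k)) = z"
proof -
  define M :: "complex ^ 3 ^ 3" where "M = (\<chi> j k. \<Sum>a\<in>UNIV. v a $ j * v a $ k)"
  have "M *v (\<chi> k. cnj (z $ k)) = z" if z: "z \<in> T" for z
  proof -
    define c where "c = (\<lambda>a. z \<bullet> v a)"
    have zc: "z = (\<Sum>a\<in>UNIV. c a *\<^sub>R v a)" unfolding c_def by (rule lagrangian_expand[OF T v z])
    have h: "(\<Sum>k\<in>UNIV. v a $ k * cnj (z $ k)) = of_real (c a)" for a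
    proof -
      have "v a \<bullet> (\<i> *s z) = 0" using T v(2) z by (simp add: lagrangian_def)
      then show ?thesis using inner_complex3[of "v a" z] inner_i_right[of "v a" z]
        unfolding c_def by (simp add: complex_eq_iff inner_commute)
    qed
    show ?thesis
    proof (subst vec_eq_iff, intro allI)
      fix j
      have "(M *v (\<chi> k. cnj (z $ k))) $ j = (\<Sum>k\<in>UNIV. \<Sum>a\<in>UNIV. v a $ j * (v a $ k * cnj
          (z $ k)))"
        by (simp add: M_def matrix_vector_mult_def sum_distrib_left mult_ac)
      also have "\<dots> = (\<Sum>a\<in>UNIV. v a $ j * (\<Sum>k\<in>UNIV. v a $ k * cnj (z $ k)))"
        by (subst sum.swap) (simp add: sum_distrib_left)
      also have "\<dots> = (\<Sum>a\<in>UNIV. c a *\<^sub>R v a) $ j"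
        unfolding h by (simp add: scaleR_conv_of_real[where 'a=complex] mult.commute)
      finally show "(M *v (\<chi> k. cnj (z $ k))) $ j = z $ j" using zc by simp
    qed
  qed
  then have "\<exists>M. \<forall>z\<in>T. M *v (\<chi> k. cnj (z $ k)) = z" by blast
  then have R: "\<forall>z\<in>T. reflection_matrix T *v (\<chi> k. cnj (z $ k)) = z"
    unfolding reflection_matrix_def by (rule someI_ex)
  show "reflection_matrix T $ j $ k = (\<Sum>a\<in>UNIV. v a $ j * v a $ k)"
    by (rule reflection_matrix_unique[OF v R])
  show "z \<in> T \<Longrightarrow> reflection_matrix T *v (\<chi> k. cnj (z $ k)) = z" using R by blast
qed

context slag_chart
begin

abbreviation Tm where "Tm q \<equiv> reflection_matrix (T q)"

lemma Tm_fr: "q \<in> V \<Longrightarrow> Tm q $ j $ k = (\<Sum>a\<in>UNIV. fr a q $ j * fr a q $ k)"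
  by (rule reflection_matrix_frame(1)[OF lagrangian_T fr_unitary fr_T])

text \<open>In the derivative of the sum of products the tangential rotation of the frame is skew
  and cancels. The normal part, \<open>\<i>\<close> times the cubic, is symmetric and is counted
  twice.\<close>

lemma Tm_has_derivative:
  assumes p: "p \<in> V"
  shows "((\<lambda>q. Tm q $ j $ k) has_derivative
    (\<lambda>w. 2 * \<i> * (\<Sum>a\<in>UNIV. \<Sum>b\<in>UNIV. of_real (C p (df p w) (fr a p) (fr b p)) * (fr
        a p $ j * fr b p $ k)))) (at p)"
proof -
  define F where "F = (\<lambda>a. frechet_derivative (fr a) (at p))"
  have F: "(fr a has_derivative F a) (at p)" for a
    unfolding F_def by (rule smooth_on_has_derivative[OF smooth_fr p])
  have anti: "F a w \<bullet> fr b p = - (F b w \<bullet> fr a p)" for a b w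
  proof -
    have "((\<lambda>q. fr a q \<bullet> fr b q) has_derivative (\<lambda>u. fr a p \<bullet> F b u + F a u
        \<bullet> fr b p)) (at p)"
      by (intro has_derivative_inner F)
    moreover have "((\<lambda>q. fr a q \<bullet> fr b q) has_derivative (\<lambda>u. 0)) (at p)"
      by (rule has_derivative_transform_within_open[OF _ open_V p, of "\<lambda>q. if a = b then 1 else 0"])
        (auto simp: fr_inner)
    ultimately have "(\<lambda>u. fr a p \<bullet> F b u + F a u \<bullet> fr b p) = (\<lambda>u. 0)"
      using has_derivative_unique by blast
    from fun_cong[OF this, of w] show ?thesis by (simp add: inner_commute)
  qed
  define c where "c = (\<lambda>w a b. C p (df p w) (fr a p) (fr b p))"
  have csym: "c w a b = c w b a" for w a b
    unfolding c_def by (intro cubic_commute23 p df_tangent fr_T)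
  have Fe: "F a w $ i = (\<Sum>b\<in>UNIV. (of_real (F a w \<bullet> fr b p) + \<i> * of_real (c w a b)) * fr b
      p $ i)" for a w i
  proof -
    have "F a w \<bullet> (\<i> *s fr b p) = c w a b" for b
      unfolding c_def using cubic_field[OF p fr_T F fr_T[OF p]] by simp
    then have "F a w = (\<Sum>b\<in>UNIV. (F a w \<bullet> fr b p) *\<^sub>R fr b p + c w a b *\<^sub>R (\<i>
        *s fr b p))"
      using unitary_frame_expand[OF fr_unitary[OF p], of "F a w"] by simp
    from arg_cong[OF this, of "\<lambda>z. z $ i"] show ?thesis
      by (simp add: scaleR_conv_of_real[where 'a=complex] algebra_simps)
  qed
  have "((\<lambda>q. \<Sum>a\<in>UNIV. fr a q $ j * fr a q $ k) has_derivative
      (\<lambda>w. \<Sum>a\<in>UNIV. fr a p $ j * F a w $ k + F a w $ j * fr a p $ k)) (at p)"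
    by (intro has_derivative_sum has_derivative_mult bounded_linear.has_derivative[OF bounded_linear_vec_nth] F)
  then have D: "((\<lambda>q. Tm q $ j $ k) has_derivative
      (\<lambda>w. \<Sum>a\<in>UNIV. fr a p $ j * F a w $ k + F a w $ j * fr a p $ k)) (at p)"
    by (rule has_derivative_transform_within_open[OF _ open_V p]) (simp add: Tm_fr)
  have "(\<Sum>a\<in>UNIV. fr a p $ j * F a w $ k + F a w $ j * fr a p $ k)
      = 2 * \<i> * (\<Sum>a\<in>UNIV. \<Sum>b\<in>UNIV. of_real (c w a b) * (fr a p $ j * fr b p $ k))" for w
  proof -
    have o: "F a w \<bullet> fr a p = 0" for a using anti[of a w a] by simp
    show ?thesis
      unfolding Fe sum_3 o anti[of 2 w 1] anti[of 3 w 1] anti[of 3 w 2] csym[of w 2 1] csym[of w 3 1] csym[of w 3 2]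
      by (simp add: algebra_simps)
  qed
  then show ?thesis using D unfolding c_def by simp
qed

end

section \<open>Local constancy of the centre, the modulus and the real structure\<close>

lemma Complex_notin_nonpos: "y \<noteq> 0 \<Longrightarrow> Complex x y \<notin> \<real>\<^sub>\<le>\<^sub>0"
  by (auto simp: complex_nonpos_Reals_iff)

text \<open>The left side is the derivative of an entry of the conserved matrix, with
  \<open>P\<close> and \<open>Q\<close> its two phases, \<open>x\<close> standing for \<epsilon>,
  \<open>a\<close> and \<open>b\<close> for entries of the axis, \<open>u\<close> and
  \<open>v\<close> for entries of \<open>df\<close>. It is a multiple of the hypothesis, which
  \<open>phase_relation\<close> supplies.\<close>

lemma sigma_identity:
  fixes P Q h r I x T a b u v :: complex
  assumes "Q * (h - I * r) = P * (h + I * r)"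
  shows "(P * (2 * I * r * (5 * x * a * b - x * T - a * v - u * b)) + 2 * I * r * x * P * T)
     + ((Q - P) * (a * ((h - I * r) * v + x * (3 * I * r - h) * b) + ((h - I * r) * u + x * (3 * I * r - h) * a) * b)
     + (- 4 * I * r * x * Q - 2 * I * r * x * P) * (a * b)) = 0" (is "?L = 0")
proof -
  have "?L = (a * v + u * b - 2 * x * a * b) * (Q * (h - I * r) - P * (h + I * r))"
    by (simp add: algebra_simps)
  then show ?thesis using assms by simp
qed

text \<open>The power \<open>m\<close> of \<open>z / norm z\<close> on the principal branch. It is
  smooth along \<open>lam\<close>, whose imaginary part \<open>- r\<close> keeps it off the
  cut.\<close>

definition phase :: "real \<Rightarrow> complex \<Rightarrow> complex" where
  "phase m z = exp (\<i> * of_real (m * Im (Ln z)))"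

lemma phase_relation:
  assumes "z \<noteq> 0"
  shows "phase (- 4 / 3) z * z = phase (2 / 3) z * cnj z"
proof -
  define w where "w = Ln z"
  have z: "z = exp w" using assms by (simp add: w_def)
  have 1: "\<i> * of_real ((- 4 / 3) * Im w) + w = \<i> * of_real ((2 / 3) * Im w) + cnj w"
    by (simp add: complex_eq_iff)
  have "phase (- 4 / 3) z * z = exp (\<i> * of_real ((- 4 / 3) * Im w) + w)"
    unfolding phase_def w_def[symmetric] exp_add z[symmetric] ..
  also have "\<dots> = phase (2 / 3) z * cnj z"
    unfolding 1 phase_def w_def[symmetric] exp_add exp_cnj[symmetric] z[symmetric] ..
  finally show ?thesis .
qed

context axial_chart
begin

lemma lam_nonzero: "p \<in> V \<Longrightarrow> lam p \<noteq> 0"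
  using rho_pos[of p] by (simp add: complex_eq_iff)

lemma Ln_lam_has_derivative:
  assumes p: "p \<in> V"
  shows "((\<lambda>q. Ln (lam q)) has_derivative (\<lambda>w. \<epsilon> p w * mu p)) (at p)"
proof -
  have "lam p \<notin> \<real>\<^sub>\<le>\<^sub>0" by (rule Complex_notin_nonpos) (use rho_pos[OF p] in simp)
  then have "(Ln has_derivative (\<lambda>x. inverse (lam p) * x)) (at (lam p))"
    using has_field_derivative_Ln unfolding has_field_derivative_def by blast
  from has_derivative_compose[OF lambda_has_derivative[OF p] this]
  show ?thesis using lam_nonzero[OF p] by (simp add: field_simps)
qed

lemma center_has_derivative:
  assumes p: "p \<in> V"
  shows "((\<lambda>q. f q - inverse (lam q) *s e q) has_derivative (\<lambda>w. 0)) (at p)"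
proof -
  have bs: "bounded_bilinear (\<lambda>(c::complex) (z::complex ^ 3). c *s z)"
    unfolding bilinear_conv_bounded_bilinear[symmetric] bilinear_def
    by (auto intro!: linearI simp: vec_eq_iff algebra_simps)
  have "((\<lambda>q. f q - inverse (lam q) *s e q) has_derivative
      (\<lambda>w. df p w - (inverse (lam p) *s De p w
        + (- (inverse (lam p) * (\<epsilon> p w * (mu p * lam p)) * inverse (lam p))) *s e p))) (at p)"
    by (intro has_derivative_diff has_derivative_f bounded_bilinear.FDERIV[OF bs] Deriv.has_derivative_inverse
        lambda_has_derivative e_has_derivative p lam_nonzero)
  moreover have "df p w - (inverse (lam p) *s De p w
        + (- (inverse (lam p) * (\<epsilon> p w * (mu p * lam p)) * inverse (lam p))) *s e p) = 0" for w
  proof -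
    have "x - (inverse l * (l * x + m * y) + - (inverse l * (a * (b * l)) * inverse l) * y) = 0"
      if "l \<noteq> 0" "m = a * b" for x y l m a b :: complex
      using that by (simp add: field_simps)
    then show ?thesis unfolding De_eq[OF p] vec_eq_iff using lam_nonzero[OF p] by simp
  qed
  ultimately show ?thesis by simp
qed

text \<open>The logarithmic derivatives of \<open>r\<close> and of the squared modulus of
  \<open>l\<close> are \<open>-4 h\<close> and \<open>-2 h\<close> times \<epsilon>, so the quotient
  of \<open>r\<close> by the square of the latter is stationary.\<close>

lemma modulus_has_derivative:
  assumes p: "p \<in> V"
  shows "((\<lambda>q. \<rho> q * inverse (((h q)\<^sup>2 + (\<rho> q)\<^sup>2)\<^sup>2)) has_derivative
      (\<lambda>w. 0)) (at p)"
proof -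
  have "((\<lambda>q. Re (lam q)) has_derivative (\<lambda>w. Re (\<epsilon> p w * (mu p * lam p)))) (at p)"
    by (rule has_derivative_Re[OF lambda_has_derivative[OF p]])
  then have dh: "(h has_derivative (\<lambda>w. \<epsilon> p w * (3 * (\<rho> p)\<^sup>2 - (h p)\<^sup>2))) (at p)"
    by (simp add: power2_eq_square algebra_simps)
  have dr: "(\<rho> has_derivative (\<lambda>w. - 4 * h p * \<rho> p * \<epsilon> p w)) (at p)"
    using rho_has_derivative[OF p] unfolding structure_aux(2)[OF p, abs_def] .
  define s where "s = (\<lambda>q. h q * h q + \<rho> q * \<rho> q)"
  have nz: "s p \<noteq> 0" using rho_pos[OF p] by (simp add: s_def add_nonneg_eq_0_iff)
  have "(s has_derivative (\<lambda>w. (h p * (\<epsilon> p w * (3 * (\<rho> p)\<^sup>2 - (h p)\<^sup>2)) +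
      \<epsilon> p w * (3 * (\<rho> p)\<^sup>2 - (h p)\<^sup>2) * h p)
      + (\<rho> p * (- 4 * h p * \<rho> p * \<epsilon> p w) + - 4 * h p * \<rho> p * \<epsilon> p w * \<rho>
          p))) (at p)"
    unfolding s_def by (intro has_derivative_add has_derivative_mult dh dr)
  then have ds: "(s has_derivative (\<lambda>w. - 2 * h p * \<epsilon> p w * s p)) (at p)"
    by (rule has_derivative_eq_rhs) (auto simp: fun_eq_iff s_def power2_eq_square algebra_simps)
  have "((\<lambda>q. \<rho> q * inverse (s q * s q)) has_derivative (\<lambda>w. 0)) (at p)"
    by (rule has_derivative_eq_rhs[OF has_derivative_mult[OF dr
            Deriv.has_derivative_inverse[OF _ has_derivative_mult[OF ds ds]]]])
      (use nz in \<open>auto simp: fun_eq_iff field_simps\<close>)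
  then show ?thesis unfolding s_def power2_eq_square .
qed

lemma phase_lam_has_derivative:
  assumes p: "p \<in> V"
  shows "((\<lambda>q. phase m (lam q)) has_derivative (\<lambda>w. \<i> * of_real (m * (3 * \<rho> p *
      \<epsilon> p w)) * phase m (lam p))) (at p)"
proof -
  have "((\<lambda>q. Im (Ln (lam q))) has_derivative (\<lambda>w. Im (\<epsilon> p w * mu p))) (at p)"
    by (rule has_derivative_Im[OF Ln_lam_has_derivative[OF p]])
  then have "((\<lambda>q. Im (Ln (lam q))) has_derivative (\<lambda>w. 3 * \<rho> p * \<epsilon> p w)) (at p)"
    by (simp add: algebra_simps)
  then have d: "((\<lambda>q. \<i> * complex_of_real (m * Im (Ln (lam q)))) has_derivative
      (\<lambda>w. \<i> * of_real (m * (3 * \<rho> p * \<epsilon> p w)))) (at p)"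
    by (intro has_derivative_mult_right has_derivative_of_real)
  have "(exp has_derivative (\<lambda>x. exp z * x)) (at z)" for z :: complex
    using DERIV_exp[of z] by (simp add: has_field_derivative_def)
  from has_derivative_compose[OF d this] show ?thesis unfolding phase_def by (simp add: mult.commute)
qed

text \<open>The argument of \<open>l\<close> has derivative \<open>3 r \<epsilon>\<close>, so its
  phase to the power 2/3 has logarithmic derivative \<open>2 \<i> r \<epsilon>\<close>, exactly what
  cancels the multiple of \<open>Tm\<close> in the derivative of \<open>Tm\<close>. The exponent
  -4/3 then balances the terms containing the axis.\<close>

lemma sigma_has_derivative:
  assumes p: "p \<in> V"
  shows "((\<lambda>q. phase (2/3) (lam q) * Tm q $ j $ k
    + (phase (- 4/3) (lam q) - phase (2/3) (lam q)) * (e q $ j * e q $ k)) has_derivative (\<lambda>w. 0)) (at p)"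
proof -
  define P where "P = phase (2/3) (lam p)"
  define Q where "Q = phase (- 4/3) (lam p)"
  have dP: "((\<lambda>q. phase (2/3) (lam q)) has_derivative (\<lambda>w. 2 * \<i> * \<rho> p * \<epsilon> p w
      * P)) (at p)"
    using phase_lam_has_derivative[OF p, of "2/3"] unfolding P_def by (simp add: mult_ac)
  have dQ: "((\<lambda>q. phase (- 4/3) (lam q)) has_derivative (\<lambda>w. - 4 * \<i> * \<rho> p * \<epsilon>
      p w * Q)) (at p)"
    using phase_lam_has_derivative[OF p, of "- 4/3"] unfolding Q_def by (simp add: mult_ac)
  have de: "((\<lambda>q. e q $ i) has_derivative (\<lambda>w. (h p - \<i> * \<rho> p) * df p w $ i
      + \<epsilon> p w * (3 * \<i> * \<rho> p - h p) * e p $ i)) (at p)" for i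
  proof -
    have "((\<lambda>q. e q $ i) has_derivative (\<lambda>w. De p w $ i)) (at p)"
      by (rule bounded_linear.has_derivative[OF bounded_linear_vec_nth e_has_derivative[OF p]])
    moreover have "De p w $ i = (h p - \<i> * \<rho> p) * df p w $ i
      + \<epsilon> p w * (3 * \<i> * \<rho> p - h p) * e p $ i" for w
      unfolding De_eq[OF p] by (simp add: complex_eq_iff)
    ultimately show ?thesis by simp
  qed
  have dT: "((\<lambda>q. Tm q $ j $ k) has_derivative (\<lambda>w. 2 * \<i> * \<rho> p * (5 * \<epsilon> p w *
      e p $ j * e p $ k
      - \<epsilon> p w * Tm p $ j $ k - e p $ j * df p w $ k - df p w $ j * e p $ k))) (at p)"
  proof -
    define E where "E = (\<lambda>a. e p \<bullet> fr a p)"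
    define W where "W = (\<lambda>w a. df p w \<bullet> fr a p)"
    have ex: "z $ i = (\<Sum>a\<in>UNIV. of_real (z \<bullet> fr a p) * fr a p $ i)" if "z \<in> T p" for z i
    proof -
      have "z = (\<Sum>a\<in>UNIV. (z \<bullet> fr a p) *\<^sub>R fr a p)"
        by (rule lagrangian_expand[OF lagrangian_T[OF p] fr_unitary[OF p] fr_T[OF p] that])
      from arg_cong[OF this, of "\<lambda>z. z $ i"] show ?thesis
        by (simp add: scaleR_conv_of_real[where 'a=complex])
    qed
    have EW: "e p \<bullet> fr a p = E a" "df p w \<bullet> fr a p = W w a" for a w by (simp_all add: E_def W_def)
    have z: "C p (df p w) (fr a p) (fr b p) = \<rho> p * (5 * \<epsilon> p w * E a * E b
        - \<epsilon> p w * (if a = b then 1 else 0) - E a * W w b - E b * W w a)" for a b w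
      unfolding C_zonal[OF p df_tangent[OF p] fr_T[OF p] fr_T[OF p]] zonal_def E_def W_def fr_inner[OF p] ..
    have eq: "2 * \<i> * (\<Sum>a\<in>UNIV. \<Sum>b\<in>UNIV. of_real (C p (df p w) (fr a p) (fr b p)) * (fr a
        p $ j * fr b p $ k))
      = 2 * \<i> * \<rho> p * (5 * \<epsilon> p w * e p $ j * e p $ k
      - \<epsilon> p w * Tm p $ j $ k - e p $ j * df p w $ k - df p w $ j * e p $ k)" for w
      unfolding z ex[OF e_T[OF p]] ex[OF df_tangent[OF p]] Tm_fr[OF p] EW sum_3
      by (simp add: algebra_simps)
    show ?thesis using Tm_has_derivative[OF p, of j k] unfolding eq .
  qed
  have "Q * (h p - \<i> * \<rho> p) = P * (h p + \<i> * \<rho> p)"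
  proof -
    have "lam p = h p - \<i> * \<rho> p" "cnj (lam p) = h p + \<i> * \<rho> p" by (simp_all add: complex_eq_iff)
    then show ?thesis using phase_relation[OF lam_nonzero[OF p]] unfolding P_def Q_def by metis
  qed
  note zero = sigma_identity[OF this]
  show ?thesis
    by (rule has_derivative_eq_rhs[OF has_derivative_add[OF has_derivative_mult[OF dP dT]
            has_derivative_mult[OF has_derivative_diff[OF dQ dP] has_derivative_mult[OF de de]]]])
      (unfold P_def[symmetric] Q_def[symmetric] fun_eq_iff of_real_mult of_real_numeral, intro allI zero)
qed

end

subsection \<open>The Harvey--Lawson examples\<close>

text \<open>The sign arises because
  \<open>Im ((s + \<i> t) ^ 3) = 3 s ^ 2 t - t ^ 3\<close>.\<close>

lemma harvey_lawson_iff: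
  "z \<in> harvey_lawson c \<longleftrightarrow>
     (\<exists>w (u :: real ^ 3). norm u = 1 \<and> Im (w ^ 3) = - (c ^ 3) \<and> z = w *s (\<chi> k.
         complex_of_real (u $ k)))"
proof -
  have 1: "Im (w ^ 3) = - (c ^ 3) \<longleftrightarrow> Im w ^ 3 - 3 * Re w ^ 2 * Im w = c ^ 3" for w :: complex
    by (auto simp: power3_eq_cube power2_eq_square algebra_simps)
  show ?thesis
  proof
    assume "z \<in> harvey_lawson c"
    then obtain s t u where "z = Complex s t *s (\<chi> k. complex_of_real (u $ k))" "norm (u :: real ^ 3) = 1"
      "t ^ 3 - 3 * s ^ 2 * t = c ^ 3" unfolding harvey_lawson_def by blast
    then show "\<exists>w (u :: real ^ 3). norm u = 1 \<and> Im (w ^ 3) = - (c ^ 3) \<and> z = w *s (\<chi> k.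
        complex_of_real (u $ k))"
      unfolding 1 by (intro exI[of _ "Complex s t"] exI[of _ u]) simp
  next
    assume "\<exists>w (u :: real ^ 3). norm u = 1 \<and> Im (w ^ 3) = - (c ^ 3) \<and> z = w *s (\<chi> k.
        complex_of_real (u $ k))"
    then obtain w u where "norm (u :: real ^ 3) = 1" "Im w ^ 3 - 3 * Re w ^ 2 * Im w = c ^ 3"
      "z = Complex (Re w) (Im w) *s (\<chi> k. complex_of_real (u $ k))"
      unfolding 1 by auto
    then show "z \<in> harvey_lawson c" unfolding harvey_lawson_def by blast
  qed
qed

text \<open>The level curve of \<open>Im (w ^ 3)\<close> through \<open>w0\<close> is tangent to \<open>cnj (w0 ^ 2)\<close>, so
  \<open>Re (w0 ^ 2 * w)\<close> is a local coordinate on it. With \<open>w = w0 * s\<close> this is \<open>Re (w0 ^ 3 * s)\<close>.\<close>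

lemma harvey_lawson_local_coordinates:
  assumes c: "c \<noteq> 0" and z0: "z0 \<in> harvey_lawson c"
  obtains U and \<pi> :: "complex ^ 3 \<Rightarrow> real ^ 3"
  where "open U" "z0 \<in> U" "continuous_on U \<pi>" "inj_on \<pi> (U \<inter> harvey_lawson c)"
proof -
  obtain w0 and u0 :: "real ^ 3" where w0: "norm u0 = 1" "Im (w0 ^ 3) = - (c ^ 3)"
    "z0 = w0 *s (\<chi> k. complex_of_real (u0 $ k))"
    using z0 unfolding harvey_lawson_iff by blast
  have w0nz: "w0 \<noteq> 0" using w0(2) c by auto
  \<comment> \<open>For \<open>z = w u\<close> with \<open>u\<close> real of norm 1 the sum of
    squares is \<open>w ^ 2\<close>, so \<open>\<zeta> z = (w / w0) ^ 2\<close> and its root is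
    \<open>w / w0\<close> up to sign.\<close>
  define \<zeta> where "\<zeta> = (\<lambda>z :: complex ^ 3. (\<Sum>k\<in>UNIV. z $ k * z $ k) / w0 ^ 2)"
  define s where "s = (\<lambda>z. csqrt (\<zeta> z))"
  \<comment> \<open>The sign condition selects the right square root, since replacing
    \<open>w\<close> by \<open>- w\<close> changes the sign of \<open>Im (w ^ 3)\<close>. The radius
    1/4 makes products of two numbers in the ball have positive real part.\<close>
  define B where "B = ball 1 (1/4) \<inter> {s. Im (w0 ^ 3) * Im ((w0 * s) ^ 3) > 0}"
  define U0 where "U0 = \<zeta> -` (- \<real>\<^sub>\<le>\<^sub>0)"
  define U where "U = U0 \<inter> s -` B"
  \<comment> \<open>Polar encoding in \<open>real ^ 3\<close>: the exponential of the coordinate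
    along the curve is the radius, \<open>u\<close> is the direction.\<close>
  define \<pi> where "\<pi> = (\<lambda>z. exp (Re (w0 ^ 3 * s z)) *\<^sub>R (\<chi> k. Re (z $ k / (w0 * s z))
      :: real ^ 3))"
  have c\<zeta>: "continuous_on A \<zeta>" for A unfolding \<zeta>_def using w0nz by (intro continuous_intros) auto
  have "open U0" unfolding U0_def
    using continuous_on_open_vimage[OF open_UNIV, of \<zeta>] c\<zeta>[of UNIV] open_Compl[OF
        closed_nonpos_Reals_complex] by auto
  have cs: "continuous_on U0 s" unfolding s_def
    by (rule continuous_on_compose2[OF continuous_on_csqrt c\<zeta>]) (auto simp: U0_def)
  have "open B" unfolding B_def
    by (intro open_Int open_ball open_Collect_less continuous_intros)
  then have oU: "open U" unfolding U_def using continuous_open_preimage[OF cs \<open>open U0\<close>] by simp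
  have \<zeta>u: "\<zeta> (w *s (\<chi> k. complex_of_real (u $ k))) = (w / w0) ^ 2" if "norm (u :: real ^ 3) =
      1" for w u
  proof -
    have "(\<Sum>k\<in>UNIV. u $ k * u $ k) = 1"
      using that by (metis dot_square_norm inner_vec_def inner_real_def power_one sum.cong)
    then have "(\<Sum>k\<in>UNIV. complex_of_real (u $ k) * complex_of_real (u $ k)) = 1"
      by (metis (mono_tags, lifting) of_real_1 of_real_mult of_real_sum sum.cong)
    moreover have "(\<Sum>k\<in>UNIV. (w * complex_of_real (u $ k)) * (w * complex_of_real (u $ k)))
        = w ^ 2 * (\<Sum>k\<in>UNIV. complex_of_real (u $ k) * complex_of_real (u $ k))"
      by (simp add: sum_distrib_left power2_eq_square mult_ac)
    ultimately show ?thesis unfolding \<zeta>_def by (simp add: power_divide)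
  qed
  have z0U: "z0 \<in> U"
    using w0nz w0(2) c unfolding U_def U0_def B_def s_def w0(3) vimage_def
    by (simp add: \<zeta>u[OF w0(1)])
  have snz: "s z \<noteq> 0" if "z \<in> U" for z using that unfolding U_def B_def by auto
  have c\<pi>: "continuous_on U \<pi>"
    unfolding \<pi>_def using snz w0nz
    by (intro continuous_intros continuous_on_subset[OF cs] continuous_on_vec_lambda) (auto simp: U_def)
  have char: "\<exists>u. norm u = 1 \<and> z = (w0 * s z) *s (\<chi> k. complex_of_real (u $ k)) \<and> \<pi>
      z = exp (Re (w0 ^ 3 * s z)) *\<^sub>R u
      \<and> Im ((w0 * s z) ^ 3) = - (c ^ 3)"
    if z: "z \<in> U" "z \<in> harvey_lawson c" for z
  proof -
    obtain w and u :: "real ^ 3" where w: "norm u = 1" "Im (w ^ 3) = - (c ^ 3)"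
      "z = w *s (\<chi> k. complex_of_real (u $ k))"
      using z(2) unfolding harvey_lawson_iff by blast
    have "(s z) ^ 2 = (w / w0) ^ 2" unfolding s_def w(3) \<zeta>u[OF w(1)] by simp
    then have "s z = w / w0 \<or> s z = - (w / w0)" by (simp add: power2_eq_iff)
    moreover have "s z \<noteq> - (w / w0)"
    proof
      assume "s z = - (w / w0)"
      then have "w0 * s z = - w" using w0nz by simp
      then have "Im ((w0 * s z) ^ 3) = - Im (w ^ 3)" by simp
      then have "Im (w0 ^ 3) * Im ((w0 * s z) ^ 3) = - (c ^ 3 * c ^ 3)" using w(2) w0(2) by simp
      moreover have "c ^ 3 * c ^ 3 \<ge> 0" by simp
      moreover have "Im (w0 ^ 3) * Im ((w0 * s z) ^ 3) > 0" using z(1) unfolding U_def B_def by simp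
      ultimately show False by linarith
    qed
    ultimately have sw: "w0 * s z = w" using w0nz by simp
    have wnz: "w \<noteq> 0" using w(2) c by auto
    have "(\<chi> k. Re (z $ k / (w0 * s z))) = u" unfolding sw using w(3) wnz by (simp add: vec_eq_iff)
    then show ?thesis using w sw unfolding \<pi>_def by (intro exI[of _ u]) simp
  qed
  have "inj_on \<pi> (U \<inter> harvey_lawson c)"
  proof (rule inj_onI)
    fix z z' assume "z \<in> U \<inter> harvey_lawson c" "z' \<in> U \<inter> harvey_lawson c" and eq: "\<pi> z
        = \<pi> z'"
    then have zz: "z \<in> U" "z \<in> harvey_lawson c" "z' \<in> U" "z' \<in> harvey_lawson c" by auto
    obtain u where u: "norm u = 1" "z = (w0 * s z) *s (\<chi> k. complex_of_real (u $ k))"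
      "\<pi> z = exp (Re (w0 ^ 3 * s z)) *\<^sub>R u" "Im ((w0 * s z) ^ 3) = - (c ^ 3)"
      using char[OF zz(1,2)] by blast
    obtain u' where u': "norm u' = 1" "z' = (w0 * s z') *s (\<chi> k. complex_of_real (u' $ k))"
      "\<pi> z' = exp (Re (w0 ^ 3 * s z')) *\<^sub>R u'" "Im ((w0 * s z') ^ 3) = - (c ^ 3)"
      using char[OF zz(3,4)] by blast
    have "norm (\<pi> z) = exp (Re (w0 ^ 3 * s z))" using u(1,3) by simp
    moreover have "norm (\<pi> z') = exp (Re (w0 ^ 3 * s z'))" using u'(1,3) by simp
    ultimately have re: "Re (w0 ^ 3 * s z) = Re (w0 ^ 3 * s z')" using eq by simp
    then have uu: "u = u'" using eq u(3) u'(3) by simp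
    define a where "a = s z" define b where "b = s z'"
    \<comment> \<open>Factoring a difference of cubes: \<open>d\<close> is purely imaginary and
      \<open>d * g\<close> is real, so \<open>Re g > 0\<close> forces \<open>d = 0\<close>.\<close>
    define d where "d = w0 ^ 3 * (a - b)"
    define g where "g = a ^ 2 + a * b + b ^ 2"
    have "Re d = 0" using re unfolding d_def a_def b_def by (simp add: right_diff_distrib)
    moreover have "Im (d * g) = 0"
    proof -
      have "d * g = (w0 * a) ^ 3 - (w0 * b) ^ 3"
        unfolding d_def g_def by (simp add: power2_eq_square power3_eq_cube algebra_simps)
      then show ?thesis using u(4) u'(4) unfolding a_def b_def by simp
    qed
    moreover have "Re g > 0"
    proof -
      have n: "norm (a - 1) < 1/4" "norm (b - 1) < 1/4"
        using zz(1,3) unfolding U_def B_def a_def b_def by (auto simp: dist_norm norm_minus_commute)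
      have m: "norm (x * y - 1) < 1" if "norm (x - 1) < 1/4" "norm (y - 1) < 1/4" for x y :: complex
      proof -
        have eq: "x * y - 1 = (x - 1) * (y - 1) + (x - 1) + (y - 1)" by (simp add: algebra_simps)
        have "norm (x * y - 1) \<le> norm (x - 1) * norm (y - 1) + norm (x - 1) + norm (y - 1)"
          unfolding eq using norm_triangle_ineq[of "(x - 1) * (y - 1) + (x - 1)" "y - 1"]
            norm_triangle_ineq[of "(x - 1) * (y - 1)" "x - 1"] norm_mult[of "x - 1" "y - 1"] by linarith
        also have "norm (x - 1) * norm (y - 1) \<le> (1/4) * (1/4)" using that by (intro mult_mono) auto
        finally show ?thesis using that by simp
      qed
      have "Re (x * y) > 0" if "norm (x - 1) < 1/4" "norm (y - 1) < 1/4" for x y :: complex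
        using m[OF that] abs_Re_le_cmod[of "x * y - 1"] by simp
      from this[OF n(1,1)] this[OF n(1,2)] this[OF n(2,2)]
      show ?thesis unfolding g_def power2_eq_square by simp
    qed
    ultimately have "d = 0" by (auto simp: complex_eq_iff)
    then have "s z = s z'" using w0nz unfolding d_def a_def b_def by simp
    then show "z = z'" using u(2) u'(2) uu by simp
  qed
  then show ?thesis using that oU z0U c\<pi> by blast
qed

text \<open>Composing a chart of \<open>N\<close> with a coordinate map of \<open>H\<close> gives a
  continuous injection between subsets of \<open>real ^ 3\<close>. Its image is open by invariance
  of domain, and injectivity on \<open>H\<close> pulls this back to openness in
  \<open>H\<close>.\<close>

lemma openin_from_charts:
  fixes H :: "(complex ^ 3) set"
  assumes sub: "N \<subseteq> H"
    and H: "\<And>z. z \<in> H \<Longrightarrow> \<exists>U (\<pi> :: complex ^ 3 \<Rightarrow> real ^ 3). open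
        U \<and> z \<in> U \<and> continuous_on U \<pi> \<and> inj_on \<pi> (U \<inter> H)"
    and N: "\<And>z. z \<in> N \<Longrightarrow> \<exists>V (f :: real ^ 3 \<Rightarrow> complex ^ 3). open V
        \<and> continuous_on V f \<and> inj_on f V \<and> f ` V \<subseteq> N \<and> z \<in> f ` V"
  shows "openin (top_of_set H) N"
proof (subst openin_subopen, intro ballI)
  fix z assume z: "z \<in> N"
  obtain U and \<pi> :: "complex ^ 3 \<Rightarrow> real ^ 3" where U: "open U" "z \<in> U" "continuous_on U
      \<pi>" "inj_on \<pi> (U \<inter> H)"
    using H sub z by blast
  obtain V and f :: "real ^ 3 \<Rightarrow> complex ^ 3" where V: "open V" "continuous_on V f" "inj_on f V" "f
      ` V \<subseteq> N" "z \<in> f ` V"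
    using N[OF z] by blast
  define W where "W = V \<inter> f -` U"
  have W: "open W" unfolding W_def by (rule continuous_open_preimage[OF V(2,1) U(1)])
  have "open ((\<lambda>q. \<pi> (f q)) ` W)"
  proof (rule invariance_of_domain[OF _ W])
    show "continuous_on W (\<lambda>q. \<pi> (f q))"
      by (rule continuous_on_compose2[OF U(3) continuous_on_subset[OF V(2)]]) (auto simp: W_def)
    show "inj_on (\<lambda>q. \<pi> (f q)) W"
    proof (rule inj_onI)
      fix x y assume xy: "x \<in> W" "y \<in> W" "\<pi> (f x) = \<pi> (f y)"
      then have "f x = f y" using U(4) V(4) sub unfolding W_def inj_on_def by blast
      then show "x = y" using V(3) xy unfolding W_def inj_on_def by blast
    qed
  qed
  then have "open (U \<inter> \<pi> -` ((\<lambda>q. \<pi> (f q)) ` W))"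
    using continuous_open_preimage[OF U(3,1)] by blast
  then have "openin (top_of_set H) (H \<inter> (U \<inter> \<pi> -` ((\<lambda>q. \<pi> (f q)) ` W)))" by blast
  moreover have "H \<inter> (U \<inter> \<pi> -` ((\<lambda>q. \<pi> (f q)) ` W)) \<subseteq> N"
  proof
    fix y assume "y \<in> H \<inter> (U \<inter> \<pi> -` ((\<lambda>q. \<pi> (f q)) ` W))"
    then obtain q where q: "y \<in> H" "y \<in> U" "q \<in> W" "\<pi> y = \<pi> (f q)" by blast
    then have "y = f q" using U(4) V(4) sub unfolding W_def inj_on_def by blast
    then show "y \<in> N" using q(3) V(4) unfolding W_def by blast
  qed
  moreover have "z \<in> H \<inter> (U \<inter> \<pi> -` ((\<lambda>q. \<pi> (f q)) ` W))"
    using z sub U(2) V(5) unfolding W_def by blast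
  ultimately show "\<exists>A. openin (top_of_set H) A \<and> z \<in> A \<and> A \<subseteq> N" by blast
qed

subsection \<open>From charts to the whole submanifold\<close>

lemma special_lagrangian_chart:
  assumes "special_lagrangian L" "x \<in> L"
  obtains V f where "slag_chart L V f" "x \<in> f ` V"
proof -
  obtain V f where Vf: "local_parametrization L V f" "x \<in> f ` V"
    using assms unfolding special_lagrangian_def smooth_submanifold3_def by blast
  then have "slag_chart L V f" using assms(1) by unfold_locales
  then show ?thesis using that Vf(2) by blast
qed

lemma (in slag_chart) ball_chart:
  assumes q: "q \<in> V"
  obtains d where "d > 0" "ball q d \<subseteq> V" "slag_chart L (ball q d) f" "openin (top_of_set L) (f ` ball q d)"
proof -
  obtain d where d: "d > 0" "ball q d \<subseteq> V" using open_V q openE by blast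
  have s: "slag_chart L (ball q d) f" by (rule restrict_chart[OF open_ball d(2)])
  interpret B: slag_chart L "ball q d" f by (rule s)
  show ?thesis using that[OF d s B.openin_image] .
qed

section \<open>Global constancy and the flat case\<close>

lemma constant_on_submanifold:
  fixes F :: "complex ^ 3 \<Rightarrow> 'b::real_normed_vector"
  assumes conn: "connected L"
    and F: "\<And>x. x \<in> L \<Longrightarrow> \<exists>V f. slag_chart L V f \<and> x \<in> f ` V \<and>
      (\<forall>p\<in>V. ((\<lambda>q. F (f q)) has_derivative (\<lambda>w. 0)) (at p))"
    and xy: "x \<in> L" "y \<in> L"
  shows "F x = F y"
proof -
  have "F constant_on L"
  proof (rule locally_constant_imp_constant[OF conn])
    fix a assume "a \<in> L"
    then obtain V f q where V: "slag_chart L V f" "a = f q" "q \<in> V"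
      "\<And>p. p \<in> V \<Longrightarrow> ((\<lambda>q. F (f q)) has_derivative (\<lambda>w. 0)) (at p)"
      using F[of a] by blast
    interpret slag_chart L V f by (rule V(1))
    obtain d where d: "d > 0" "ball q d \<subseteq> V" "openin (top_of_set L) (f ` ball q d)"
      using ball_chart[OF V(3)] by blast
    have "F (f p) = F a" if "p \<in> ball q d" for p
      unfolding V(2) by (rule has_derivative_zero_unique_connected[of "ball q d" "\<lambda>q. F (f q)"])
        (use V(4) d that in auto)
    then have "\<forall>x\<in>f ` ball q d. F x = F a" by blast
    moreover have "a \<in> f ` ball q d" using d(1) V(2) by simp
    ultimately show "\<exists>T. openin (top_of_set L) T \<and> a \<in> T \<and> (\<forall>x\<in>T. F x = F a)"
      using d(3) by blast
  qed
  then show ?thesis using xy unfolding constant_on_def by auto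
qed

lemma (in slag_chart) chart_continuous: "continuous_on V f"
  by (rule smooth_on_continuous[OF smooth_f])

text \<open>A vanishing cubic makes the reflection matrix constant, hence the tangent space. Points
  of \<open>L\<close> then differ by tangent vectors, and invariance of domain gives openness in the
  affine plane.\<close>

lemma flat_imp_affine:
  assumes sl: "special_lagrangian L" and conn: "connected L" and ne: "L \<noteq> {}"
    and flat: "\<And>x. x \<in> L \<Longrightarrow> flat_at L x"
  shows "\<exists>P. affine P \<and> aff_dim P = 3 \<and> openin (top_of_set P) L"
proof -
  let ?T = "tangent_space L"
  have lag: "lagrangian (?T x)" if x: "x \<in> L" for x
  proof -
    obtain V f where V: "slag_chart L V f" "x \<in> f ` V" using special_lagrangian_chart[OF sl x] by blast
    interpret slag_chart L V f by (rule V(1))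
    show ?thesis using lagrangian_T V(2) by auto
  qed
  have const: "reflection_matrix (?T x) $ j $ k = reflection_matrix (?T y) $ j $ k"
    if "x \<in> L" "y \<in> L" for x y j k
  proof (rule constant_on_submanifold[OF conn _ that])
    fix a assume "a \<in> L"
    then obtain V f where V: "slag_chart L V f" "a \<in> f ` V" using special_lagrangian_chart[OF sl] by blast
    interpret slag_chart L V f by (rule V(1))
    have "((\<lambda>q. Tm q $ j $ k) has_derivative (\<lambda>w. 0)) (at p)" if p: "p \<in> V" for p
    proof -
      have "C p (df p w) (fr i p) (fr l p) = 0" for w i l
        using flat[OF f_in_L[OF p]] df_tangent[OF p] fr_T[OF p] unfolding flat_at_def by blast
      then show ?thesis using Tm_has_derivative[OF p, of j k] by simp
    qed
    then show "\<exists>V f. slag_chart L V f \<and> a \<in> f ` V \<and>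
      (\<forall>p\<in>V. ((\<lambda>q. reflection_matrix (?T (f q)) $ j $ k) has_derivative (\<lambda>w. 0)) (at p))"
      using V by blast
  qed
  \<comment> \<open>Tangent vectors satisfy \<open>z = M cnj z\<close>, with the same
    \<open>M\<close> at both points. Symmetry of \<open>M\<close> makes the Hermitian product of two
    such vectors real, and this is the tangency test of \<open>lagrangian_memI\<close>.\<close>
  have sub: "?T x \<subseteq> ?T y" if xy: "x \<in> L" "y \<in> L" for x y
  proof
    fix z assume z: "z \<in> ?T x"
    obtain v where v: "unitary_frame v" "\<And>a. v a \<in> ?T x" using lagrangian_frame[OF lag[OF xy(1)]] by blast
    obtain v' where v': "unitary_frame v'" "\<And>a. v' a \<in> ?T y" using lagrangian_frame[OF lag[OF xy(2)]]
        by blast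
    define M where "M = reflection_matrix (?T x)"
    have M': "reflection_matrix (?T y) = M" unfolding M_def vec_eq_iff using const[OF xy] by simp
    have sym: "M $ j $ k = M $ k $ j" for j k
      unfolding M_def reflection_matrix_frame(1)[OF lag[OF xy(1)] v] by (simp add: mult.commute)
    show "z \<in> ?T y"
    proof (rule lagrangian_memI[OF lag[OF xy(2)]])
      fix u assume u: "u \<in> ?T y"
      have "(M *v (\<chi> k. cnj (z $ k))) $ k = z $ k" for k
        using reflection_matrix_frame(2)[OF lag[OF xy(1)] v z] unfolding M_def[symmetric] by simp
      then have zM: "z $ k = (\<Sum>l\<in>UNIV. M $ k $ l * cnj (z $ l))" for k
        by (simp add: matrix_vector_mult_def)
      have "(M *v (\<chi> k. cnj (u $ k))) $ k = u $ k" for k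
        using reflection_matrix_frame(2)[OF lag[OF xy(2)] v' u] unfolding M' by simp
      then have uM: "(\<Sum>l\<in>UNIV. M $ k $ l * cnj (u $ l)) = u $ k" for k
        by (simp add: matrix_vector_mult_def)
      define S where "S = (\<Sum>k\<in>UNIV. z $ k * cnj (u $ k))"
      have "z $ k * cnj (u $ k) = (\<Sum>l\<in>UNIV. M $ l $ k * cnj (u $ k) * cnj (z $ l))" for k
        by (subst zM[of k]) (simp add: sum_distrib_left sym[of k] mult_ac)
      then have "S = (\<Sum>k\<in>UNIV. \<Sum>l\<in>UNIV. M $ l $ k * cnj (u $ k) * cnj (z $ l))"
        unfolding S_def by simp
      also have "\<dots> = (\<Sum>l\<in>UNIV. (\<Sum>k\<in>UNIV. M $ l $ k * cnj (u $ k)) * cnj (z $ l))"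
        by (subst sum.swap) (simp add: sum_distrib_right)
      also have "\<dots> = cnj S" unfolding uM S_def by (simp add: mult.commute)
      finally have "S = cnj S" .
      from arg_cong[OF this, of Im] have "Im (\<Sum>k\<in>UNIV. z $ k * cnj (u $ k)) = 0"
        unfolding S_def[symmetric] by simp
      then show "z \<bullet> (\<i> *s u) = 0" by (simp add: inner_i_right)
    qed
  qed
  obtain x0 where x0: "x0 \<in> L" using ne by blast
  define T0 where "T0 = ?T x0"
  have T0: "?T x = T0" if "x \<in> L" for x unfolding T0_def using sub[OF that x0] sub[OF x0 that] by blast
  have lag0: "lagrangian T0" unfolding T0_def by (rule lag[OF x0])
  define P where "P = (+) x0 ` T0"
  have P: "affine P" "aff_dim P = 3"
    using lag0 unfolding P_def lagrangian_def
    by (auto simp: affine_translation[symmetric] subspace_imp_affine aff_dim_translation_eq aff_dim_subspace)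
  have LP: "L \<subseteq> P"
  proof
    fix x assume x: "x \<in> L"
    have "x - x0 \<in> T0"
    proof (rule lagrangian_memI[OF lag0])
      fix u assume u: "u \<in> T0"
      \<comment> \<open>The linear function \<open>y \<bullet> (\<i> *s u)\<close> is constant on
        \<open>L\<close>: its derivative pairs two vectors of the Lagrangian space
        \<open>T0\<close>.\<close>
      have "x \<bullet> (\<i> *s u) = x0 \<bullet> (\<i> *s u)"
      proof (rule constant_on_submanifold[OF conn _ x x0])
        fix a assume a: "a \<in> L"
        then obtain V f where V: "slag_chart L V f" "a \<in> f ` V" using special_lagrangian_chart[OF sl] by blast
        interpret slag_chart L V f by (rule V(1))
        have "((\<lambda>q. f q \<bullet> (\<i> *s u)) has_derivative (\<lambda>w. 0)) (at p)" if p: "p \<in> V" for p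
        proof -
          have "((\<lambda>q. f q \<bullet> (\<i> *s u)) has_derivative (\<lambda>w. df p w \<bullet> (\<i> *s
              u))) (at p)"
            by (intro has_derivative_inner_left has_derivative_f p)
          moreover have "df p w \<bullet> (\<i> *s u) = 0" for w
            using T_inner[OF p df_tangent[OF p]] u T0[OF f_in_L[OF p]] by blast
          ultimately show ?thesis by simp
        qed
        then show "\<exists>V f. slag_chart L V f \<and> a \<in> f ` V \<and>
          (\<forall>p\<in>V. ((\<lambda>q. f q \<bullet> (\<i> *s u)) has_derivative (\<lambda>w. 0)) (at p))"
              using V by blast
      qed
      then show "(x - x0) \<bullet> (\<i> *s u) = 0" by (simp add: inner_diff_left)
    qed
    then show "x \<in> P" unfolding P_def by (intro image_eqI[of _ _ "x - x0"]) auto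
  qed
  have "openin (top_of_set P) L"
  proof (subst openin_subopen, intro ballI)
    fix x assume "x \<in> L"
    then obtain V f where V: "slag_chart L V f" "x \<in> f ` V" using special_lagrangian_chart[OF sl] by blast
    interpret slag_chart L V f by (rule V(1))
    have "openin (top_of_set P) (f ` V)"
    proof (rule invariance_of_domain_affine_sets[of UNIV V P f])
      show "openin (top_of_set UNIV) V" using open_V by simp
      show "aff_dim P \<le> aff_dim (UNIV :: (real ^ 3) set)" using P(2) by simp
      show "f \<in> V \<rightarrow> P" using f_in_L LP by auto
    qed (use P chart_continuous inj_on_f in auto)
    then show "\<exists>A. openin (top_of_set P) A \<and> x \<in> A \<and> A \<subseteq> L" using V(2) f_in_L by blast
  qed
  then show ?thesis using P by blast
qed

text \<open>The equation for \<open>dE\<close> stated without a chart, so that the numbers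
  \<open>l\<close> from different charts can be identified. The second coefficient is
  \<open>m\<close>: \<open>l = h - \<i> r\<close> gives \<open>m = - h + 3 \<i> r\<close>.\<close>

definition connection_value :: "(complex ^ 3) set \<Rightarrow> (complex ^ 3 \<Rightarrow> complex ^ 3)
    \<Rightarrow> complex ^ 3 \<Rightarrow> complex \<Rightarrow> bool" where
  "connection_value L E x l \<longleftrightarrow> (\<exists>D. (E has_derivative D) (at x within L) \<and>
     (\<forall>u\<in>tangent_space L x. D u = l *s u + (of_real (E x \<bullet> u) * Complex (- Re l) (- 3 * Im
         l)) *s E x))"

text \<open>On a tangent vector orthogonal to the axis the equation reduces to multiplication by
  \<open>l\<close>, and derivatives within \<open>L\<close> are unique on tangent vectors.\<close>

lemma (in axial_chart) connection_value_lam: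
  assumes p: "p \<in> V"
  shows "connection_value L E (f p) l \<longleftrightarrow> l = lam p"
proof -
  obtain i where i: "linear i" "\<And>v. i (df p v) = v" using obtains_left_inverse[OF p] by blast
  have D0: "(E has_derivative (\<lambda>x. De p (i x))) (at (f p) within L)"
    by (rule has_derivative_within_chart[OF p e_has_derivative[OF p] i])
  have D0u: "De p (i u) = lam p *s u + (of_real (e p \<bullet> u) * mu p) *s e p" if u: "u \<in> T p" for u
  proof -
    obtain w where "u = df p w" using T_df[OF p u] by blast
    then show ?thesis using De_eq[OF p, of w] i(2) by simp
  qed
  have "connection_value L E (f p) (lam p)"
    unfolding connection_value_def using D0 D0u by (intro exI[of _ "\<lambda>x. De p (i x)"]) auto
  moreover have "l = lam p" if l: "connection_value L E (f p) l"
  proof -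
    obtain D where D: "(E has_derivative D) (at (f p) within L)"
      "\<And>u. u \<in> T p \<Longrightarrow> D u = l *s u + (of_real (e p \<bullet> u) * Complex (- Re l) (- 3
          * Im l)) *s e p"
      using l unfolding connection_value_def by blast
    obtain v where v: "unitary_frame v" "\<And>a. v a \<in> T p" "v 1 = e p"
      using lagrangian_frame_ex[OF lagrangian_T[OF p] e_T[OF p] e_norm[OF p]] by blast
    have "v 1 \<bullet> v 2 = 0" using v(1) unfolding unitary_frame_def by simp
    then have "e p \<bullet> v 2 = 0" using v(3) by simp
    then have "l *s v 2 = lam p *s v 2"
      using D(2)[OF v(2)[of 2]] D0u[OF v(2)[of 2]] tangent_derivative_unique[OF D(1) D0 v(2)[of 2]] by auto
    then have "0 *s v 1 + (l - lam p) *s v 2 + 0 *s v 3 = 0" by (simp add: vec_eq_iff algebra_simps)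
    then show ?thesis using unitary_frame_independent(2)[OF v(1)] by fastforce
  qed
  ultimately show ?thesis by blast
qed

section \<open>The cubic vanishes identically or nowhere\<close>

lemma norm_smult: "norm (c *s z) = norm c * norm z" for z :: "complex ^ 3"
  by (simp add: norm_vec_def norm_mult L2_set_right_distrib)

lemma flat_or_axial:
  assumes sl: "special_lagrangian L" and x: "x \<in> L"
    and rot: "\<exists>e\<in>tangent_space L x. e \<noteq> 0 \<and> rotations_about (tangent_space L x) e
        \<subseteq> cubic_stabilizer L x"
  shows "flat_at L x \<or> (\<exists>E r. axial L x E r)"
proof -
  obtain V f p where V: "slag_chart L V f" "x = f p" "p \<in> V" using special_lagrangian_chart[OF sl x] by blast
  interpret slag_chart L V f by (rule V(1))
  obtain e where e: "e \<in> T p" "e \<noteq> 0" "rotations_about (T p) e \<subseteq> cubic_stabilizer L (f p)"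
    using rot V(2) by blast
  obtain E r where E: "E \<in> T p" "norm E = 1" "r \<ge> 0"
    "\<And>a b c. a \<in> T p \<Longrightarrow> b \<in> T p \<Longrightarrow> c \<in> T p \<Longrightarrow> C p
        a b c = zonal E r a b c"
    using cubic_zonal[OF V(3) e] by blast
  show ?thesis
  proof (cases "r = 0")
    case True
    then show ?thesis using E(4) V(2) by (simp add: flat_at_def)
  next
    case False
    then have "axial L x E r" using E V(2) by (simp add: axial_def)
    then show ?thesis by blast
  qed
qed

lemma inter_closure_subset_closedin:
  assumes "closedin (top_of_set S) A" "K \<subseteq> A"
  shows "S \<inter> closure K \<subseteq> A"
proof -
  obtain T where "closed T" "A = S \<inter> T" using assms(1) closedin_closed by metis
  then show ?thesis using assms(2) closure_minimal[of K T] by blast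
qed

text \<open>Along a component of the chart domain on which the cubic does not vanish, the cubic has
  size \<open>k / (norm (f q - X)) ^ 4\<close> for constants \<open>k\<close> and \<open>X\<close>, so it
  cannot tend to zero at a point of the chart.\<close>

lemma all_axial:
  assumes sl: "special_lagrangian L" and conn: "connected L"
    and dich: "\<And>x. x \<in> L \<Longrightarrow> flat_at L x \<or> axial L x (E x) (r x)"
    and x1: "x1 \<in> L" "\<not> flat_at L x1"
  shows "\<forall>x\<in>L. axial L x (E x) (r x)"
proof -
  define A where "A = {x \<in> L. \<not> flat_at L x}"
  have axA: "axial L x (E x) (r x)" if "x \<in> A" for x using dich that unfolding A_def by blast
  have nz: "x \<in> A \<longleftrightarrow> slag_chart.axis_vec L V f p \<noteq> 0" if V: "slag_chart L V f" "p
      \<in> V" "x = f p" for x V f p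
  proof -
    interpret slag_chart L V f by (rule V(1))
    show ?thesis
    proof
      assume "x \<in> A"
      then have "axial L (f p) (E x) (r x)" using axA V(3) by simp
      then have "axis_vec p = (8 * r x ^ 3) *\<^sub>R E x" "r x > 0" "norm (E x) = 1"
        using axis_vec_axial[OF V(2)] by (auto simp: axial_def)
      then show "axis_vec p \<noteq> 0" by force
    next
      assume "axis_vec p \<noteq> 0"
      then show "x \<in> A" using axis_vec_flat[OF V(2)] f_in_L[OF V(2)] V(3) unfolding A_def by blast
    qed
  qed
  have "openin (top_of_set L) A"
  proof (subst openin_subopen, intro ballI)
    fix x assume x: "x \<in> A"
    then have "x \<in> L" by (simp add: A_def)
    then obtain V f q where V: "slag_chart L V f" "x = f q" "q \<in> V" using special_lagrangian_chart[OF sl] by blast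
    interpret slag_chart L V f by (rule V(1))
    define W where "W = V \<inter> axis_vec -` (- {0})"
    have W: "open W" "W \<subseteq> V" unfolding W_def
      by (auto intro!: continuous_open_preimage smooth_on_continuous smooth_axis_vec open_V)
    interpret W: slag_chart L W f by (rule restrict_chart[OF W])
    have "f ` W \<subseteq> A" using nz[OF V(1)] unfolding W_def by auto
    moreover have "x \<in> f ` W" using nz[OF V(1) V(3) V(2)] x V unfolding W_def by auto
    ultimately show "\<exists>T. openin (top_of_set L) T \<and> x \<in> T \<and> T \<subseteq> A" using
        W.openin_image by blast
  qed
  moreover have "openin (top_of_set L) (L - A)"
  proof (subst openin_subopen, intro ballI)
    fix x assume x: "x \<in> L - A"
    then have "x \<in> L" by simp
    then obtain V f q where V: "slag_chart L V f" "x = f q" "q \<in> V" using special_lagrangian_chart[OF sl] by blast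
    interpret V: slag_chart L V f by (rule V(1))
    obtain d where d: "d > 0" "slag_chart L (ball q d) f" "openin (top_of_set L) (f ` ball q d)"
      using V.ball_chart[OF V(3)] by blast
    define B where "B = ball q d"
    interpret B: slag_chart L B f unfolding B_def by (rule d(2))
    have qB: "q \<in> B" using d(1) by (simp add: B_def)
    define W where "W = B \<inter> B.axis_vec -` (- {0})"
    have W: "open W" "W \<subseteq> B" unfolding W_def
      by (auto intro!: continuous_open_preimage smooth_on_continuous B.smooth_axis_vec B.open_V)
    have WA: "f p \<in> A \<longleftrightarrow> p \<in> W" if "p \<in> B" for p
      using nz[OF B.slag_chart_axioms that] that unfolding W_def by auto
    have "W = {}"
    proof (rule ccontr)
      assume "W \<noteq> {}"
      then obtain p1 where p1: "p1 \<in> W" by blast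
      define K where "K = connected_component_set W p1"
      have K: "open K" "connected K" "K \<subseteq> W" "p1 \<in> K"
        unfolding K_def using W(1) p1
        by (auto simp: open_connected_component connected_component_subset connected_component_refl)
      have KW: "W \<inter> closure K \<subseteq> K"
        by (rule inter_closure_subset_closedin) (auto simp: K_def closedin_connected_component)
      have "q \<notin> W" using WA[OF qB] x V(2) by simp
      \<comment> \<open>Such a boundary point exists: otherwise the component \<open>K\<close> would
        be open and closed in the ball \<open>B\<close>, hence all of it, contradicting that
        \<open>q\<close> lies outside \<open>W\<close>.\<close>
      obtain q1 where q1: "q1 \<in> B" "q1 \<in> closure K" "q1 \<notin> W"
      proof (rule ccontr)
        assume "\<not> thesis"
        then have "B \<inter> closure K \<subseteq> W" using that by blast
        then have "K = B \<inter> closure K" using KW K(3) W(2) closure_subset[of K] by blast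
        then have "closedin (top_of_set B) K" by (metis closed_closure closedin_closed)
        moreover have "openin (top_of_set B) K" using K(1,3) W(2) by (simp add: openin_open_eq B.open_V)
        ultimately have "K = {} \<or> K = B" using connected_clopen[of B] by (auto simp: B_def)
        then show False using K(3,4) qB \<open>q \<notin> W\<close> by blast
      qed
      interpret K0: slag_chart L K f by (rule B.restrict_chart) (use K W in auto)
      interpret K: axial_chart L K f E r
        by unfold_locales (use K W WA axA in auto)
      define X where "X = f p1 - inverse (K.lam p1) *s E (f p1)"
      define k where "k = r (f p1) * inverse (((K.h p1)\<^sup>2 + (r (f p1))\<^sup>2)\<^sup>2)"
      have X: "f p - inverse (K.lam p) *s E (f p) = X" if "p \<in> K" for p
        unfolding X_def
        by (rule has_derivative_zero_unique_connected[of K "\<lambda>p. f p - inverse (K.lam p) *s E (f p)"])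
          (use K that K.center_has_derivative in auto)
      have k: "r (f p) * inverse (((K.h p)\<^sup>2 + (r (f p))\<^sup>2)\<^sup>2) = k" if "p \<in> K" for p
        unfolding k_def
        by (rule has_derivative_zero_unique_connected[of K "\<lambda>p. r (f p) * inverse (((K.h p)\<^sup>2 +
            (r (f p))\<^sup>2)\<^sup>2)"])
          (use K that K.modulus_has_derivative in auto)
      have "k > 0"
      proof -
        have "r (f p1) > 0" by (rule K.rho_pos[OF K(4)])
        then have "(K.h p1)\<^sup>2 + (r (f p1))\<^sup>2 > 0" by (simp add: add_nonneg_pos)
        then show ?thesis unfolding k_def using \<open>r (f p1) > 0\<close> by simp
      qed
      \<comment> \<open>The axis vector has norm \<open>8 r ^ 3\<close> and
        \<open>r = k / norm (f p - X) ^ 4\<close> on \<open>K\<close>, so the twelfth power of the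
        distance makes the product the constant \<open>8 k ^ 3\<close>. The product is continuous on
        all of \<open>B\<close> and vanishes at \<open>q1\<close>.\<close>
      define \<phi> where "\<phi> = (\<lambda>p. norm (B.axis_vec p) * ((norm (f p - X))\<^sup>2) ^ 6)"
      have \<phi>K: "\<phi> p = 8 * k ^ 3" if p: "p \<in> K" for p
      proof -
        define s where "s = (K.h p)\<^sup>2 + (r (f p))\<^sup>2"
        have rp: "r (f p) > 0" by (rule K.rho_pos[OF p])
        then have s: "s > 0" unfolding s_def by (simp add: add_nonneg_pos)
        have "f p - X = inverse (K.lam p) *s E (f p)" using X[OF p] by (simp add: algebra_simps)
        then have "norm (f p - X) = inverse (norm (K.lam p))"
          using K.e_norm[OF p] by (simp add: norm_smult norm_inverse)
        moreover have "(norm (K.lam p))\<^sup>2 = s" unfolding s_def by (simp add: cmod_power2)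
        ultimately have n: "(norm (f p - X))\<^sup>2 = inverse s" by (simp add: power_inverse)
        have "p \<in> B" using p K(3) W(2) by blast
        from B.axis_vec_axial[OF this K.axial[OF p]]
        have "norm (B.axis_vec p) = 8 * r (f p) ^ 3" using K.e_norm[OF p] rp by simp
        moreover have "r (f p) = k * s ^ 2" using k[OF p] s unfolding s_def[symmetric] by (simp add: field_simps)
        ultimately show ?thesis unfolding \<phi>_def n using s
          by (simp add: power_mult_distrib power_inverse flip: power_mult)
      qed
      have "continuous_on B \<phi>"
        unfolding \<phi>_def
        by (intro continuous_intros smooth_on_continuous[OF B.smooth_axis_vec] B.chart_continuous)
      then have "closedin (top_of_set B) {p \<in> B. \<phi> p = 8 * k ^ 3}"
        by (rule continuous_closedin_preimage_constant)
      then have "B \<inter> closure K \<subseteq> {p \<in> B. \<phi> p = 8 * k ^ 3}"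
        by (rule inter_closure_subset_closedin) (use \<phi>K K(3) W(2) in auto)
      then have "\<phi> q1 = 8 * k ^ 3" using q1 by blast
      moreover have "\<phi> q1 = 0" using q1 unfolding \<phi>_def W_def by simp
      ultimately show False using \<open>k > 0\<close> by simp
    qed
    then have "f ` B \<subseteq> L - A" using WA B.f_in_L by blast
    then show "\<exists>T. openin (top_of_set L) T \<and> x \<in> T \<and> T \<subseteq> L - A"
      using d(3) qB V(2) unfolding B_def by blast
  qed
  then have "closedin (top_of_set L) A"
    unfolding closedin_def by (auto simp: A_def)
  ultimately have "A = {} \<or> A = L" using conn connected_clopen by metis
  then have "A = L" using x1 unfolding A_def by blast
  then show ?thesis using axA by blast
qed

section \<open>The rigid motion onto a Harvey--Lawson example\<close>

lemma phase_mult: "phase a z * phase b z = phase (a + b) z"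
  unfolding phase_def exp_add[symmetric] by (simp add: algebra_simps)

lemma cnj_phase: "cnj (phase a z) = phase (- a) z"
  unfolding phase_def exp_cnj by simp

lemma norm_phase: "norm (phase a z) = 1"
  unfolding phase_def by simp

lemma phase_0 [simp]: "phase 0 z = 1"
  unfolding phase_def by simp

lemma phase_two:
  assumes "z \<noteq> 0"
  shows "phase 2 z * cnj z = z"
proof -
  have "phase (4/3) z * (phase (- 4 / 3) z * z) = phase (4/3) z * (phase (2 / 3) z * cnj z)"
    using phase_relation[OF assms] by simp
  then show ?thesis unfolding mult.assoc[symmetric] phase_mult by simp
qed

lemma axial_conserved:
  assumes sl: "special_lagrangian L" and conn: "connected L" and ne: "L \<noteq> {}"
    and ax: "\<forall>x\<in>L. axial L x (E x) (r x)"
  obtains l X k S where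
    "\<And>x. x \<in> L \<Longrightarrow> Im (l x) = - r x"
    "\<And>x. x \<in> L \<Longrightarrow> x - inverse (l x) *s E x = X"
    "\<And>x. x \<in> L \<Longrightarrow> r x * inverse (((Re (l x))\<^sup>2 + (r x)\<^sup>2)\<^sup>2) = k"
    "\<And>x i j. x \<in> L \<Longrightarrow> phase (2/3) (l x) * reflection_matrix (tangent_space L x) $ i $ j
        + (phase (- 4/3) (l x) - phase (2/3) (l x)) * (E x $ i * E x $ j) = S i j"
proof -
  \<comment> \<open>\<open>connection_value_lam\<close> shows that exactly one value qualifies in
    any axial chart, so this is a function on \<open>L\<close> that agrees with every local
    \<open>lam\<close>.\<close>
  define l where "l = (\<lambda>x. THE l. connection_value L E x l)"
  have chart: "\<exists>V f. axial_chart L V f E r \<and> x \<in> f ` V" if x: "x \<in> L" for x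
  proof -
    obtain V f where V: "slag_chart L V f" "x \<in> f ` V" using special_lagrangian_chart[OF sl x] by blast
    interpret slag_chart L V f by (rule V(1))
    have "axial_chart L V f E r" by unfold_locales (use ax f_in_L in auto)
    then show ?thesis using V(2) by blast
  qed
  have l: "l (f p) = Complex (axial_chart.h V f E r p) (- r (f p))" if V: "axial_chart L V f E r" "p \<in> V"
      for V f p
  proof -
    interpret axial_chart L V f E r by (rule V(1))
    show ?thesis unfolding l_def connection_value_lam[OF V(2)] by simp
  qed
  have slag: "slag_chart L V f" if "axial_chart L V f E r" for V f
    using that axial_chart_def by blast
  have 1: "Im (l x) = - r x" if "x \<in> L" for x
    using chart[OF that] l by auto
  obtain x0 where x0: "x0 \<in> L" using ne by blast
  have 2: "x - inverse (l x) *s E x = x0 - inverse (l x0) *s E x0" if x: "x \<in> L" for x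
  proof (rule constant_on_submanifold[OF conn _ x x0])
    fix a assume "a \<in> L"
    then obtain V f where V: "axial_chart L V f E r" "a \<in> f ` V" using chart by blast
    interpret axial_chart L V f E r by (rule V(1))
    have "((\<lambda>q. f q - inverse (l (f q)) *s E (f q)) has_derivative (\<lambda>w. 0)) (at p)" if p: "p
        \<in> V" for p
      by (rule has_derivative_transform_within_open[OF center_has_derivative[OF p] open_V p]) (simp add: l[OF V(1)])
    then show "\<exists>V f. slag_chart L V f \<and> a \<in> f ` V \<and>
      (\<forall>p\<in>V. ((\<lambda>q. f q - inverse (l (f q)) *s E (f q)) has_derivative (\<lambda>w. 0)) (at p))"
      using V(2) slag[OF V(1)] by blast
  qed
  have 3: "r x * inverse (((Re (l x))\<^sup>2 + (r x)\<^sup>2)\<^sup>2) = r x0 * inverse (((Re (l x0))\<^sup>2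
      + (r x0)\<^sup>2)\<^sup>2)"
    if x: "x \<in> L" for x
  proof (rule constant_on_submanifold[OF conn _ x x0])
    fix a assume "a \<in> L"
    then obtain V f where V: "axial_chart L V f E r" "a \<in> f ` V" using chart by blast
    interpret axial_chart L V f E r by (rule V(1))
    have "((\<lambda>q. r (f q) * inverse (((Re (l (f q)))\<^sup>2 + (r (f q))\<^sup>2)\<^sup>2))
        has_derivative (\<lambda>w. 0)) (at p)"
      if p: "p \<in> V" for p
      by (rule has_derivative_transform_within_open[OF modulus_has_derivative[OF p] open_V p]) (simp add: l[OF V(1)])
    then show "\<exists>V f. slag_chart L V f \<and> a \<in> f ` V \<and>
      (\<forall>p\<in>V. ((\<lambda>q. r (f q) * inverse (((Re (l (f q)))\<^sup>2 + (r (f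
          q))\<^sup>2)\<^sup>2)) has_derivative (\<lambda>w. 0)) (at p))"
      using V(2) slag[OF V(1)] by blast
  qed
  define S where "S = (\<lambda>x i j. phase (2/3) (l x) * reflection_matrix (tangent_space L x) $ i $ j
        + (phase (- 4/3) (l x) - phase (2/3) (l x)) * (E x $ i * E x $ j))"
  have 4: "S x i j = S x0 i j" if x: "x \<in> L" for x i j
  proof (rule constant_on_submanifold[OF conn _ x x0])
    fix a assume "a \<in> L"
    then obtain V f where V: "axial_chart L V f E r" "a \<in> f ` V" using chart by blast
    interpret axial_chart L V f E r by (rule V(1))
    have "((\<lambda>q. S (f q) i j) has_derivative (\<lambda>w. 0)) (at p)" if p: "p \<in> V" for p
      by (rule has_derivative_transform_within_open[OF sigma_has_derivative[OF p] open_V p])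
        (simp add: S_def l[OF V(1)])
    then show "\<exists>V f. slag_chart L V f \<and> a \<in> f ` V \<and> (\<forall>p\<in>V. ((\<lambda>q. S (f
        q) i j) has_derivative (\<lambda>w. 0)) (at p))"
      using V(2) slag[OF V(1)] by blast
  qed
  show ?thesis using that[OF 1 2 3 4[unfolded S_def]] by blast
qed

lemma unitary_frame_phases:
  assumes v: "unitary_frame v" and c: "\<And>a. norm (c a) = 1"
  shows "(\<Sum>a\<in>UNIV. (c a *s v a) $ j * cnj ((c a *s v a) $ k)) = (if j = k then 1 else 0)"
    and "(\<Sum>j\<in>UNIV. (c a *s v a) $ j * cnj ((c b *s v b) $ j)) = (if a = b then 1 else 0)"
proof -
  have cc: "c a * cnj (c a) = 1" for a using complex_norm_square[of "c a"] c by simp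
  have "(c a *s v a) $ j * cnj ((c a *s v a) $ k) = (c a * cnj (c a)) * (v a $ j * cnj (v a $ k))" for a
    by (simp add: mult_ac)
  then have eq: "(c a *s v a) $ j * cnj ((c a *s v a) $ k) = v a $ j * cnj (v a $ k)" for a
    unfolding cc by simp
  show "(\<Sum>a\<in>UNIV. (c a *s v a) $ j * cnj ((c a *s v a) $ k)) = (if j = k then 1 else 0)"
    unfolding eq by (rule unitary_frame_columns(1)[OF v])
  have "(\<Sum>j\<in>UNIV. (c a *s v a) $ j * cnj ((c b *s v b) $ j))
      = (c a * cnj (c b)) * (\<Sum>j\<in>UNIV. v a $ j * cnj (v b $ j))"
    by (simp add: sum_distrib_left mult_ac)
  then show "(\<Sum>j\<in>UNIV. (c a *s v a) $ j * cnj ((c b *s v b) $ j)) = (if a = b then 1 else 0)"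
    unfolding unitary_frame_columns(2)[OF v] using cc by simp
qed

text \<open>The volume of a tangent unitary frame has modulus 1 and is real, hence is 1 or -1.
  Reversing the third vector corrects the sign and leaves \<open>E\<close> in place.\<close>

lemma special_lagrangian_frame:
  assumes T: "lagrangian T" and im: "\<And>u v w. u \<in> T \<Longrightarrow> v \<in> T \<Longrightarrow> w
      \<in> T \<Longrightarrow> Im (holomorphic_volume u v w) = 0"
    and E: "E \<in> T" "norm E = 1"
  obtains v where "unitary_frame v" "\<And>a. v a \<in> T" "v 1 = E" "holomorphic_volume (v 1) (v 2) (v 3) = 1"
proof -
  obtain v where v: "unitary_frame v" "\<And>a. v a \<in> T" "v 1 = E" using lagrangian_frame_ex[OF T E] by blast
  define h where "h = holomorphic_volume (v 1) (v 2) (v 3)"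
  have "norm h = 1" "Im h = 0" unfolding h_def using holomorphic_volume_unitary_frame[OF v(1)] im v(2) by auto
  then have h: "h = 1 \<or> h = - 1" by (auto simp: cmod_def complex_eq_iff)
  show ?thesis
  proof (cases "h = 1")
    case True
    then show ?thesis using that[of v] v unfolding h_def by blast
  next
    case False
    define v' where "v' = v(3 := - v 3)"
    have vv: "v a \<bullet> v b = (if a = b then 1 else 0)" "v a \<bullet> (\<i> *s v b) = 0" for a b
      using v(1) unfolding unitary_frame_def by auto
    have "\<i> *s (- z) = - (\<i> *s z)" for z :: "complex ^ 3" by (simp add: vec_eq_iff)
    then have "unitary_frame v'" unfolding unitary_frame_def v'_def by (simp add: vv)
    moreover have "v' a \<in> T" for a using v(2) T by (simp add: v'_def lagrangian_def subspace_neg)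
    moreover have "holomorphic_volume (v' 1) (v' 2) (v' 3) = - h"
      unfolding h_def v'_def holomorphic_volume_expand by simp
    ultimately show ?thesis using that[of v'] v(3) h False by (simp add: v'_def)
  qed
qed

lemma sum_mult_cnj_self: "(\<Sum>k\<in>UNIV. z $ k * cnj (z $ k)) = of_real ((norm z)\<^sup>2)" for z :: "complex ^ 3"
proof -
  have "(norm z)\<^sup>2 = (\<Sum>k\<in>UNIV. (norm (z $ k))\<^sup>2)"
    by (simp add: dot_square_norm[symmetric] inner_vec_def)
  then show ?thesis by (simp add: complex_norm_square del: of_real_power)
qed

text \<open>The conserved matrix factors through a unitary frame \<open>b\<close> of determinant 1
  as the sum of the products \<open>b\<^sub>a b\<^sub>a\<close>. In the coordinates of
  \<open>b\<close> the conjugation \<open>z\<close> to \<open>S cnj z\<close> becomes ordinary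
  conjugation, so the vectors that it fixes become real.\<close>

lemma axial_imp_harvey_lawson:
  assumes sl: "special_lagrangian L" and conn: "connected L" and ne: "L \<noteq> {}"
    and ax: "\<forall>x\<in>L. axial L x (E x) (r x)"
  shows "\<exists>M c. rigid_motion M \<and> openin (top_of_set (harvey_lawson c)) (M ` L)"
proof -
  obtain l X k S where
    l: "\<And>x. x \<in> L \<Longrightarrow> Im (l x) = - r x" and
    X: "\<And>x. x \<in> L \<Longrightarrow> x - inverse (l x) *s E x = X" and
    k: "\<And>x. x \<in> L \<Longrightarrow> r x * inverse (((Re (l x))\<^sup>2 + (r x)\<^sup>2)\<^sup>2) = k" and
    S: "\<And>x i j. x \<in> L \<Longrightarrow> phase (2/3) (l x) * reflection_matrix (tangent_space L x) $ i $ j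
        + (phase (- 4/3) (l x) - phase (2/3) (l x)) * (E x $ i * E x $ j) = S i j"
    using axial_conserved[OF sl conn ne ax] by blast
  have lag: "lagrangian (tangent_space L x)" if x: "x \<in> L" for x
  proof -
    obtain V f where V: "slag_chart L V f" "x \<in> f ` V" using special_lagrangian_chart[OF sl x] by blast
    interpret slag_chart L V f by (rule V(1))
    show ?thesis using lagrangian_T V(2) by auto
  qed
  have E: "E x \<in> tangent_space L x" "norm (E x) = 1" "r x > 0" if "x \<in> L" for x
    using ax that unfolding axial_def by auto
  have lnz: "l x \<noteq> 0" if "x \<in> L" for x using l[OF that] E(3)[OF that] by (auto simp: complex_eq_iff)
  obtain x0 where x0: "x0 \<in> L" using ne by blast
  have im: "Im (holomorphic_volume u v w) = 0"
    if "u \<in> tangent_space L x0" "v \<in> tangent_space L x0" "w \<in> tangent_space L x0" for u v w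
    using sl x0 that unfolding special_lagrangian_def by blast
  obtain v where v: "unitary_frame v" "\<And>a. v a \<in> tangent_space L x0" "v 1 = E x0"
    "holomorphic_volume (v 1) (v 2) (v 3) = 1"
    using special_lagrangian_frame[OF lag[OF x0] im E(1,2)[OF x0]] by blast
  \<comment> \<open>The squares of these phases are the coefficients of \<open>S\<close> in the
    frame \<open>v\<close>; the exponents add up to 0, so the determinant stays 1.\<close>
  define c where "c = (\<lambda>a :: 3. if a = 1 then phase (- 2/3) (l x0) else phase (1/3) (l x0))"
  define b where "b = (\<lambda>a. c a *s v a)"
  have nc: "norm (c a) = 1" for a by (simp add: c_def norm_phase)
  have bb: "(\<Sum>a\<in>UNIV. b a $ j * cnj (b a $ k)) = (if j = k then 1 else 0)"
    "(\<Sum>j\<in>UNIV. b a $ j * cnj (b d $ j)) = (if a = d then 1 else 0)" for a d j k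
    unfolding b_def by (rule unitary_frame_phases[OF v(1) nc])+
  have Sb: "S i j = (\<Sum>a\<in>UNIV. b a $ i * b a $ j)" for i j
  proof -
    have "S i j = phase (2/3) (l x0) * (\<Sum>a\<in>UNIV. v a $ i * v a $ j)
        + (phase (- 4/3) (l x0) - phase (2/3) (l x0)) * (v 1 $ i * v 1 $ j)"
      using S[OF x0, of i j] unfolding reflection_matrix_frame(1)[OF lag[OF x0] v(1,2)] v(3) by simp
    moreover have cc: "c 1 * c 1 = phase (- 4/3) (l x0)" "c 2 * c 2 = phase (2/3) (l x0)" "c 3 * c 3 = phase
        (2/3) (l x0)"
      by (simp_all add: c_def phase_mult)
    moreover have bc: "b a $ i * b a $ j = (c a * c a) * (v a $ i * v a $ j)" for a by (simp add: b_def)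
    ultimately show ?thesis unfolding sum_3 bc cc by (simp add: algebra_simps)
  qed
  define A :: "complex ^ 3 ^ 3" where "A = (\<chi> a j. cnj (b a $ j))"
  have A1: "map_matrix cnj (transpose A) ** A = mat 1"
    using bb(1) by (simp add: vec_eq_iff matrix_matrix_mult_def A_def transpose_def map_matrix_def mat_def)
  have "det A = cnj (holomorphic_volume (b 1) (b 2) (b 3))"
    unfolding holomorphic_volume_expand det_3 by (simp add: A_def algebra_simps)
  also have "holomorphic_volume (b 1) (b 2) (b 3) = (c 1 * (c 2 * c 3)) * holomorphic_volume (v 1) (v 2) (v 3)"
    unfolding b_def holomorphic_volume_expand by (simp add: algebra_simps)
  also have "c 1 * (c 2 * c 3) = 1" by (simp add: c_def phase_mult)
  finally have "det A = 1" using v(4) by simp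
  then have A: "special_unitary A" using A1 by (simp add: special_unitary_def)
  define M where "M = (\<lambda>z. A *v z + (- (A *v X)))"
  have M: "rigid_motion M" unfolding rigid_motion_def M_def using A by blast
  have Mx: "M x = A *v (x - X)" for x unfolding M_def by (simp add: matrix_vector_mult_diff_distrib)
  have injM: "inj M"
  proof (rule injI)
    fix x y assume "M x = M y"
    then have "A *v x = A *v y" unfolding M_def by simp
    then have "(map_matrix cnj (transpose A) ** A) *v x = (map_matrix cnj (transpose A) ** A) *v y"
      by (simp add: matrix_vector_mul_assoc[symmetric])
    then show "x = y" unfolding A1 by simp
  qed
  have contM: "continuous_on T M" for T
    unfolding M_def matrix_vector_mult_def by (intro continuous_intros)
  \<comment> \<open>The defining equation of \<open>harvey_lawson\<close> has the opposite sign to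
    \<open>Im (w ^ 3)\<close>, which will equal \<open>k\<close>.\<close>
  define c0 where "c0 = root 3 (- k)"
  have c03: "c0 ^ 3 = - k" unfolding c0_def by (intro odd_real_root_pow) simp
  have kpos: "k > 0"
  proof -
    have "(Re (l x0))\<^sup>2 + (r x0)\<^sup>2 > 0" using E(3)[OF x0] by (simp add: add_nonneg_pos)
    then show ?thesis using k[OF x0] E(3)[OF x0] by (metis inverse_positive_iff_positive mult_pos_pos zero_less_power)
  qed
  have c0: "c0 \<noteq> 0" using c03 kpos by auto
  have sub: "M ` L \<subseteq> harvey_lawson c0"
  proof
    fix z assume "z \<in> M ` L"
    then obtain x where x: "x \<in> L" "z = M x" by blast
    \<comment> \<open>The vector \<open>E x / l x\<close> is split as \<open>w *s u\<close>, with
      the phase distributed so that \<open>u\<close> is a unit vector fixed by the conserved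
      conjugation.\<close>
    define u where "u = phase (- 2/3) (l x) *s E x"
    define y where "y = A *v u"
    define w where "w = inverse (l x) * phase (2/3) (l x)"
    have nu: "norm u = 1" unfolding u_def norm_smult using E(2)[OF x(1)] by (simp add: norm_phase)
    have uu: "(\<Sum>k\<in>UNIV. u $ k * cnj (u $ k)) = 1"
      using nu by (simp add: sum_mult_cnj_self)
    have EE: "(\<Sum>k\<in>UNIV. E x $ k * cnj (E x $ k)) = 1"
      using E(2)[OF x(1)] by (simp add: sum_mult_cnj_self)
    obtain v' where v': "unitary_frame v'" "\<And>a. v' a \<in> tangent_space L x"
      using lagrangian_frame[OF lag[OF x(1)]] by blast
    have TE: "(\<Sum>k\<in>UNIV. reflection_matrix (tangent_space L x) $ i $ k * cnj (E x $ k)) = E x $ i" for i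
    proof -
      have "(reflection_matrix (tangent_space L x) *v (\<chi> k. cnj (E x $ k))) $ i = E x $ i"
        using reflection_matrix_frame(2)[OF lag[OF x(1)] v' E(1)[OF x(1)]] by simp
      then show ?thesis by (simp add: matrix_vector_mult_def)
    qed
    have Su: "(\<Sum>k\<in>UNIV. S i k * cnj (u $ k)) = u $ i" for i
    proof -
      define P where "P = phase (2/3) (l x)"
      define Q where "Q = phase (- 4/3) (l x)"
      have "S i k * cnj (u $ k) = P * (P * (reflection_matrix (tangent_space L x) $ i $ k * cnj (E x $ k))
          + (Q - P) * E x $ i * (E x $ k * cnj (E x $ k)))" for k
        unfolding S[OF x(1), symmetric] u_def P_def Q_def by (simp add: cnj_phase algebra_simps)
      then have "(\<Sum>k\<in>UNIV. S i k * cnj (u $ k)) = P * (P * E x $ i + (Q - P) * E x $ i * 1)"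
        by (simp only: sum.distrib sum_distrib_left[symmetric] TE EE)
      also have "\<dots> = (P * Q) * E x $ i" by (simp add: algebra_simps)
      also have "\<dots> = u $ i" unfolding P_def Q_def u_def phase_mult by simp
      finally show ?thesis .
    qed
    have ya: "y $ a = (\<Sum>j\<in>UNIV. cnj (b a $ j) * u $ j)" for a
      unfolding y_def A_def by (simp add: matrix_vector_mult_def)
    define Y where "Y = (\<lambda>d. \<Sum>k\<in>UNIV. b d $ k * cnj (u $ k))"
    have uY: "u $ j = (\<Sum>d\<in>UNIV. b d $ j * Y d)" for j
    proof -
      have "(\<Sum>k\<in>UNIV. S j k * cnj (u $ k)) = (\<Sum>d\<in>UNIV. b d $ j * Y d)"
        unfolding Sb Y_def sum_3 by (simp add: algebra_simps)
      then show ?thesis using Su by simp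
    qed
    \<comment> \<open>Orthonormality of \<open>b\<close> extracts the coefficient \<open>Y a\<close>
      from \<open>u = S cnj u\<close>, and \<open>Y a\<close> is the conjugate of
      \<open>y $ a\<close>.\<close>
    have yr: "y $ a = cnj (y $ a)" for a
    proof -
      have "y $ a = (\<Sum>j\<in>UNIV. cnj (b a $ j) * (\<Sum>d\<in>UNIV. b d $ j * Y d))"
        unfolding ya by (simp only: uY[symmetric])
      also have "\<dots> = (\<Sum>d\<in>UNIV. (\<Sum>j\<in>UNIV. b d $ j * cnj (b a $ j)) * Y d)"
        unfolding sum_3 by (simp add: algebra_simps)
      also have "\<dots> = Y a"
        unfolding bb(2) by (simp add: if_distrib[of "\<lambda>x. x * _"] cong: if_cong)
      also have "\<dots> = cnj (y $ a)" unfolding ya Y_def by simp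
      finally show ?thesis .
    qed
    define yy where "yy = (\<chi> a. Re (y $ a))"
    have yyy: "y = (\<chi> a. complex_of_real (yy $ a))"
      using yr unfolding yy_def vec_eq_iff by (auto simp: complex_eq_iff)
    have "(\<Sum>a\<in>UNIV. y $ a * cnj (y $ a)) = (\<Sum>j\<in>UNIV. \<Sum>k\<in>UNIV. (\<Sum>a\<in>UNIV. b a
        $ k * cnj (b a $ j)) * (u $ j * cnj (u $ k)))"
      unfolding ya by (simp only: sum_3) (simp add: algebra_simps)
    also have "\<dots> = 1"
      unfolding bb(1) using uu by (simp add: if_distrib[of "\<lambda>x. x * _"] cong: if_cong)
    finally have "(\<Sum>a\<in>UNIV. complex_of_real (yy $ a * yy $ a)) = 1" by (simp add: yyy)
    then have "complex_of_real (\<Sum>a\<in>UNIV. yy $ a * yy $ a) = 1" by simp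
    then have "(\<Sum>a\<in>UNIV. yy $ a * yy $ a) = 1" using of_real_eq_1_iff by blast
    then have nyy: "norm yy = 1" by (simp add: norm_eq_sqrt_inner inner_vec_def)
    have "x - X = inverse (l x) *s E x" using X[OF x(1)] by (simp add: algebra_simps)
    also have "E x = phase (2/3) (l x) *s u" unfolding u_def by (simp add: phase_mult mult.assoc[symmetric]
        vec_eq_iff)
    finally have "x - X = w *s u" unfolding w_def by simp
    then have z: "z = w *s y" unfolding x(2) Mx y_def by (simp add: vector_scalar_commute)
    have "Im (w ^ 3) = - (c0 ^ 3)"
    proof -
      define s where "s = (Re (l x))\<^sup>2 + (r x)\<^sup>2"
      have ls: "l x * cnj (l x) = of_real s"
        using l[OF x(1)] unfolding s_def by (simp add: complex_eq_iff power2_eq_square)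
      \<comment> \<open>The phase to the power 2 is \<open>l / cnj l\<close>, so
        \<open>w ^ 3 = cnj l / norm l ^ 4\<close>, whose imaginary part is
        \<open>r / norm l ^ 4 = k\<close>.\<close>
      have "phase (2/3) (l x) ^ 3 = phase 2 (l x)" unfolding power3_eq_cube phase_mult by simp
      then have w3: "w ^ 3 = inverse (l x) ^ 3 * phase 2 (l x)" unfolding w_def by (simp add: power_mult_distrib)
      have "w ^ 3 * (of_real s) ^ 2 = w ^ 3 * (l x * cnj (l x)) ^ 2" using ls by simp
      also have "\<dots> = inverse (l x) ^ 3 * l x ^ 2 * (phase 2 (l x) * cnj (l x)) * cnj (l x)"
        unfolding w3 by (simp add: power2_eq_square mult_ac)
      also have "\<dots> = cnj (l x)" unfolding phase_two[OF lnz[OF x(1)]] using lnz[OF x(1)]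
        by (simp add: power2_eq_square power3_eq_cube field_simps)
      finally have "w ^ 3 * of_real (s ^ 2) = cnj (l x)" by simp
      then have "Im (w ^ 3 * of_real (s ^ 2)) = r x" using l[OF x(1)] by simp
      then have "Im (w ^ 3) * s ^ 2 = r x" by simp
      moreover have "s > 0" unfolding s_def using E(3)[OF x(1)] by (simp add: add_nonneg_pos)
      ultimately have "Im (w ^ 3) = k" using k[OF x(1)] unfolding s_def[symmetric] by (simp add: field_simps)
      then show ?thesis using c03 by simp
    qed
    then show "z \<in> harvey_lawson c0" unfolding harvey_lawson_iff using nyy z yyy by blast
  qed
  have "openin (top_of_set (harvey_lawson c0)) (M ` L)"
  proof (rule openin_from_charts[OF sub])
    fix z assume z: "z \<in> harvey_lawson c0"
    obtain U and \<pi> :: "complex ^ 3 \<Rightarrow> real ^ 3" where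
      "open U" "z \<in> U" "continuous_on U \<pi>" "inj_on \<pi> (U \<inter> harvey_lawson c0)"
      by (rule harvey_lawson_local_coordinates[OF c0 z])
    then show "\<exists>U (\<pi> :: complex ^ 3 \<Rightarrow> real ^ 3). open U \<and> z \<in> U \<and>
        continuous_on U \<pi> \<and> inj_on \<pi> (U \<inter> harvey_lawson c0)"
      by blast
  next
    fix z assume "z \<in> M ` L"
    then obtain x where x: "x \<in> L" "z = M x" by blast
    obtain V f where V: "slag_chart L V f" "x \<in> f ` V" using special_lagrangian_chart[OF sl x(1)] by blast
    interpret slag_chart L V f by (rule V(1))
    have "continuous_on V (\<lambda>q. M (f q))"
      using continuous_on_compose[OF chart_continuous contM] by (simp add: o_def)
    moreover have "inj_on (\<lambda>q. M (f q)) V"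
      using inj_on_f injM by (auto simp: inj_on_def)
    moreover have "(\<lambda>q. M (f q)) ` V \<subseteq> M ` L" using f_in_L by blast
    moreover have "z \<in> (\<lambda>q. M (f q)) ` V" using V(2) x(2) by blast
    ultimately show "\<exists>V (f :: real ^ 3 \<Rightarrow> complex ^ 3). open V \<and> continuous_on V f
        \<and> inj_on f V \<and> f ` V \<subseteq> M ` L \<and> z \<in> f ` V"
      using open_V by blast
  qed
  then show ?thesis using M by blast
qed

theorem theorem1:
  fixes L :: "(complex ^ 3) set"
  assumes "special_lagrangian L"
    and "connected L"
    and "\<And>x. x \<in> L \<Longrightarrow> \<exists>e\<in>tangent_space L x. e \<noteq> 0 \<and>
           rotations_about (tangent_space L x) e \<subseteq> cubic_stabilizer L x"
  shows "(\<exists>P. affine P \<and> aff_dim P = 3 \<and> openin (top_of_set P) L) \<or>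
         (\<exists>M c. rigid_motion M \<and> openin (top_of_set (harvey_lawson c)) (M ` L))"
proof -
  have dich: "flat_at L x \<or> (\<exists>E r. axial L x E r)" if "x \<in> L" for x
    using flat_or_axial[OF assms(1) that assms(3)[OF that]] .
  consider "L = {}" | "L \<noteq> {}" "\<forall>x\<in>L. flat_at L x" | x where "x \<in> L" "\<not> flat_at L
      x" by blast
  then show ?thesis
  proof cases
    case 1
    \<comment> \<open>The empty set is open in every example, so the identity motion serves as a
      witness.\<close>
    have "map_matrix cnj (transpose (mat 1)) = (mat 1 :: complex ^ 3 ^ 3)"
      unfolding transpose_mat by (simp add: map_matrix_def mat_def vec_eq_iff)
    then have "special_unitary (mat 1)" by (simp add: special_unitary_def)
    then have "rigid_motion (\<lambda>z. mat 1 *v z + 0)" unfolding rigid_motion_def by blast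
    then show ?thesis using 1 by auto
  next
    case 2
    then show ?thesis using flat_imp_affine[OF assms(1,2)] by blast
  next
    case 3
    have "\<exists>E r. x \<in> L \<longrightarrow> flat_at L x \<or> axial L x E r" for x using dich by blast
    then obtain E r where "\<And>x. x \<in> L \<Longrightarrow> flat_at L x \<or> axial L x (E x) (r x)" by metis
    from all_axial[OF assms(1,2) this 3] have ax: "\<forall>x\<in>L. axial L x (E x) (r x)" .
    have "L \<noteq> {}" using 3 by blast
    from axial_imp_harvey_lawson[OF assms(1,2) this ax] show ?thesis by (rule disjI2)
  qed
qed

end
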